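(* Let $M^{16}$ be a compact Riemannian manifold with holonomy $\mathrm{Spin}(9)$, i.e. $M^{16}$ is either the Cayley projective plane $\mathbb{O}P^2$ or a compact quotient of the Cayley hyperbolic plane $\mathbb{O}H^2$ (with their symmetric metrics). Then its (real) Pontrjagin classes are given by $$p_1(M)=0,\qquad p_2(M)=-\frac{45}{2\pi^4}[\Phi_{\mathrm{Spin}(9)}],\qquad p_3(M)=0,\qquad p_4(M)=-\frac{13}{256\pi^8}[\tau_8(\psi)].$$
   Context: Holonomy $\mathrm{Spin}(9)$ (acting on $\mathbb{R}^{16}$ by the spin representation) gives a $\mathrm{Spin}(9)$-structure preserved by the Levi-Civita connection: a rank $9$ subbundle $V=V^9\subset\mathrm{End}(TM)$ locally spanned by $\mathcal I_1,\dots,\mathcal I_9$ with $\mathcal I_\alpha^2=\mathrm{Id}$, $\mathcal I_\alpha^*=\mathcal I_\alpha$, $\mathcal I_\alpha\mathcal I_\beta=-\mathcal I_\beta\mathcal I_\alpha$ for $\alpha\ne\beta$; $V$ carries the Euclidean metric in which such frames are orthonormal, and the Levi-Civita connection induces a metric connection on $V$. The local skew-symmetric $9\times 9$ matrix $\psi=(\psi_{\alpha\beta})$ is the matrix of curvature $2$-forms of this connection with respect to $\mathcal I_1,\dots,\mathcal I_9$; up to a constant factor depending on the scale of the metric, $\psi_{\alpha\beta}$ is the Kähler form $\langle X,\mathcal I_\alpha\mathcal I_\beta Y\rangle$ of the almost complex structure $\mathcal I_\alpha\mathcal I_\beta$. The global closed forms $\tau_4(\psi)$ ($8$-form) and $\tau_8(\psi)$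 ($16$-form) are the coefficients of $t^5$ and $t$ in $\det(tI-\psi)$ (computed in the commutative algebra of even forms), and $\Phi_{\mathrm{Spin}(9)}=\frac1{360}\tau_4(\psi)$. Brackets denote de Rham cohomology classes. *)

theory Defs
  imports "HOL-Analysis.Analysis" "HOL-Computational_Algebra.Polynomial"
begin

section \<open>Exterior algebra\<close>

text \<open>An element of the exterior algebra of the dual of \<open>real^'n\<close> is the family of its coefficients
  with respect to the monomials \<open>dx\<^sub>I = dx\<^sub>i\<^sub>1 \<and> \<dots> \<and> dx\<^sub>i\<^sub>p\<close>, where
  \<open>I = {i\<^sub>1 < \<dots> < i\<^sub>p}\<close>. Multiplication is the wedge product.\<close>

typedef 'n ext = "UNIV :: ('n set \<Rightarrow> real) set"
  morphisms ecoeff Ext by simp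

setup_lifting type_definition_ext

lemma ext_eqI: "(\<And>I. ecoeff a I = ecoeff b I) \<Longrightarrow> a = b"
  by (simp add: ecoeff_inject[symmetric] fun_eq_iff)

text \<open>For disjoint \<open>I\<close> and \<open>J\<close>, \<open>dx\<^sub>I \<and> dx\<^sub>J = shuffle_sign I J *\<^sub>R dx\<^bsub>I \<union> J\<^esub>\<close>.\<close>

definition inversions :: "'n::{finite,linorder} set \<Rightarrow> 'n set \<Rightarrow> nat" where
  "inversions I J = card {(i, j). i \<in> I \<and> j \<in> J \<and> j < i}"

definition shuffle_sign :: "'n::{finite,linorder} set \<Rightarrow> 'n set \<Rightarrow> real" where
  "shuffle_sign I J = (-1) ^ inversions I J"

lemma inversions_Un_left:
  "I \<inter> J = {} \<Longrightarrow> inversions (I \<union> J) K = inversions I K + inversions J K"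
  unfolding inversions_def
  by (subst card_Un_disjoint[symmetric]) (auto intro!: arg_cong[where f = card])

lemma inversions_Un_right:
  "J \<inter> K = {} \<Longrightarrow> inversions I (J \<union> K) = inversions I J + inversions I K"
  unfolding inversions_def
  by (subst card_Un_disjoint[symmetric]) (auto intro!: arg_cong[where f = card])

lemma inversions_swap:
  assumes "I \<inter> J = {}"
  shows "inversions I J + inversions J I = card I * card J"
proof -
  have "card {(j, i). j \<in> J \<and> i \<in> I \<and> i < j} = card {(i, j). i \<in> I \<and> j \<in> J \<and> i < j}"
    by (rule bij_betw_same_card[of prod.swap]) (auto simp: bij_betw_def inj_on_def image_def)
  then have "inversions I J + inversions J I
      = card {(i, j). i \<in> I \<and> j \<in> J \<and> j < i} + card {(i, j). i \<in> I \<and> j \<in> J \<and> i < j}"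
    by (simp add: inversions_def)
  also have "\<dots> = card ({(i, j). i \<in> I \<and> j \<in> J \<and> j < i} \<union> {(i, j). i \<in> I \<and> j \<in> J \<and> i < j})"
    by (subst card_Un_disjoint) auto
  also have "{(i, j). i \<in> I \<and> j \<in> J \<and> j < i} \<union> {(i, j). i \<in> I \<and> j \<in> J \<and> i < j} = I \<times> J"
    using assms by (auto simp: neq_iff)
  finally show ?thesis by (simp add: card_cartesian_product)
qed

lemma shuffle_sign_empty [simp]: "shuffle_sign {} I = 1" "shuffle_sign I {} = 1"
  by (simp_all add: shuffle_sign_def inversions_def)

lemma shuffle_sign_assoc:
  assumes "I \<inter> J = {}" "I \<inter> K = {}" "J \<inter> K = {}"
  shows "shuffle_sign I J * shuffle_sign (I \<union> J) K = shuffle_sign I (J \<union> K) * shuffle_sign J K"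
  using assms
  by (simp add: shuffle_sign_def inversions_Un_left inversions_Un_right power_add)

lemma shuffle_sign_commute:
  assumes "I \<inter> J = {}" "even (card I)"
  shows "shuffle_sign I J = shuffle_sign J I"
proof -
  have "even (inversions I J + inversions J I)"
    using assms by (simp add: inversions_swap)
  then show ?thesis
    by (simp add: shuffle_sign_def minus_one_power_iff)
qed

instantiation ext :: (type) real_vector
begin

lift_definition zero_ext :: "'a ext" is "\<lambda>I. 0" .
lift_definition plus_ext :: "'a ext \<Rightarrow> 'a ext \<Rightarrow> 'a ext" is "\<lambda>a b I. a I + b I" .
lift_definition minus_ext :: "'a ext \<Rightarrow> 'a ext \<Rightarrow> 'a ext" is "\<lambda>a b I. a I - b I" .
lift_definition uminus_ext :: "'a ext \<Rightarrow> 'a ext" is "\<lambda>a I. - a I" .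
lift_definition scaleR_ext :: "real \<Rightarrow> 'a ext \<Rightarrow> 'a ext" is "\<lambda>r a I. r * a I" .

instance
  by standard (transfer; simp add: fun_eq_iff algebra_simps)+

end

lemma wedge_assoc_aux:
  fixes a b c :: "'n::{finite,linorder} set \<Rightarrow> real"
  shows "(\<Sum>L\<in>Pow K. shuffle_sign L (K - L) *
            (\<Sum>I\<in>Pow L. shuffle_sign I (L - I) * a I * b (L - I)) * c (K - L))
       = (\<Sum>I\<in>Pow K. shuffle_sign I (K - I) * a I *
            (\<Sum>J\<in>Pow (K - I). shuffle_sign J (K - I - J) * b J * c (K - I - J)))"
  (is "?l = ?r")
proof -
  let ?f = "\<lambda>L I. shuffle_sign L (K - L) * (shuffle_sign I (L - I) * a I * b (L - I)) * c (K - L)"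
  let ?g = "\<lambda>I J. shuffle_sign I (K - I) * a I * (shuffle_sign J (K - I - J) * b J * c (K - I - J))"
  have "?l = (\<Sum>(L, I)\<in>Sigma (Pow K) Pow. ?f L I)"
    by (simp add: sum_distrib_left sum_distrib_right sum.Sigma)
  also have "\<dots> = (\<Sum>(I, J)\<in>Sigma (Pow K) (\<lambda>I. Pow (K - I)). ?g I J)"
  proof (rule sum.reindex_bij_witness[where i = "\<lambda>(I, J). (I \<union> J, I)" and j = "\<lambda>(L, I). (I, L - I)"])
    fix x assume "x \<in> Sigma (Pow K) Pow"
    then obtain L I where x: "x = (L, I)" "L \<subseteq> K" "I \<subseteq> L" by auto
    have eq: "K - I - (L - I) = K - L" "I \<union> (L - I) = L" "(L - I) \<union> (K - L) = K - I"
      using x by auto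
    have "shuffle_sign I (L - I) * shuffle_sign (I \<union> (L - I)) (K - L)
        = shuffle_sign I ((L - I) \<union> (K - L)) * shuffle_sign (L - I) (K - L)"
      by (rule shuffle_sign_assoc) (use x in auto)
    then have s: "shuffle_sign L (K - L) * shuffle_sign I (L - I)
        = shuffle_sign I (K - I) * shuffle_sign (L - I) (K - L)"
      unfolding eq by (simp add: mult_ac)
    show "(case case x of (L, I) \<Rightarrow> (I, L - I) of (I, J) \<Rightarrow> ?g I J) = (case x of (L, I) \<Rightarrow> ?f L I)"
      unfolding x prod.case eq(1) using s by (simp add: algebra_simps)
  qed auto
  also have "\<dots> = ?r"
    by (simp add: sum_distrib_left sum.Sigma)
  finally show ?thesis .
qed

instantiation ext :: ("{finite,linorder}") real_algebra_1
begin

lift_definition one_ext :: "'a ext" is "\<lambda>I. if I = {} then 1 else 0" .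
lift_definition times_ext :: "'a ext \<Rightarrow> 'a ext \<Rightarrow> 'a ext" is
  "\<lambda>a b K. \<Sum>I\<in>Pow K. shuffle_sign I (K - I) * a I * b (K - I)" .

instance
proof
  fix a b c :: "'a ext" and r :: real
  show "a * b * c = a * (b * c)"
    by transfer (simp add: fun_eq_iff wedge_assoc_aux)
  show "(a + b) * c = a * c + b * c" "a * (b + c) = a * b + a * c"
    by (transfer; simp add: fun_eq_iff algebra_simps sum.distrib)+
  show "r *\<^sub>R a * b = r *\<^sub>R (a * b)" "a * r *\<^sub>R b = r *\<^sub>R (a * b)"
    by (transfer; simp add: fun_eq_iff sum_distrib_left algebra_simps)+
  show "1 * a = a"
  proof (transfer, rule ext)
    fix a :: "'a set \<Rightarrow> real" and K
    have "(\<Sum>I\<in>Pow K. shuffle_sign I (K - I) * (if I = {} then 1 else 0) * a (K - I))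
        = (\<Sum>I\<in>Pow K. if I = {} then a K else 0)"
      by (rule sum.cong) auto
    then show "(\<Sum>I\<in>Pow K. shuffle_sign I (K - I) * (if I = {} then 1 else 0) * a (K - I)) = a K"
      by (simp add: sum.delta)
  qed
  show "a * 1 = a"
  proof (transfer, rule ext)
    fix a :: "'a set \<Rightarrow> real" and K
    have "(\<Sum>I\<in>Pow K. shuffle_sign I (K - I) * a I * (if K - I = {} then 1 else 0))
        = (\<Sum>I\<in>Pow K. if I = K then a K else 0)"
      by (rule sum.cong) auto
    then show "(\<Sum>I\<in>Pow K. shuffle_sign I (K - I) * a I * (if K - I = {} then 1 else 0)) = a K"
      by (simp add: sum.delta)
  qed
  show "(0::'a ext) \<noteq> 1"
    by transfer (simp add: fun_eq_iff)
qed

end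

lift_definition dx :: "'n \<Rightarrow> 'n ext" is "\<lambda>i I. if I = {i} then 1 else 0" .

text \<open>The commutative algebra of even forms.\<close>

typedef 'n even_ext = "{a :: 'n ext. \<forall>I. odd (card I) \<longrightarrow> ecoeff a I = 0}"
  morphisms form_of even_of
  by (rule exI[of _ 0]) (simp add: zero_ext.rep_eq)

setup_lifting type_definition_even_ext

instantiation even_ext :: (type) real_vector
begin

lift_definition zero_even_ext :: "'a even_ext" is 0 by (simp add: zero_ext.rep_eq)
lift_definition plus_even_ext :: "'a even_ext \<Rightarrow> 'a even_ext \<Rightarrow> 'a even_ext" is "(+)"
  by (simp add: plus_ext.rep_eq)
lift_definition minus_even_ext :: "'a even_ext \<Rightarrow> 'a even_ext \<Rightarrow> 'a even_ext" is "(-)"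
  by (simp add: minus_ext.rep_eq)
lift_definition uminus_even_ext :: "'a even_ext \<Rightarrow> 'a even_ext" is uminus
  by (simp add: uminus_ext.rep_eq)
lift_definition scaleR_even_ext :: "real \<Rightarrow> 'a even_ext \<Rightarrow> 'a even_ext" is scaleR
  by (simp add: scaleR_ext.rep_eq)

instance
  by standard (transfer; simp add: algebra_simps)+

end

lemma even_mult_closed:
  fixes a b :: "'n::{finite,linorder} ext"
  assumes "\<forall>I. odd (card I) \<longrightarrow> ecoeff a I = 0" "\<forall>I. odd (card I) \<longrightarrow> ecoeff b I = 0"
    and "odd (card K)"
  shows "ecoeff (a * b) K = 0"
  unfolding times_ext.rep_eq
proof (rule sum.neutral, rule ballI)
  fix I assume "I \<in> Pow K"
  then have "card K = card I + card (K - I)"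
    by (simp add: card_Diff_subset card_mono)
  then have "odd (card I) \<or> odd (card (K - I))" using assms(3) by auto
  then show "shuffle_sign I (K - I) * ecoeff a I * ecoeff b (K - I) = 0"
    using assms(1,2) by auto
qed

lemma even_mult_commute:
  fixes a b :: "'n::{finite,linorder} ext"
  assumes "\<forall>I. odd (card I) \<longrightarrow> ecoeff a I = 0"
  shows "a * b = b * a"
proof (rule ext_eqI)
  fix K
  have "ecoeff (a * b) K = (\<Sum>I\<in>Pow K. shuffle_sign (K - I) I * ecoeff b (K - I) * ecoeff a I)"
    unfolding times_ext.rep_eq
  proof (rule sum.cong)
    fix I assume "I \<in> Pow K"
    show "shuffle_sign I (K - I) * ecoeff a I * ecoeff b (K - I)
        = shuffle_sign (K - I) I * ecoeff b (K - I) * ecoeff a I"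
      using assms shuffle_sign_commute[of I "K - I"] by (cases "even (card I)") auto
  qed simp
  also have "\<dots> = ecoeff (b * a) K"
    unfolding times_ext.rep_eq
    by (rule sum.reindex_bij_witness[where i = "\<lambda>I. K - I" and j = "\<lambda>I. K - I"])
       (auto simp: double_diff)
  finally show "ecoeff (a * b) K = ecoeff (b * a) K" .
qed

instantiation even_ext :: ("{finite,linorder}") "{comm_ring_1, real_algebra_1}"
begin

lift_definition one_even_ext :: "'a even_ext" is 1 by (auto simp: one_ext.rep_eq)
lift_definition times_even_ext :: "'a even_ext \<Rightarrow> 'a even_ext \<Rightarrow> 'a even_ext" is "(*)"
  using even_mult_closed by blast

instance
proof
  fix a b c :: "'a even_ext" and r :: real
  show "a * b * c = a * (b * c)" by transfer (simp add: mult.assoc)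
  show "a * b = b * a" by transfer (rule even_mult_commute)
  show "1 * a = a" "a * 1 = a" by (transfer; simp)+
  show "(a + b) * c = a * c + b * c" "a * (b + c) = a * b + a * c"
    by (transfer; simp add: algebra_simps)+
  show "r *\<^sub>R a * b = r *\<^sub>R (a * b)" "a * r *\<^sub>R b = r *\<^sub>R (a * b)" by (transfer; simp)+
  show "(0::'a even_ext) \<noteq> 1" by transfer simp
qed

end

lemma dx_mult_even:
  fixes i j :: "'n::{finite,linorder}"
  assumes "odd (card K)"
  shows "ecoeff (dx i * dx j) K = 0"
  unfolding times_ext.rep_eq dx.rep_eq
proof (rule sum.neutral, rule ballI)
  fix I assume "I \<in> Pow K"
  then have K: "card K = card I + card (K - I)"
    by (simp add: card_Diff_subset card_mono)
  have "I \<noteq> {i} \<or> K - I \<noteq> {j}"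
  proof (rule ccontr)
    assume "\<not> ?thesis"
    then have "card I = 1" "card (K - I) = 1" by auto
    then show False using K assms by simp
  qed
  then show "shuffle_sign I (K - I) * (if I = {i} then 1 else 0) * (if K - I = {j} then 1 else 0) = 0"
    by auto
qed

lemma ecoeff_sum: "ecoeff (sum f S) I = (\<Sum>s\<in>S. ecoeff (f s) I)"
  by (induction S rule: infinite_finite_induct) (simp_all add: zero_ext.rep_eq plus_ext.rep_eq)

text \<open>The 2-form with values \<open>B i j\<close> on the coordinate vector fields, for skew-symmetric \<open>B\<close>.\<close>

lift_definition two_form :: "('n::{finite,linorder} \<Rightarrow> 'n \<Rightarrow> real) \<Rightarrow> 'n even_ext" is
  "\<lambda>B. \<Sum>i\<in>UNIV. \<Sum>j | i < j. B i j *\<^sub>R (dx i * dx j)"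
  by (simp add: ecoeff_sum scaleR_ext.rep_eq dx_mult_even)

text \<open>\<open>det (t I - N)\<close>, as a polynomial in \<open>t\<close> over the even forms.\<close>

definition char_form :: "('n::{finite,linorder} even_ext)^'m^'m \<Rightarrow> 'n even_ext poly" where
  "char_form N = det (\<chi> a b. (if a = b then [:0, 1:] else 0) - [:N $ a $ b:])"

text \<open>Pull-back along a linear map: the algebra homomorphism sending \<open>dx\<^sub>k\<close> to
  \<open>\<Sum>i. J\<^sub>k\<^sub>i dx\<^sub>i\<close>.\<close>

definition pull_back ::
  "real^('n::{finite,linorder})^('n::{finite,linorder}) \<Rightarrow> 'n ext \<Rightarrow> 'n ext" where
  "pull_back J a = (\<Sum>K\<in>UNIV. ecoeff a K *\<^sub>R
     prod_list (map (\<lambda>k. \<Sum>i\<in>UNIV. J $ k $ i *\<^sub>R dx i) (sorted_list_of_set K)))"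


section \<open>Smooth functions on open subsets of coordinate space\<close>

definition pd :: "'n \<Rightarrow> (real^'n \<Rightarrow> 'b::real_normed_vector) \<Rightarrow> real^'n \<Rightarrow> 'b" where
  "pd i f x = frechet_derivative f (at x) (axis i 1)"

primrec Ck_on :: "nat \<Rightarrow> (real^'n \<Rightarrow> 'b::real_normed_vector) \<Rightarrow> (real^'n) set \<Rightarrow> bool" where
  "Ck_on 0 f S \<longleftrightarrow> continuous_on S f"
| "Ck_on (Suc k) f S \<longleftrightarrow> (\<forall>x\<in>S. f differentiable (at x)) \<and> (\<forall>i. Ck_on k (pd i f) S)"

definition smooth_on :: "(real^'n) set \<Rightarrow> (real^'n \<Rightarrow> 'b::real_normed_vector) \<Rightarrow> bool" where
  "smooth_on S f \<longleftrightarrow> (\<forall>k. Ck_on k f S)"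


section \<open>Smooth manifolds\<close>

text \<open>The underlying space of the manifold is the whole type \<open>'a\<close>. Tensor fields, forms and
  connections are given by their components in the charts of an atlas \<open>A\<close>, subject to the usual
  transformation laws; their values outside the charts carry no information.\<close>

type_synonym ('a, 'n) chart = "'a set \<times> ('a \<Rightarrow> real^'n)"

definition is_chart :: "('a::topological_space, 'n::finite) chart \<Rightarrow> bool" where
  "is_chart c \<longleftrightarrow> open (fst c) \<and> open (snd c ` fst c) \<and>
     homeomorphism (fst c) (snd c ` fst c) (snd c) (inv_into (fst c) (snd c))"

definition transition :: "('a, 'n::finite) chart \<Rightarrow> ('a, 'n) chart \<Rightarrow> real^'n \<Rightarrow> real^'n" where
  "transition c d = snd d \<circ> inv_into (fst c) (snd c)"

definition smooth_atlas :: "('a::topological_space, 'n::finite) chart set \<Rightarrow> bool" where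
  "smooth_atlas A \<longleftrightarrow> (\<Union>c\<in>A. fst c) = UNIV \<and> (\<forall>c\<in>A. is_chart c) \<and>
     (\<forall>c\<in>A. \<forall>d\<in>A. smooth_on (snd c ` (fst c \<inter> fst d)) (transition c d))"

text \<open>The Jacobian matrix, at the point with coordinates \<open>x\<close> in \<open>c\<close>, of the coordinate change from
  \<open>c\<close> to \<open>d\<close>.\<close>

definition jac :: "('a, 'n::finite) chart \<Rightarrow> ('a, 'n) chart \<Rightarrow> real^'n \<Rightarrow> real^'n^'n" where
  "jac c d x = jacobian (transition c d) (at x)"


section \<open>Differential forms and de Rham cohomology\<close>

type_synonym ('a, 'n) form_field = "('a, 'n) chart \<Rightarrow> real^'n \<Rightarrow> 'n ext"

definition is_form :: "('a, 'n::{finite,linorder}) chart set \<Rightarrow> nat \<Rightarrow> ('a, 'n) form_field \<Rightarrow> bool" where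
  "is_form A k \<omega> \<longleftrightarrow>
     (\<forall>c\<in>A. \<forall>I. smooth_on (snd c ` fst c) (\<lambda>x. ecoeff (\<omega> c x) I)) \<and>
     (\<forall>c\<in>A. \<forall>x\<in>snd c ` fst c. \<forall>I. card I \<noteq> k \<longrightarrow> ecoeff (\<omega> c x) I = 0) \<and>
     (\<forall>c\<in>A. \<forall>d\<in>A. \<forall>x\<in>snd c ` (fst c \<inter> fst d).
        \<omega> c x = pull_back (jac c d x) (\<omega> d (transition c d x)))"

definition ext_deriv :: "('a, 'n::{finite,linorder}) form_field \<Rightarrow> ('a, 'n) form_field" where
  "ext_deriv \<omega> c x = (\<Sum>i\<in>UNIV. dx i * Ext (\<lambda>I. pd i (\<lambda>y. ecoeff (\<omega> c y) I) x))"

definition closed_form :: "('a, 'n::{finite,linorder}) chart set \<Rightarrow> nat \<Rightarrow> ('a, 'n) form_field \<Rightarrow> bool" where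
  "closed_form A k \<omega> \<longleftrightarrow> is_form A k \<omega> \<and> (\<forall>c\<in>A. \<forall>x\<in>snd c ` fst c. ext_deriv \<omega> c x = 0)"

text \<open>The class of \<open>\<omega>\<close> in the degree \<open>k\<close> cohomology, as a coset of the exact forms. (For \<open>k = 0\<close> the
  primitive \<open>\<theta>\<close> is a function and the degree condition on \<open>\<eta>\<close> and \<open>\<omega>\<close> forces
  \<open>ext_deriv \<theta> = 0\<close>, as it should be.)\<close>

definition de_rham_class ::
  "('a, 'n::{finite,linorder}) chart set \<Rightarrow> nat \<Rightarrow> ('a, 'n) form_field \<Rightarrow> ('a, 'n) form_field set" where
  "de_rham_class A k \<omega> = {\<eta>. closed_form A k \<eta> \<and>
     (\<exists>\<theta>. is_form A (k - 1) \<theta> \<and> (\<forall>c\<in>A. \<forall>x\<in>snd c ` fst c. \<eta> c x = \<omega> c x + ext_deriv \<theta> c x))}"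


section \<open>Connections on the tangent bundle and Pontrjagin classes\<close>

text \<open>In the chart \<open>c\<close> the covariant derivative of a vector field \<open>v\<close> along the \<open>i\<close>-th coordinate
  field is \<open>pd i v x + D c x i *v v x\<close>; the Christoffel symbol \<open>\<Gamma>\<^sup>k\<^sub>i\<^sub>j\<close> is
  \<open>D c x i $ k $ j\<close>.\<close>

type_synonym ('a, 'n) connection = "('a, 'n) chart \<Rightarrow> real^'n \<Rightarrow> 'n \<Rightarrow> real^'n^'n"

definition is_connection :: "('a, 'n::finite) chart set \<Rightarrow> ('a, 'n) connection \<Rightarrow> bool" where
  "is_connection A D \<longleftrightarrow>
     (\<forall>c\<in>A. \<forall>i. smooth_on (snd c ` fst c) (\<lambda>x. D c x i)) \<and>
     (\<forall>c\<in>A. \<forall>d\<in>A. \<forall>x\<in>snd c ` (fst c \<inter> fst d). \<forall>i.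
        jac c d x ** D c x i =
          pd i (jac c d) x + (\<Sum>l\<in>UNIV. jac c d x $ l $ i *\<^sub>R D d (transition c d x) l) ** jac c d x)"

text \<open>The curvature endomorphism \<open>\<nabla>\<^sub>i\<nabla>\<^sub>j - \<nabla>\<^sub>j\<nabla>\<^sub>i\<close> of the tangent bundle and the
  matrix of curvature 2-forms in a coordinate frame.\<close>

definition curvature :: "('a, 'n::finite) connection \<Rightarrow> ('a, 'n) chart \<Rightarrow> real^'n \<Rightarrow> 'n \<Rightarrow> 'n \<Rightarrow> real^'n^'n" where
  "curvature D c x i j =
     pd i (\<lambda>y. D c y j) x - pd j (\<lambda>y. D c y i) x + D c x i ** D c x j - D c x j ** D c x i"

definition curvature_forms ::
  "('a, 'n::{finite,linorder}) connection \<Rightarrow> ('a, 'n) chart \<Rightarrow> real^('n::{finite,linorder}) \<Rightarrow>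
     ('n even_ext)^('n::{finite,linorder})^('n::{finite,linorder})" where
  "curvature_forms D c x = (\<chi> k l. two_form (\<lambda>i j. curvature D c x i j $ k $ l))"

text \<open>Chern-Weil: \<open>p\<^sub>k\<close> is represented by the coefficient of \<open>t^(n - 2 * k)\<close> in
  \<open>det (t I - \<Omega> / (2 * pi))\<close>, for the curvature \<open>\<Omega>\<close> of any connection on the tangent bundle.\<close>

definition pontrjagin_form :: "('a, 'n::{finite,linorder}) connection \<Rightarrow> nat \<Rightarrow> ('a, 'n) form_field" where
  "pontrjagin_form D k c x =
     form_of (coeff (char_form (\<chi> a b. (1 / (2 * pi)) *\<^sub>R curvature_forms D c x $ a $ b))
       (CARD('n) - 2 * k))"

definition pontrjagin_class ::
  "('a, 'n::{finite,linorder}) chart set \<Rightarrow> nat \<Rightarrow> ('a, 'n) form_field set" where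
  "pontrjagin_class A k =
     de_rham_class A (4 * k) (pontrjagin_form (SOME D. is_connection A D) k)"


section \<open>Riemannian metrics and holonomy\<close>

type_synonym ('a, 'n) metric = "('a, 'n) chart \<Rightarrow> real^'n \<Rightarrow> real^'n^'n"

definition riemannian_metric :: "('a, 'n::finite) chart set \<Rightarrow> ('a, 'n) metric \<Rightarrow> bool" where
  "riemannian_metric A g \<longleftrightarrow>
     (\<forall>c\<in>A. smooth_on (snd c ` fst c) (g c)) \<and>
     (\<forall>c\<in>A. \<forall>x\<in>snd c ` fst c. transpose (g c x) = g c x \<and> (\<forall>v. v \<noteq> 0 \<longrightarrow> v \<bullet> (g c x *v v) > 0)) \<and>
     (\<forall>c\<in>A. \<forall>d\<in>A. \<forall>x\<in>snd c ` (fst c \<inter> fst d).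
        g c x = transpose (jac c d x) ** g d (transition c d x) ** jac c d x)"

definition levi_civita ::
  "('a, 'n::finite) chart set \<Rightarrow> ('a, 'n) metric \<Rightarrow> ('a, 'n) connection \<Rightarrow> bool" where
  "levi_civita A g D \<longleftrightarrow> is_connection A D \<and>
     (\<forall>c\<in>A. \<forall>x\<in>snd c ` fst c. \<forall>i.
        (\<forall>j k. D c x i $ k $ j = D c x j $ k $ i) \<and>
        pd i (g c) x = transpose (D c x i) ** g c x + g c x ** D c x i)"

text \<open>A closed subinterval of \<open>{0..1}\<close> without break points in its interior, mapped by \<open>\<gamma>\<close> into the
  domain of \<open>c\<close>.\<close>

definition chart_piece ::
  "(real \<Rightarrow> 'a) \<Rightarrow> real set \<Rightarrow> ('a, 'n::finite) chart \<Rightarrow> real \<Rightarrow> real \<Rightarrow> bool" where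
  "chart_piece \<gamma> S c a b \<longleftrightarrow>
     0 \<le> a \<and> a < b \<and> b \<le> 1 \<and> {a<..<b} \<inter> S = {} \<and> \<gamma> ` {a..b} \<subseteq> fst c"

definition piecewise_C1_curve ::
  "('a::topological_space, 'n::finite) chart set \<Rightarrow> (real \<Rightarrow> 'a) \<Rightarrow> real set \<Rightarrow> bool" where
  "piecewise_C1_curve A \<gamma> S \<longleftrightarrow> continuous_on {0..1} \<gamma> \<and> finite S \<and>
     (\<forall>c\<in>A. \<forall>a b. chart_piece \<gamma> S c a b \<longrightarrow>
        (\<exists>h. continuous_on {a..b} h \<and>
          (\<forall>t\<in>{a..b}. ((\<lambda>t. snd c (\<gamma> t)) has_vector_derivative h t) (at t within {a..b}))))"

text \<open>\<open>X t c\<close> are the components in the chart \<open>c\<close> of a tangent vector at \<open>\<gamma> t\<close>.\<close>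

definition parallel_along ::
  "('a, 'n::finite) chart set \<Rightarrow> ('a, 'n) connection \<Rightarrow> (real \<Rightarrow> 'a) \<Rightarrow> real set \<Rightarrow>
     (real \<Rightarrow> ('a, 'n) chart \<Rightarrow> real^'n) \<Rightarrow> bool" where
  "parallel_along A D \<gamma> S X \<longleftrightarrow>
     (\<forall>t\<in>{0..1}. \<forall>c\<in>A. \<forall>d\<in>A. \<gamma> t \<in> fst c \<inter> fst d \<longrightarrow> X t d = jac c d (snd c (\<gamma> t)) *v X t c) \<and>
     (\<forall>c\<in>A. \<forall>a b. chart_piece \<gamma> S c a b \<longrightarrow>
        (\<forall>t\<in>{a..b}.
          ((\<lambda>t. X t c) has_vector_derivative
             - (\<Sum>i\<in>UNIV. (vector_derivative (\<lambda>t. snd c (\<gamma> t)) (at t within {a..b}) $ i) *\<^sub>R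
                   (D c (snd c (\<gamma> t)) i *v X t c))) (at t within {a..b})))"

text \<open>The holonomy group at \<open>p\<close>, as a group of matrices by means of the coordinate basis of the
  tangent space at \<open>p\<close> given by \<open>c\<close>.\<close>

definition holonomy_group ::
  "('a::topological_space, 'n::finite) chart set \<Rightarrow> ('a, 'n) connection \<Rightarrow> ('a, 'n) chart \<Rightarrow> 'a \<Rightarrow>
     (real^'n^'n) set" where
  "holonomy_group A D c p = {P. \<exists>\<gamma> S. piecewise_C1_curve A \<gamma> S \<and> \<gamma> 0 = p \<and> \<gamma> 1 = p \<and>
     (\<forall>v. \<exists>X. parallel_along A D \<gamma> S X \<and> X 0 c = v \<and> X 1 c = P *v v)}"


section \<open>Spin(9)-structures\<close>

text \<open>\<open>G\<close> is the Gram matrix of the inner product.\<close>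

definition clifford_system :: "real^'n^'n \<Rightarrow> ('r \<Rightarrow> real^'n^'n) \<Rightarrow> bool" where
  "clifford_system G E \<longleftrightarrow>
     (\<forall>\<alpha>. E \<alpha> ** E \<alpha> = mat 1 \<and> transpose (E \<alpha>) ** G = G ** E \<alpha>) \<and>
     (\<forall>\<alpha> \<beta>. \<alpha> \<noteq> \<beta> \<longrightarrow> E \<alpha> ** E \<beta> = - (E \<beta> ** E \<alpha>))"

definition clifford_mult :: "('r::finite \<Rightarrow> real^'n^'n) \<Rightarrow> real^'r \<Rightarrow> real^'n^'n" where
  "clifford_mult E u = (\<Sum>\<alpha>\<in>UNIV. u $ \<alpha> *\<^sub>R E \<alpha>)"

text \<open>The image of the spin group under the representation defined by \<open>E\<close>: the products of an even
  number of unit vectors. If \<open>'r = 9\<close> and \<open>'n = 16\<close>, this is the spin representation of Spin(9),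
  which is faithful.\<close>

inductive_set spin_group :: "('r::finite \<Rightarrow> real^'n^'n) \<Rightarrow> (real^'n^'n) set" for E where
  one: "mat 1 \<in> spin_group E"
| mult: "P \<in> spin_group E \<Longrightarrow> norm u = 1 \<Longrightarrow> norm v = 1 \<Longrightarrow>
    P ** clifford_mult E u ** clifford_mult E v \<in> spin_group E"

text \<open>All systems \<open>E\<close> as below are, up to a simultaneous change of sign, conjugate by isometries, so
  the condition says that some isometry from the tangent space at \<open>p\<close> to \<open>real^16\<close> carries the holonomy
  group to Spin(9). On a connected manifold it does not depend on \<open>p\<close> and \<open>c\<close>.\<close>

definition has_holonomy_Spin9 ::
  "('a::topological_space, 16) chart set \<Rightarrow> ('a, 16) metric \<Rightarrow> ('a, 16) connection \<Rightarrow> bool" where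
  "has_holonomy_Spin9 A g D \<longleftrightarrow>
     (\<exists>c\<in>A. \<exists>p\<in>fst c. \<exists>E :: 9 \<Rightarrow> real^16^16.
        clifford_system (g c (snd c p)) E \<and> holonomy_group A D c p = spin_group E)"

text \<open>A subbundle \<open>V\<close> of the endomorphism bundle of the tangent bundle: \<open>V c x\<close> is its fibre at the
  point with coordinates \<open>x\<close>, in the chart \<open>c\<close>.\<close>

type_synonym ('a, 'n) end_subbundle = "('a, 'n) chart \<Rightarrow> real^'n \<Rightarrow> (real^'n^'n) set"

definition local_frame ::
  "('a, 16) metric \<Rightarrow> ('a, 16) end_subbundle \<Rightarrow> ('a, 16) chart \<Rightarrow> (real^16) set \<Rightarrow>
     (9 \<Rightarrow> real^16 \<Rightarrow> real^16^16) \<Rightarrow> bool" where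
  "local_frame g V c W E \<longleftrightarrow> open W \<and> W \<subseteq> snd c ` fst c \<and> (\<forall>\<alpha>. smooth_on W (E \<alpha>)) \<and>
     (\<forall>y\<in>W. clifford_system (g c y) (\<lambda>\<alpha>. E \<alpha> y) \<and> V c y = span (range (\<lambda>\<alpha>. E \<alpha> y)))"

definition Spin9_structure ::
  "('a, 16) chart set \<Rightarrow> ('a, 16) metric \<Rightarrow> ('a, 16) end_subbundle \<Rightarrow> bool" where
  "Spin9_structure A g V \<longleftrightarrow>
     (\<forall>c\<in>A. \<forall>x\<in>snd c ` fst c. \<exists>W E. x \<in> W \<and> local_frame g V c W E) \<and>
     (\<forall>c\<in>A. \<forall>d\<in>A. \<forall>x\<in>snd c ` (fst c \<inter> fst d).
        V d (transition c d x) = (\<lambda>S. jac c d x ** S ** matrix_inv (jac c d x)) ` V c x)"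

text \<open>The induced covariant derivative \<open>\<nabla>\<^sub>i S\<close> of a field of endomorphisms.\<close>

definition end_deriv ::
  "('a, 'n::finite) connection \<Rightarrow> ('a, 'n) chart \<Rightarrow> 'n \<Rightarrow> (real^'n \<Rightarrow> real^'n^'n) \<Rightarrow> real^'n \<Rightarrow> real^'n^'n" where
  "end_deriv D c i S x = pd i S x + D c x i ** S x - S x ** D c x i"

definition preserved_by ::
  "('a, 'n::finite) chart set \<Rightarrow> ('a, 'n) connection \<Rightarrow> ('a, 'n) end_subbundle \<Rightarrow> bool" where
  "preserved_by A D V \<longleftrightarrow>
     (\<forall>c\<in>A. \<forall>W S. open W \<and> W \<subseteq> snd c ` fst c \<and> smooth_on W S \<and> (\<forall>y\<in>W. S y \<in> V c y) \<longrightarrow>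
        (\<forall>y\<in>W. \<forall>i. end_deriv D c i S y \<in> V c y))"

text \<open>The Euclidean metric on the fibres of \<open>V\<close>: the members of a Clifford system are orthonormal for
  it, because products of two distinct ones are traceless.\<close>

definition end_inner :: "real^'n^'n \<Rightarrow> real^'n^'n \<Rightarrow> real" where
  "end_inner S T = trace (S ** T) / real CARD('n)"

text \<open>The curvature forms of the induced connection on \<open>V\<close>:
  \<open>(\<nabla>\<^sub>i\<nabla>\<^sub>j - \<nabla>\<^sub>j\<nabla>\<^sub>i) E\<^sub>\<beta> = (\<Sum>\<alpha>. \<psi>\<^sub>\<alpha>\<^sub>\<beta> (\<partial>\<^sub>i, \<partial>\<^sub>j) E\<^sub>\<alpha>)\<close>.\<close>

definition psi ::
  "('a, 16) connection \<Rightarrow> ('a, 16) chart \<Rightarrow> (9 \<Rightarrow> real^16 \<Rightarrow> real^16^16) \<Rightarrow> real^16 \<Rightarrow> (16 even_ext)^9^9" where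
  "psi D c E x = (\<chi> \<alpha> \<beta>. two_form (\<lambda>i j. end_inner (E \<alpha> x)
     (end_deriv D c i (end_deriv D c j (E \<beta>)) x - end_deriv D c j (end_deriv D c i (E \<beta>)) x)))"

text \<open>The global form \<open>\<tau>\<^sub>k(\<psi>)\<close>, computed in some local frame around each point; it does not
  depend on the frame, since two frames differ by an orthogonal matrix of functions.\<close>

definition tau ::
  "('a, 16) metric \<Rightarrow> ('a, 16) connection \<Rightarrow> ('a, 16) end_subbundle \<Rightarrow> nat \<Rightarrow> ('a, 16) form_field" where
  "tau g D V k c x =
     form_of (coeff (char_form (psi D c (SOME E. \<exists>W. x \<in> W \<and> local_frame g V c W E) x)) (9 - k))"

definition Phi_Spin9 ::
  "('a, 16) metric \<Rightarrow> ('a, 16) connection \<Rightarrow> ('a, 16) end_subbundle \<Rightarrow> ('a, 16) form_field" where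
  "Phi_Spin9 g D V c x = (1 / 360) *\<^sub>R tau g D V 4 c x"

end

theory Submission
  imports Defs 
begin

text \<open>The coefficients of the characteristic polynomial of a matrix of even forms are polynomials in the
  traces of its powers (Newton). For the curvature forms of the tangent bundle these traces are
  closed, and joining two connections by a segment shows that the Pontrjagin classes may be computed
  from the Levi-Civita connection.

  At each point the curvature of the Levi-Civita connection is rigid: if \<open>E\<^sub>1, \<dots>, E\<^sub>9\<close> is a local frame
  of \<open>V\<close>, the curvature operators lie in the span of the products \<open>E\<^sub>\<alpha> E\<^sub>\<beta>\<close>, which is
  \<open>spin(9)\<close>, and the first Bianchi identity together with the Fierz identity of the Clifford module
  determines them up to a scalar \<open>\<zeta>\<close>. Hence the curvature matrices \<open>\<Xi>\<close> of the tangent bundle \<open>\<Delta>\<close>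
  and \<open>\<psi>\<close> of \<open>V\<close> are multiples, by the same factor, of algebraic models.

  The relations between their power sums come from representations of F4, restricted to Spin(9): the
  representation \<open>\<real> \<oplus> V \<oplus> \<Delta>\<close> of dimension 26 and the adjoint representation
  \<open>\<Lambda>\<^sup>2V \<oplus> \<Delta>\<close> of dimension 52. In each, the part of F4 outside \<open>spin(9)\<close> is given by a pair of matrices
  \<open>A\<close>, \<open>B\<close> of 1-forms, such that \<open>A B\<close> and \<open>B A\<close> are, up to a factor, the curvatures of the two summands, and odd matrices
  satisfy \<open>tr (A B)\<^sup>k = - tr (B A)\<^sup>k\<close>. This gives \<open>tr \<Xi>\<^sup>k = - tr \<psi>\<^sup>k\<close> and
  \<open>\<Sum>j\<le>k. (k choose j) (tr \<psi>\<^sup>j) (tr \<psi>\<^bsup>k-j\<^esup>) = (2\<^sup>k + 2) tr \<psi>\<^sup>k\<close>, so that \<open>tr \<psi>\<^sup>2 = tr \<psi>\<^sup>6 = 0\<close> and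
  \<open>24 tr \<psi>\<^sup>8 = 7 (tr \<psi>\<^sup>4)\<^sup>2\<close>, and Newton's identities finish the computation.\<close>

section \<open>The normed algebra of exterior forms\<close>

text \<open>The identities from F4 express a flatness. Over the compact space F4/Spin(9), the bundle
  associated with a representation of F4 restricted to Spin(9) is trivial, so its Chern character is
  constant. The odd matrices \<open>A\<close> and \<open>B\<close> give this vanishing for the
  curvature forms themselves, so that linear algebra at one point suffices and no group F4 has to be
  constructed. The obstacle throughout is that connection matrices have odd entries. They live in
  \<open>ext\<close>, where the trace is only graded cyclic and there is no determinant, while the
  characteristic polynomial needs the commutative ring \<open>even_ext\<close>. Power sums make
  sense in both, and \<open>newton\<close> is therefore defined over any real algebra and
  transported along \<open>form_of\<close>. The scalar \<zeta> may depend on the point and its value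
  is never computed: coefficients of the same degree k for the tangent bundle and for
  \<open>V\<close> are both multiplied by the same k-th power, so their ratio is that of the
  algebraic models.\<close>

lemma ecoeff_simps [simp]:
  "ecoeff 0 I = 0" "ecoeff (a + b) I = ecoeff a I + ecoeff b I"
  "ecoeff (a - b) I = ecoeff a I - ecoeff b I" "ecoeff (- a) I = - ecoeff a I"
  "ecoeff (r *\<^sub>R a) I = r * ecoeff a I"
  by (simp_all add: zero_ext.rep_eq plus_ext.rep_eq minus_ext.rep_eq uminus_ext.rep_eq scaleR_ext.rep_eq)

text \<open>A norm on forms lets Frechet derivatives, \<open>Ck_on\<close> and the product rules
  apply directly to form-valued and matrix-valued functions. The sum of the absolute values of the
  coefficients is chosen because it is submultiplicative for the wedge product.\<close>

instantiation ext :: (finite) real_normed_vector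
begin

definition norm_ext :: "'a ext \<Rightarrow> real" where
  "norm_ext a = (\<Sum>I\<in>UNIV. \<bar>ecoeff a I\<bar>)"

definition dist_ext :: "'a ext \<Rightarrow> 'a ext \<Rightarrow> real" where
  "dist_ext a b = norm (a - b)"

definition sgn_ext :: "'a ext \<Rightarrow> 'a ext" where
  "sgn_ext a = a /\<^sub>R norm a"

definition uniformity_ext :: "('a ext \<times> 'a ext) filter" where
  "uniformity_ext = (INF e\<in>{0 <..}. principal {(x, y). dist x y < e})"

definition open_ext :: "'a ext set \<Rightarrow> bool" where
  "open_ext U \<longleftrightarrow> (\<forall>x\<in>U. \<forall>\<^sub>F (x', y) in uniformity. x' = x \<longrightarrow> y \<in> U)"

instance
proof
  fix a b :: "'a ext" and r :: real
  show "dist a b = norm (a - b)" by (rule dist_ext_def)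
  show "sgn a = a /\<^sub>R norm a" by (rule sgn_ext_def)
  show "norm a = 0 \<longleftrightarrow> a = 0"
    by (auto simp: norm_ext_def sum_nonneg_eq_0_iff intro!: ext_eqI)
  show "norm (a + b) \<le> norm a + norm b"
    by (auto simp: norm_ext_def sum.distrib[symmetric] intro!: sum_mono)
  show "norm (r *\<^sub>R a) = \<bar>r\<bar> * norm a"
    by (simp add: norm_ext_def abs_mult sum_distrib_left)
qed (simp_all add: uniformity_ext_def open_ext_def)

end

lemma bounded_linear_ecoeff: "bounded_linear (\<lambda>a :: 'n::finite ext. ecoeff a I)"
proof (rule bounded_linear_intro[where K = 1])
  fix a :: "'n ext"
  have "norm (ecoeff a I) \<le> (\<Sum>I\<in>UNIV. \<bar>ecoeff a I\<bar>)"
    using member_le_sum[of I UNIV "\<lambda>I. \<bar>ecoeff a I\<bar>"] by simp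
  then show "norm (ecoeff a I) \<le> norm a * 1" by (simp add: norm_ext_def)
qed simp_all

text \<open>A product of two monomials is zero or a monomial up to sign, so the norm of a product is
  bounded by a sum over disjoint pairs of index sets. Dropping the disjointness gives the product of
  the norms.\<close>

instance ext :: ("{finite,linorder}") real_normed_algebra_1
proof
  fix a b :: "'a ext"
  have "norm (a * b) \<le> (\<Sum>K\<in>UNIV. \<Sum>I\<in>Pow K. \<bar>ecoeff a I\<bar> * \<bar>ecoeff b (K - I)\<bar>)"
    unfolding norm_ext_def times_ext.rep_eq
    by (intro sum_mono order_trans[OF sum_abs] eq_refl sum.cong)
       (auto simp: abs_mult shuffle_sign_def power_abs)
  also have "\<dots> = (\<Sum>(K, I)\<in>Sigma UNIV Pow. \<bar>ecoeff a I\<bar> * \<bar>ecoeff b (K - I)\<bar>)"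
    by (simp add: sum.Sigma)
  also have "\<dots> = (\<Sum>(I, J)\<in>{(I, J). I \<inter> J = {}}. \<bar>ecoeff a I\<bar> * \<bar>ecoeff b J\<bar>)"
    by (rule sum.reindex_bij_witness[where i = "\<lambda>(I, J). (I \<union> J, I)" and j = "\<lambda>(K, I). (I, K - I)"])
       (auto simp: Un_Diff Diff_triv Int_commute)
  also have "\<dots> \<le> (\<Sum>(I, J)\<in>UNIV \<times> UNIV. \<bar>ecoeff a I\<bar> * \<bar>ecoeff b J\<bar>)"
    by (rule sum_mono2) auto
  also have "\<dots> = norm a * norm b"
    by (simp add: norm_ext_def sum_product sum.cartesian_product)
  finally show "norm (a * b) \<le> norm a * norm b" .
  have "norm (1 :: 'a ext) = (\<Sum>I\<in>(UNIV :: 'a set set). if I = {} then 1 else 0)"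
    unfolding norm_ext_def one_ext.rep_eq by (intro sum.cong) auto
  then show "norm (1 :: 'a ext) = 1" by simp
qed

text \<open>Only the vanishing of the other coefficients is asked, so 0 is homogeneous of every
  degree and sums need no case distinction.\<close>

definition homog :: "nat \<Rightarrow> 'n ext \<Rightarrow> bool" where
  "homog k a \<longleftrightarrow> (\<forall>I. card I \<noteq> k \<longrightarrow> ecoeff a I = 0)"

lemma homog_simps [simp, intro]:
  "homog k 0"
  "homog k a \<Longrightarrow> homog k b \<Longrightarrow> homog k (a + b)"
  "homog k a \<Longrightarrow> homog k b \<Longrightarrow> homog k (a - b)"
  "homog k a \<Longrightarrow> homog k (- a)"
  "homog k a \<Longrightarrow> homog k (r *\<^sub>R a)"
  "homog (Suc 0) (dx i)"
  by (auto simp: homog_def dx.rep_eq)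

lemma homog_one [simp, intro]: "homog 0 (1 :: 'n::{finite,linorder} ext)"
  by (auto simp: homog_def one_ext.rep_eq)

lemma homog_sum: "(\<And>s. s \<in> S \<Longrightarrow> homog k (f s)) \<Longrightarrow> homog k (sum f S)"
  by (induction S rule: infinite_finite_induct) auto

lemma homog_mult:
  fixes a b :: "'n::{finite,linorder} ext"
  assumes "homog j a" "homog k b"
  shows "homog (j + k) (a * b)"
  unfolding homog_def times_ext.rep_eq
proof (intro allI impI sum.neutral ballI)
  fix K I :: "'n set" assume K: "card K \<noteq> j + k" and "I \<in> Pow K"
  then have "card K = card I + card (K - I)"
    by (simp add: card_Diff_subset card_mono)
  then have "card I \<noteq> j \<or> card (K - I) \<noteq> k" using K by auto
  then show "shuffle_sign I (K - I) * ecoeff a I * ecoeff b (K - I) = 0"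
    using assms by (auto simp: homog_def)
qed

text \<open>By \<open>inversions_swap\<close> the two shuffle signs of disjoint sets I and J differ
  by (-1)^(card I * card J), and only sets of sizes j and k carry nonzero coefficients.\<close>

lemma homog_commute:
  fixes a b :: "'n::{finite,linorder} ext"
  assumes "homog j a" "homog k b"
  shows "a * b = (- 1) ^ (j * k) * (b * a)"
proof -
  have "a * b = ((- 1) ^ (j * k)) *\<^sub>R (b * a)"
  proof (rule ext_eqI)
    fix K
    have "ecoeff (a * b) K = (\<Sum>I\<in>Pow K. (-1) ^ (j * k) * (shuffle_sign (K - I) I * ecoeff b (K - I) * ecoeff a I))"
      unfolding times_ext.rep_eq
    proof (rule sum.cong)
      fix I assume "I \<in> Pow K"
      have "inversions I (K - I) + inversions (K - I) I = card I * card (K - I)"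
        by (rule inversions_swap) auto
      then have "shuffle_sign I (K - I) * shuffle_sign (K - I) I = (-1) ^ (card I * card (K - I))"
        by (simp add: shuffle_sign_def power_add[symmetric])
      moreover have "shuffle_sign (K - I) I * shuffle_sign (K - I) I = 1"
        by (simp add: shuffle_sign_def power_add[symmetric])
      ultimately have *: "shuffle_sign I (K - I) = (-1) ^ (card I * card (K - I)) * shuffle_sign (K - I) I"
        by (metis mult.assoc mult.right_neutral)
      show "shuffle_sign I (K - I) * ecoeff a I * ecoeff b (K - I)
        = (-1) ^ (j * k) * (shuffle_sign (K - I) I * ecoeff b (K - I) * ecoeff a I)"
        using assms * by (cases "card I = j \<and> card (K - I) = k") (auto simp: homog_def)
    qed simp
    also have "\<dots> = ecoeff ((- 1) ^ (j * k) *\<^sub>R (b * a)) K"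
      unfolding times_ext.rep_eq ecoeff_simps sum_distrib_left
      by (rule sum.reindex_bij_witness[where i = "\<lambda>I. K - I" and j = "\<lambda>I. K - I"])
         (auto simp: double_diff)
    finally show "ecoeff (a * b) K = ecoeff ((- 1) ^ (j * k) *\<^sub>R (b * a)) K" .
  qed
  then show ?thesis by (cases "even (j * k)") auto
qed

lemma homog_1_anticommute: "homog 1 a \<Longrightarrow> homog 1 b \<Longrightarrow> a * b = - (b * a)"
  for a b :: "'n::{finite,linorder} ext"
  using homog_commute[of 1 a 1 b] by simp

lemma homog_1_square: "homog 1 a \<Longrightarrow> a * a = 0"
  for a :: "'n::{finite,linorder} ext"
  using homog_1_anticommute[of a a] by (simp add: eq_neg_iff_add_eq_0 scaleR_2[symmetric])

lemma dx_anticommute: "dx i * dx j = - (dx j * dx i)" and dx_square [simp]: "dx i * dx i = 0"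
  for i j :: "'n::{finite,linorder}"
  using homog_1_anticommute[of "dx i" "dx j"] homog_1_square[of "dx i"] by simp_all

lemma form_of_simps [simp]:
  "form_of 0 = 0" "form_of (a + b) = form_of a + form_of b" "form_of (a - b) = form_of a - form_of b"
  "form_of (- a) = - form_of a" "form_of (r *\<^sub>R a) = r *\<^sub>R form_of a"
  by (simp_all add: zero_even_ext.rep_eq plus_even_ext.rep_eq minus_even_ext.rep_eq
      uminus_even_ext.rep_eq scaleR_even_ext.rep_eq)

lemma form_of_ring_simps [simp]:
  "form_of (1 :: 'n::{finite,linorder} even_ext) = 1" "form_of (a * b) = form_of a * form_of b"
  for a b :: "'n::{finite,linorder} even_ext"
  by (simp_all add: one_even_ext.rep_eq times_even_ext.rep_eq)

lemma form_of_sum: "form_of (sum f S) = (\<Sum>s\<in>S. form_of (f s))"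
  by (induction S rule: infinite_finite_induct) simp_all

text \<open>\<open>two_form\<close> sums over i < j, whereas \<open>tens\<close> and
  \<open>quad\<close> sum over all ordered pairs. For skew-symmetric \<open>B\<close> the second sum
  is twice the first.\<close>

lemma form_of_two_form:
  fixes B :: "'n::{finite,linorder} \<Rightarrow> 'n \<Rightarrow> real"
  assumes "\<And>i j. B j i = - B i j"
  shows "form_of (two_form B) = (1 / 2) *\<^sub>R (\<Sum>i\<in>UNIV. \<Sum>j\<in>UNIV. B i j *\<^sub>R (dx i * dx j))"
proof -
  let ?f = "\<lambda>i j. B i j *\<^sub>R (dx i * dx j)"
  have "?f i j = ?f j i" for i j
    using assms[of i j] dx_anticommute[of i j] by simp
  then have "(\<Sum>i\<in>UNIV. \<Sum>j | j < i. ?f i j) = (\<Sum>i\<in>UNIV. \<Sum>j | j < i. ?f j i)"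
    by simp
  also have "\<dots> = (\<Sum>i\<in>UNIV. \<Sum>j | i < j. ?f i j)"
    using sum.swap_restrict[of UNIV UNIV "\<lambda>i j. ?f j i" "\<lambda>i j. j < i"] by simp
  finally have eq: "(\<Sum>i\<in>UNIV. \<Sum>j | j < i. ?f i j) = (\<Sum>i\<in>UNIV. \<Sum>j | i < j. ?f i j)" .
  have "(\<Sum>j\<in>UNIV. ?f i j) = (\<Sum>j | j < i. ?f i j) + (\<Sum>j | i < j. ?f i j)" for i
  proof -
    have "(\<Sum>j\<in>UNIV. ?f i j) = (\<Sum>j\<in>UNIV - {i}. ?f i j)"
      by (rule sum.mono_neutral_right) auto
    also have "UNIV - {i} = {j. j < i} \<union> {j. i < j}" by auto
    also have "(\<Sum>j\<in>{j. j < i} \<union> {j. i < j}. ?f i j) = (\<Sum>j | j < i. ?f i j) + (\<Sum>j | i < j. ?f i j)"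
      by (rule sum.union_disjoint) auto
    finally show ?thesis .
  qed
  then have "(\<Sum>i\<in>UNIV. \<Sum>j\<in>UNIV. ?f i j) = 2 *\<^sub>R (\<Sum>i\<in>UNIV. \<Sum>j | i < j. ?f i j)"
    by (simp add: sum.distrib eq scaleR_2)
  then show ?thesis by (simp add: two_form.rep_eq)
qed

section \<open>Pull-back of forms\<close>

definition monomial :: "('n::{finite,linorder} \<Rightarrow> 'a::monoid_mult) \<Rightarrow> 'n set \<Rightarrow> 'a" where
  "monomial y K = prod_list (map y (sorted_list_of_set K))"

lemma monomial_empty [simp]: "monomial y {} = 1"
  by (simp add: monomial_def)

lemma monomial_insert_less:
  assumes "\<forall>l\<in>K. k < l"
  shows "monomial y (insert k K) = y k * monomial y K"
proof -
  have "sorted_list_of_set (set (k # sorted_list_of_set K)) = k # sorted_list_of_set K"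
    using assms by (intro sorted_list_of_set.idem_if_sorted_distinct) (auto simp: less_imp_le)
  then show ?thesis by (simp add: monomial_def)
qed

lemma shuffle_sign_Un_left: "I \<inter> J = {} \<Longrightarrow> shuffle_sign (I \<union> J) K = shuffle_sign I K * shuffle_sign J K"
  and shuffle_sign_Un_right: "J \<inter> K = {} \<Longrightarrow> shuffle_sign I (J \<union> K) = shuffle_sign I J * shuffle_sign I K"
  by (simp_all add: shuffle_sign_def inversions_Un_left inversions_Un_right power_add)

lemma shuffle_sign_less: "\<forall>l\<in>K. k < l \<Longrightarrow> shuffle_sign {k} K = 1"
proof -
  assume "\<forall>l\<in>K. k < l"
  then have "{(i, j). i \<in> {k} \<and> j \<in> K \<and> j < i} = {}" by auto
  then show ?thesis unfolding shuffle_sign_def inversions_def by (simp only: card.empty power_0)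
qed

text \<open>Induction on the smallest element of \<open>K\<close>: moving \<open>y k\<close> past a
  smaller factor costs one sign, the inversion counted by \<open>shuffle_sign {k}\<close>.\<close>

lemma monomial_single_mult:
  fixes y :: "'n::{finite,linorder} \<Rightarrow> 'a::real_algebra_1"
  assumes anti: "\<And>i j. y i * y j = - (y j * y i)" and sq: "\<And>i. y i * y i = 0"
  shows "y k * monomial y K = (if k \<in> K then 0 else shuffle_sign {k} K *\<^sub>R monomial y (insert k K))"
  using finite[of K]
proof (induction K rule: finite_linorder_min_induct)
  case (insert m M)
  consider "k < m" | "k = m" | "m < k" by force
  then show ?case
  proof cases
    case 1
    then have "\<forall>l\<in>insert m M. k < l" using insert.hyps by auto
    then show ?thesis
      by (auto simp: monomial_insert_less shuffle_sign_less)
  next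
    case 2
    then show ?thesis
      using insert.hyps by (simp add: monomial_insert_less mult.assoc[symmetric] sq)
  next
    case 3
    have "y k * monomial y (insert m M) = - (y m * (y k * monomial y M))"
      using insert.hyps anti[of k m] by (simp add: monomial_insert_less mult.assoc[symmetric])
    also have "\<dots> = (if k \<in> M then 0 else (- shuffle_sign {k} M) *\<^sub>R (y m * monomial y (insert k M)))"
      by (simp add: insert.IH)
    also have "\<dots> = (if k \<in> M then 0 else (- shuffle_sign {k} M) *\<^sub>R monomial y (insert m (insert k M)))"
      using insert.hyps 3 by (simp add: monomial_insert_less)
    also have "- shuffle_sign {k} M = shuffle_sign {k} (insert m M)"
    proof -
      have "inversions {k} {m} = 1"
        using 3 by (auto simp: inversions_def card_1_singleton_iff)
      then show ?thesis
        using insert.hyps shuffle_sign_Un_right[of "{m}" M "{k}"] by (auto simp: shuffle_sign_def)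
    qed
    finally show ?thesis
      using 3 by (auto simp: insert_commute)
  qed
qed (simp add: monomial_insert_less)

text \<open>Anticommuting elements of square zero obey the multiplication table of the basis
  monomials of the exterior algebra. This is its universal property, in the form that makes
  \<open>pull_back\<close> multiplicative.\<close>

lemma monomial_mult:
  fixes y :: "'n::{finite,linorder} \<Rightarrow> 'a::real_algebra_1"
  assumes anti: "\<And>i j. y i * y j = - (y j * y i)" and sq: "\<And>i. y i * y i = 0"
  shows "monomial y K * monomial y L
    = (if K \<inter> L = {} then shuffle_sign K L *\<^sub>R monomial y (K \<union> L) else 0)"
  using finite[of K]
proof (induction K rule: finite_linorder_min_induct)
  case (insert k K)
  have "monomial y (insert k K) * monomial y L = y k * (monomial y K * monomial y L)"
    using insert.hyps by (simp add: monomial_insert_less mult.assoc)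
  also have "\<dots> = (if K \<inter> L = {} then shuffle_sign K L *\<^sub>R (y k * monomial y (K \<union> L)) else 0)"
    by (simp add: insert.IH)
  also have "\<dots> = (if insert k K \<inter> L = {} then (shuffle_sign K L * shuffle_sign {k} (K \<union> L)) *\<^sub>R
      monomial y (insert k K \<union> L) else 0)"
    using insert.hyps by (auto simp: monomial_single_mult[of y, OF anti sq])
  also have "\<dots> = (if insert k K \<inter> L = {} then shuffle_sign (insert k K) L *\<^sub>R
      monomial y (insert k K \<union> L) else 0)"
  proof -
    have "shuffle_sign K L * shuffle_sign {k} (K \<union> L) = shuffle_sign (insert k K) L"
      if "insert k K \<inter> L = {}"
      using that insert.hyps shuffle_sign_Un_right[of K L "{k}"] shuffle_sign_Un_left[of "{k}" K L]
      by (auto simp: shuffle_sign_less)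
    then show ?thesis by simp
  qed
  finally show ?case .
qed simp

lemma pull_back_eq: "pull_back J a = (\<Sum>K\<in>UNIV. ecoeff a K *\<^sub>R monomial (\<lambda>k. \<Sum>i\<in>UNIV. J $ k $ i *\<^sub>R dx i) K)"
  by (simp add: pull_back_def monomial_def)

lemma pull_back_linear [simp]:
  "pull_back J 0 = 0" "pull_back J (a + b) = pull_back J a + pull_back J b"
  "pull_back J (a - b) = pull_back J a - pull_back J b" "pull_back J (- a) = - pull_back J a"
  "pull_back J (r *\<^sub>R a) = r *\<^sub>R pull_back J a"
  by (simp_all add: pull_back_eq scaleR_left.add scaleR_left.diff sum.distrib sum_subtractf sum_negf scaleR_sum_right)

lemma pull_back_sum: "pull_back J (sum f S) = (\<Sum>s\<in>S. pull_back J (f s))"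
  by (induction S rule: infinite_finite_induct) simp_all

lemma pull_back_one [simp]: "pull_back J 1 = 1"
  for J :: "real^('n::{finite,linorder})^('n::{finite,linorder})"
proof -
  have "pull_back J 1 = (\<Sum>K\<in>(UNIV :: 'n set set). if K = {} then 1 else 0)"
    unfolding pull_back_eq one_ext.rep_eq by (intro sum.cong) auto
  then show ?thesis by simp
qed

lemma pull_back_dx: "pull_back J (dx k) = (\<Sum>i\<in>UNIV. J $ k $ i *\<^sub>R dx i)"
proof -
  have "pull_back J (dx k) = (\<Sum>K\<in>UNIV. if K = {k} then \<Sum>i\<in>UNIV. J $ k $ i *\<^sub>R dx i else 0)"
    unfolding pull_back_eq dx.rep_eq by (intro sum.cong) (auto simp: monomial_def)
  then show ?thesis by simp
qed

lemma pull_back_mult: "pull_back J (a * b) = pull_back J a * pull_back J b"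
proof -
  let ?y = "\<lambda>k. \<Sum>i\<in>UNIV. J $ k $ i *\<^sub>R dx i"
  have hom: "homog 1 (?y k)" for k by (intro homog_sum) auto
  have anti: "?y i * ?y j = - (?y j * ?y i)" and sq: "?y i * ?y i = 0" for i j
    by (intro homog_1_anticommute homog_1_square hom)+
  let ?m = "monomial ?y"
  have "pull_back J a * pull_back J b
      = (\<Sum>(I, L)\<in>UNIV. (ecoeff a I * ecoeff b L) *\<^sub>R (?m I * ?m L))"
    by (simp add: pull_back_eq sum_product sum.cartesian_product mult_ac)
  also have "\<dots> = (\<Sum>(I, L)\<in>{(I, L). I \<inter> L = {}}. (ecoeff a I * ecoeff b L) *\<^sub>R (?m I * ?m L))"
    by (rule sum.mono_neutral_right) (auto simp: monomial_mult[of ?y, OF anti sq] split: if_splits)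
  also have "\<dots> = (\<Sum>(I, L)\<in>{(I, L). I \<inter> L = {}}.
      (shuffle_sign I L * ecoeff a I * ecoeff b L) *\<^sub>R ?m (I \<union> L))"
    by (rule sum.cong) (auto simp: monomial_mult[of ?y, OF anti sq] mult_ac)
  also have "\<dots> = (\<Sum>(K, I)\<in>Sigma UNIV Pow. (shuffle_sign I (K - I) * ecoeff a I * ecoeff b (K - I)) *\<^sub>R ?m K)"
    by (rule sum.reindex_bij_witness[where j = "\<lambda>(I, J). (I \<union> J, I)" and i = "\<lambda>(K, I). (I, K - I)"])
       (auto simp: Un_Diff Diff_triv Int_commute Un_absorb1)
  also have "\<dots> = (\<Sum>K\<in>UNIV. \<Sum>I\<in>Pow K. (shuffle_sign I (K - I) * ecoeff a I * ecoeff b (K - I)) *\<^sub>R ?m K)"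
    by (simp add: sum.Sigma)
  also have "\<dots> = pull_back J (a * b)"
    by (simp add: pull_back_eq times_ext.rep_eq scaleR_left.sum)
  finally show ?thesis by simp
qed

section \<open>Matrices over rings\<close>

lemma matrix_mult_ring_simps:
  fixes A A' :: "'a::ring_1^'n^'m" and B B' :: "'a^'p^'n"
  shows matrix_add_distrib_right: "(A + A') ** B = A ** B + A' ** B"
    and matrix_diff_distrib_right: "(A - A') ** B = A ** B - A' ** B"
    and matrix_diff_distrib_left: "A ** (B - B') = A ** B - A ** B'"
    and matrix_mult_minus_left: "(- A) ** B = - (A ** B)"
    and matrix_mult_minus_right: "A ** (- B) = - (A ** B)"
    and matrix_mult_zero_left: "(0 :: 'a^'n^'m) ** B = 0"
    and matrix_mult_zero_right: "A ** (0 :: 'a^'p^'n) = 0"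
  by (simp_all add: matrix_matrix_mult_def vec_eq_iff algebra_simps sum.distrib sum_subtractf sum_negf)

lemma matrix_mult_sum_left: "sum f S ** B = (\<Sum>s\<in>S. f s ** B)"
  for f :: "'i \<Rightarrow> 'a::ring_1^'n^'m"
  by (induction S rule: infinite_finite_induct) (simp_all add: matrix_mult_ring_simps)

lemma matrix_mult_sum_right: "A ** sum f S = (\<Sum>s\<in>S. A ** f s)"
  for f :: "'i \<Rightarrow> 'a::ring_1^'n^'m"
  by (induction S rule: infinite_finite_induct) (simp_all add: matrix_mult_ring_simps matrix_add_ldistrib)

lemma matrix_mult_scaleR_left: "(r *\<^sub>R A) ** B = r *\<^sub>R (A ** B)"
  and matrix_mult_scaleR_right: "A ** (r *\<^sub>R B) = r *\<^sub>R (A ** B)"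
  for A :: "'a::real_algebra_1^'n^'m"
  by (simp_all add: matrix_matrix_mult_def vec_eq_iff scaleR_sum_right)

lemmas matrix_mult_simps = matrix_mult_ring_simps matrix_add_ldistrib matrix_mult_sum_left
  matrix_mult_sum_right matrix_mult_scaleR_left matrix_mult_scaleR_right

lemma trace_ring_simps:
  fixes A B :: "'a::ring_1^'n^'n"
  shows "trace (0 :: 'a^'n^'n) = 0" "trace (A + B) = trace A + trace B"
    "trace (A - B) = trace A - trace B" "trace (- A) = - trace A"
  by (simp_all add: trace_def sum.distrib sum_subtractf sum_negf)

lemma trace_scaleR: "trace (r *\<^sub>R A) = r *\<^sub>R trace A"
  for A :: "'a::real_algebra_1^'n^'n"
  by (simp add: trace_def scaleR_sum_right)

lemma trace_sum: "trace (sum f S) = (\<Sum>s\<in>S. trace (f s))"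
  for f :: "'i \<Rightarrow> 'a::ring_1^'n^'n"
  by (induction S rule: infinite_finite_induct) (simp_all add: trace_ring_simps)

lemmas trace_simps = trace_ring_simps trace_scaleR trace_sum

section \<open>Newton's identities for the characteristic polynomial\<close>

primrec mpow :: "'a::semiring_1^'n^'n \<Rightarrow> nat \<Rightarrow> 'a^'n^'n" where
  "mpow N 0 = mat 1"
| "mpow N (Suc k) = N ** mpow N k"

lemma mpow_add: "mpow N (j + k) = mpow N j ** mpow N k"
  by (induction j) (simp_all add: matrix_mul_assoc)

lemma mpow_Suc_right: "mpow N (Suc k) = mpow N k ** N"
  using mpow_add[of N k 1] by simp

lemma fps_deriv_prod:
  fixes f :: "'b \<Rightarrow> 'a::comm_ring_1 fps"
  assumes "finite S"
  shows "fps_deriv (prod f S) = (\<Sum>i\<in>S. \<Prod>k\<in>S. if k = i then fps_deriv (f k) else f k)"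
  using assms
proof (induction S)
  case (insert x S)
  have *: "(\<Prod>k\<in>S. if k = x then fps_deriv (f k) else f k) = prod f S"
    using insert.hyps by (intro prod.cong) auto
  have "(\<Sum>i\<in>insert x S. \<Prod>k\<in>insert x S. if k = i then fps_deriv (f k) else f k)
      = fps_deriv (f x) * prod f S + (\<Sum>i\<in>S. \<Prod>k\<in>insert x S. if k = i then fps_deriv (f k) else f k)"
    using insert.hyps by (simp add: *)
  also have "(\<Sum>i\<in>S. \<Prod>k\<in>insert x S. if k = i then fps_deriv (f k) else f k)
      = f x * (\<Sum>i\<in>S. \<Prod>k\<in>S. if k = i then fps_deriv (f k) else f k)"
    using insert.hyps unfolding sum_distrib_left by (intro sum.cong) auto
  finally show ?case using insert by (simp add: algebra_simps)
qed simp

lemma fps_deriv_det: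
  fixes M :: "('a::comm_ring_1 fps)^'n^'n"
  shows "fps_deriv (det M) = (\<Sum>i\<in>UNIV. det (\<chi> k. if k = i then \<chi> j. fps_deriv (M $ k $ j) else M $ k))"
proof -
  have "fps_deriv (of_int (sign p) * x) = of_int (sign p) * fps_deriv x" for p :: "'n \<Rightarrow> 'n" and x :: "'a fps"
    by (simp add: sign_def)
  then have "fps_deriv (det M) = (\<Sum>p | p permutes UNIV. of_int (sign p) *
      (\<Sum>i\<in>UNIV. \<Prod>k\<in>UNIV. if k = i then fps_deriv (M $ k $ p k) else M $ k $ p k))"
    by (simp add: det_def fps_deriv_sum fps_deriv_prod)
  also have "\<dots> = (\<Sum>i\<in>UNIV. \<Sum>p | p permutes UNIV. of_int (sign p) *
      (\<Prod>k\<in>UNIV. if k = i then fps_deriv (M $ k $ p k) else M $ k $ p k))"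
    unfolding sum_distrib_left by (rule sum.swap)
  finally show ?thesis
    by (simp add: det_def if_distrib[of "\<lambda>v. v $ _"] cong: if_cong)
qed

text \<open>Row i of \<open>C ** M\<close> is a combination of the rows of \<open>M\<close>; every
  row other than the i-th repeats a row that is still present and contributes nothing.\<close>

lemma det_replace_row:
  fixes C M :: "'a::comm_ring_1^'n^'n"
  shows "det (\<chi> k. if k = i then (C ** M) $ i else M $ k) = C $ i $ i * det M"
proof -
  have "(C ** M) $ i = (\<Sum>j\<in>UNIV. C $ i $ j *s M $ j)"
    by (simp add: vec_eq_iff matrix_matrix_mult_def)
  then have "det (\<chi> k. if k = i then (C ** M) $ i else M $ k)
      = (\<Sum>j\<in>UNIV. det (\<chi> k. if k = i then C $ i $ j *s M $ j else M $ k))"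
    by (simp only: det_linear_row_sum[OF finite])
  also have "\<dots> = (\<Sum>j\<in>UNIV. if j = i then C $ i $ i * det M else 0)"
  proof (rule sum.cong)
    fix j
    have "det (\<chi> k. if k = i then M $ j else M $ k) = 0" if "j \<noteq> i"
      by (rule det_identical_rows[OF that]) (use that in \<open>simp add: row_def vec_eq_iff\<close>)
    moreover have "(\<chi> k. if k = i then M $ i else M $ k) = M"
      by (simp add: vec_eq_iff)
    ultimately show "det (\<chi> k. if k = i then C $ i $ j *s M $ j else M $ k)
        = (if j = i then C $ i $ i * det M else 0)"
      by (cases "j = i") (simp_all add: det_row_mul cong: if_cong)
  qed simp
  finally show ?thesis by simp
qed

text \<open>Jacobi's formula for det (1 - X N). Over formal power series the geometric series of the
  powers of N inverts 1 - X N, so neither eigenvalues nor division are needed, and the logarithmic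
  derivative is minus the generating series of the power sums.\<close>

lemma fps_deriv_det_reversed:
  fixes N :: "'a::comm_ring_1^'n^'n"
  defines "M \<equiv> (\<chi> i j. (if i = j then 1 else 0) - fps_X * fps_const (N $ i $ j))"
  shows "fps_deriv (det M) = - Abs_fps (\<lambda>k. trace (mpow N (Suc k))) * det M"
proof -
  define P where "P = (\<chi> i j. Abs_fps (\<lambda>k. mpow N k $ i $ j))"
  define L where "L = (\<chi> i j. fps_const (N $ i $ j))"
  have PL: "P ** L = (\<chi> i j. Abs_fps (\<lambda>k. mpow N (Suc k) $ i $ j))"
    by (simp add: P_def L_def vec_eq_iff fps_eq_iff matrix_matrix_mult_def fps_sum_nth mpow_Suc_right del: mpow.simps)
  have M: "M = mat 1 - (\<chi> i j. fps_X * L $ i $ j)"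
    by (simp add: M_def L_def mat_def vec_eq_iff)
  have "P ** M = P - P ** (\<chi> i j. fps_X * L $ i $ j)"
    by (simp add: M matrix_mult_simps)
  also have "P ** (\<chi> i j. fps_X * L $ i $ j) = (\<chi> i j. fps_X * (P ** L) $ i $ j)"
    by (simp add: matrix_matrix_mult_def vec_eq_iff sum_distrib_left mult_ac)
  also have "P - \<dots> = mat 1"
    unfolding PL by (auto simp: P_def vec_eq_iff fps_eq_iff mat_def gr0_conv_Suc simp del: mpow.simps(2))
  finally have PM: "P ** M = mat 1" .
  define DM where "DM = (\<chi> i j. fps_deriv (M $ i $ j))"
  have DM: "DM = - L"
    by (simp add: DM_def M_def L_def vec_eq_iff)
  have "fps_deriv (det M) = (\<Sum>i\<in>UNIV. det (\<chi> k. if k = i then DM $ i else M $ k))"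
    unfolding fps_deriv_det DM_def by (intro sum.cong refl arg_cong[where f = det]) (simp add: vec_eq_iff)
  \<comment> \<open>Writing the derivative as a left multiple of \<open>M\<close> gives each
    replaced row the shape required by \<open>det_replace_row\<close>.\<close>
  also have "DM = (DM ** P) ** M"
    by (simp add: matrix_mul_assoc[symmetric] PM)
  also have "(\<Sum>i\<in>UNIV. det (\<chi> k. if k = i then ((DM ** P) ** M) $ i else M $ k)) = trace (DM ** P) * det M"
    by (simp add: det_replace_row trace_def sum_distrib_right)
  also have "trace (DM ** P) = - trace (P ** L)"
    by (subst trace_mul_sym) (simp add: DM trace_def matrix_matrix_mult_def sum_negf)
  also have "trace (P ** L) = Abs_fps (\<lambda>k. trace (mpow N (Suc k)))"
    unfolding PL by (simp add: fps_eq_iff trace_def fps_sum_nth)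
  finally show ?thesis by simp
qed

text \<open>Passing from a t - b to a - X b reverses the coefficients; in a determinant
  \<open>a\<close> is 1 on the diagonal and 0 off it. The second conjunct is the degree bound, which
  the induction needs at the new top coefficient.\<close>

lemma fps_nth_prod_reversed:
  fixes a b :: "'b \<Rightarrow> 'a::comm_ring_1"
  assumes "finite S"
  shows "fps_nth (\<Prod>i\<in>S. fps_const (a i) - fps_X * fps_const (b i)) k
      = (if k \<le> card S then coeff (\<Prod>i\<in>S. [:- b i, a i:]) (card S - k) else 0) \<and>
    (k > card S \<longrightarrow> coeff (\<Prod>i\<in>S. [:- b i, a i:]) k = 0)"
  using assms
proof (induction S arbitrary: k)
  case empty
  then show ?case by auto
next
  case (insert x S)
  have "(fps_const (a x) - fps_X * fps_const (b x)) * F = fps_const (a x) * F - fps_X * (fps_const (b x) * F)"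
    for F :: "'a fps" by (simp add: algebra_simps)
  then show ?case
    using insert.hyps insert.IH[of k] insert.IH[of "k - 1"] insert.IH[of "card S + 1"]
    by (auto simp: coeff_pCons Suc_diff_le split: nat.split)
qed

lemma coeff_det_reversed:
  fixes N :: "'a::comm_ring_1^'n^'n"
  assumes "k \<le> CARD('n)"
  shows "coeff (det (\<chi> a b. (if a = b then [:0, 1:] else 0) - [:N $ a $ b:])) (CARD('n) - k)
    = fps_nth (det (\<chi> i j. (if i = j then 1 else 0) - fps_X * fps_const (N $ i $ j))) k"
proof -
  have "coeff (of_int (sign p) * q) m = of_int (sign p) * coeff q m" for p :: "'n \<Rightarrow> 'n" and q :: "'a poly" and m
    by (simp add: sign_def)
  moreover have "fps_nth (of_int (sign p) * q) m = of_int (sign p) * fps_nth q m" for p :: "'n \<Rightarrow> 'n" and q :: "'a fps" and m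
    by (simp add: sign_def)
  moreover have "coeff (\<Prod>i\<in>UNIV. (if i = p i then [:0, 1:] else 0) - [:N $ i $ p i:]) (CARD('n) - k)
      = fps_nth (\<Prod>i\<in>UNIV. (if i = p i then 1 else 0) - fps_X * fps_const (N $ i $ p i)) k" for p
  proof -
    let ?a = "\<lambda>i. if i = p i then 1 else 0"
    have "fps_nth (\<Prod>i\<in>UNIV. fps_const (?a i) - fps_X * fps_const (N $ i $ p i)) k
        = coeff (\<Prod>i\<in>UNIV. [:- N $ i $ p i, ?a i:]) (CARD('n) - k)"
      using assms by (subst fps_nth_prod_reversed[THEN conjunct1]) auto
    also have "(\<lambda>i. [:- N $ i $ p i, ?a i:]) = (\<lambda>i. (if i = p i then [:0, 1:] else 0) - [:N $ i $ p i:])"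
      by auto
    also have "(\<lambda>i. fps_const (?a i) - fps_X * fps_const (N $ i $ p i))
        = (\<lambda>i. (if i = p i then 1 else 0) - fps_X * fps_const (N $ i $ p i))"
      by auto
    finally show ?thesis by simp
  qed
  ultimately show ?thesis
    by (simp add: det_def coeff_sum fps_sum_nth)
qed

text \<open>Coefficients of X^k are compared in \<open>fps_deriv_det_reversed\<close>. The factor k
  + 1 stays on the left because a commutative ring need not allow division by it.\<close>

theorem newton_identity:
  fixes N :: "'a::comm_ring_1^'n^'n"
  defines "e \<equiv> \<lambda>k. coeff (det (\<chi> a b. (if a = b then [:0, 1:] else 0) - [:N $ a $ b:])) (CARD('n) - k)"
  assumes "Suc k \<le> CARD('n)"
  shows "of_nat (Suc k) * e (Suc k) = - (\<Sum>i\<le>k. e (k - i) * trace (mpow N (Suc i)))"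
proof -
  let ?f = "det (\<chi> i j. (if i = j then 1 else 0) - fps_X * fps_const (N $ i $ j))"
  have e: "e i = fps_nth ?f i" if "i \<le> Suc k" for i
    unfolding e_def using that assms(2) by (intro coeff_det_reversed) simp
  have "of_nat (Suc k) * fps_nth ?f (Suc k) = fps_nth (fps_deriv ?f) k"
    by simp
  also have "\<dots> = - (\<Sum>i\<le>k. fps_nth ?f (k - i) * trace (mpow N (Suc i)))"
    unfolding fps_deriv_det_reversed
    by (simp add: fps_mult_nth atLeast0AtMost mult.commute sum_negf del: mpow.simps)
  finally show ?thesis by (simp add: e)
qed

lemma char_poly_lead:
  fixes N :: "'a::comm_ring_1^'n^'n"
  shows "coeff (det (\<chi> a b. (if a = b then [:0, 1:] else 0) - [:N $ a $ b:])) (CARD('n)) = 1"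
proof -
  let ?M = "\<chi> i j. (if i = j then 1 else 0) - fps_X * fps_const (N $ i $ j)"
  have "fps_nth (det ?M) 0 = (\<Sum>p | p permutes (UNIV :: 'n set). of_int (sign p) * (\<Prod>i\<in>UNIV. mat 1 $ i $ p i))"
  proof -
    have "fps_nth (of_int (sign p) * q) 0 = of_int (sign p) * fps_nth q 0" for p :: "'n \<Rightarrow> 'n" and q :: "'a fps"
      by (simp add: sign_def)
    moreover have "fps_nth (prod f S) 0 = (\<Prod>i\<in>S. fps_nth (f i) 0)" for f :: "'n \<Rightarrow> 'a fps" and S
      by (induction S rule: infinite_finite_induct) auto
    ultimately show ?thesis by (simp add: det_def fps_sum_nth mat_def if_distrib[of "\<lambda>f. fps_nth f 0"] cong: if_cong)
  qed
  also have "\<dots> = det (mat 1 :: 'a^'n^'n)" by (simp add: det_def)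
  finally show ?thesis using coeff_det_reversed[of 0 N] by simp
qed

section \<open>Calculus of smooth functions\<close>

lemmas has_derivative_frechet = frechet_derivative_works[THEN iffD1]

lemma pd_eqI: "(f has_derivative f') (at x) \<Longrightarrow> pd i f x = f' (axis i 1)"
  by (simp add: pd_def frechet_derivative_at[symmetric])

lemma pd_const [simp]: "pd i (\<lambda>x. c) x = 0"
  by (rule pd_eqI[OF has_derivative_const])

lemma pd_bounded_linear:
  assumes "bounded_linear L" "f differentiable (at x)"
  shows "pd i (\<lambda>x. L (f x)) x = L (pd i f x)"
  using pd_eqI[OF bounded_linear.has_derivative[OF assms(1) has_derivative_frechet[OF assms(2)]]]
  by (simp add: pd_def)

lemma pd_add: "f differentiable (at x) \<Longrightarrow> g differentiable (at x) \<Longrightarrow>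
    pd i (\<lambda>x. f x + g x) x = pd i f x + pd i g x"
  using pd_eqI[OF has_derivative_add[OF has_derivative_frechet has_derivative_frechet]]
  by (simp add: pd_def)

lemma pd_diff: "f differentiable (at x) \<Longrightarrow> g differentiable (at x) \<Longrightarrow>
    pd i (\<lambda>x. f x - g x) x = pd i f x - pd i g x"
  using pd_eqI[OF has_derivative_diff[OF has_derivative_frechet has_derivative_frechet]]
  by (simp add: pd_def)

lemma pd_sum: "(\<And>s. s \<in> T \<Longrightarrow> f s differentiable (at x)) \<Longrightarrow>
    pd i (\<lambda>x. \<Sum>s\<in>T. f s x) x = (\<Sum>s\<in>T. pd i (f s) x)"
  unfolding pd_def[of _ "f _"] by (intro pd_eqI has_derivative_sum has_derivative_frechet)

lemma pd_bilinear:
  assumes "bounded_bilinear p" "f differentiable (at x)" "g differentiable (at x)"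
  shows "pd i (\<lambda>x. p (f x) (g x)) x = p (pd i f x) (g x) + p (f x) (pd i g x)"
  using pd_eqI[OF bounded_bilinear.FDERIV[OF assms(1) has_derivative_frechet[OF assms(2)]
      has_derivative_frechet[OF assms(3)]]]
  by (simp add: pd_def)

lemma differentiable_bounded_linear:
  "bounded_linear L \<Longrightarrow> f differentiable (at x) \<Longrightarrow> (\<lambda>x. L (f x)) differentiable (at x)"
  using bounded_linear.has_derivative by (fastforce simp: differentiable_def)

lemma differentiable_bilinear:
  "bounded_bilinear p \<Longrightarrow> f differentiable (at x) \<Longrightarrow> g differentiable (at x) \<Longrightarrow>
    (\<lambda>x. p (f x) (g x)) differentiable (at x)"
  using bounded_bilinear.FDERIV by (fastforce simp: differentiable_def)

lemma differentiable_cong_open: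
  assumes "open S" "x \<in> S" "\<And>y. y \<in> S \<Longrightarrow> f y = g y"
  shows "f differentiable (at x) \<longleftrightarrow> g differentiable (at x)"
  unfolding differentiable_def
  using has_derivative_transform_within_open[of f _ x UNIV S g]
    has_derivative_transform_within_open[of g _ x UNIV S f] assms by auto

lemma pd_cong_open:
  assumes "open S" "x \<in> S" "\<And>y. y \<in> S \<Longrightarrow> f y = g y"
  shows "pd i f x = pd i g x"
proof -
  have "(f has_derivative f') (at x) \<longleftrightarrow> (g has_derivative f') (at x)" for f'
    using has_derivative_transform_within_open[of f _ x UNIV S g]
      has_derivative_transform_within_open[of g _ x UNIV S f] assms by auto
  then show ?thesis by (simp add: pd_def frechet_derivative_def)
qed

lemma Ck_on_cong:
  assumes "open S" "\<And>y. y \<in> S \<Longrightarrow> f y = g y"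
  shows "Ck_on k f S \<longleftrightarrow> Ck_on k g S"
  using assms(2)
proof (induction k arbitrary: f g)
  case 0
  then show ?case by (auto cong: continuous_on_cong)
next
  case (Suc k)
  have "Ck_on k (pd i f) S \<longleftrightarrow> Ck_on k (pd i g) S" for i
    by (rule Suc.IH) (use Suc.prems assms(1) in \<open>blast intro: pd_cong_open\<close>)
  then show ?case
    using Suc.prems differentiable_cong_open[OF assms(1), of _ f g] by auto
qed

lemma Ck_on_SucD: "Ck_on (Suc k) f S \<Longrightarrow> Ck_on k f S"
  by (induction k arbitrary: f)
     (auto intro!: differentiable_imp_continuous_on differentiable_at_imp_differentiable_on)

lemma Ck_on_const: "Ck_on k (\<lambda>x. c) S"
  for S :: "(real^'n) set" and c :: "'b::real_normed_vector"
proof (induction k arbitrary: c)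
  case (Suc k)
  have "pd i (\<lambda>x. c) = (\<lambda>x. 0 :: 'b)" for i :: 'n by (simp add: fun_eq_iff)
  then show ?case using Suc by simp
qed simp

lemma Ck_on_add:
  assumes "open S" "Ck_on k f S" "Ck_on k g S"
  shows "Ck_on k (\<lambda>x. f x + g x) S"
  using assms(2,3)
proof (induction k arbitrary: f g)
  case (Suc k)
  have "Ck_on k (pd i (\<lambda>x. f x + g x)) S" for i
    by (subst Ck_on_cong[OF assms(1), of _ "\<lambda>x. pd i f x + pd i g x"])
       (use Suc in \<open>auto simp: pd_add\<close>)
  then show ?case using Suc.prems by auto
qed (auto intro: continuous_intros)

lemma Ck_on_bounded_linear:
  assumes "bounded_linear L" "open S" "Ck_on k f S"
  shows "Ck_on k (\<lambda>x. L (f x)) S"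
  using assms(3)
proof (induction k arbitrary: f)
  case 0
  then show ?case using bounded_linear.continuous_on[OF assms(1)] by auto
next
  case (Suc k)
  have "Ck_on k (pd i (\<lambda>x. L (f x))) S" for i
    by (subst Ck_on_cong[OF assms(2), of _ "\<lambda>x. L (pd i f x)"])
       (use Suc assms(1) in \<open>auto simp: pd_bounded_linear\<close>)
  then show ?case using Suc.prems assms(1) by (auto intro: differentiable_bounded_linear)
qed

lemma Ck_on_bilinear:
  assumes "bounded_bilinear p" "open S" "Ck_on k f S" "Ck_on k g S"
  shows "Ck_on k (\<lambda>x. p (f x) (g x)) S"
  using assms(3,4)
proof (induction k arbitrary: f g)
  case 0
  then show ?case using bounded_bilinear.continuous_on[OF assms(1)] by auto
next
  case (Suc k)
  have "Ck_on k f S" "Ck_on k g S" using Suc.prems by (auto dest: Ck_on_SucD simp del: Ck_on.simps)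
  then have "Ck_on k (pd i (\<lambda>x. p (f x) (g x))) S" for i
    by (subst Ck_on_cong[OF assms(2), of _ "\<lambda>x. p (pd i f x) (g x) + p (f x) (pd i g x)"])
       (use Suc.prems assms(1) in \<open>auto simp: pd_bilinear intro!: Ck_on_add assms(2) Suc.IH\<close>)
  then show ?case using Suc.prems assms(1) by (auto intro: differentiable_bilinear)
qed

lemma smooth_on_cong:
  "open S \<Longrightarrow> (\<And>y. y \<in> S \<Longrightarrow> f y = g y) \<Longrightarrow> smooth_on S f \<longleftrightarrow> smooth_on S g"
  using Ck_on_cong[of S f g] by (simp add: smooth_on_def)

lemma smooth_on_const [simp]: "smooth_on S (\<lambda>x. c)"
  by (simp add: smooth_on_def Ck_on_const)

lemma smooth_on_add: "open S \<Longrightarrow> smooth_on S f \<Longrightarrow> smooth_on S g \<Longrightarrow> smooth_on S (\<lambda>x. f x + g x)"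
  by (simp add: smooth_on_def Ck_on_add)

lemma smooth_on_bounded_linear:
  "bounded_linear L \<Longrightarrow> open S \<Longrightarrow> smooth_on S f \<Longrightarrow> smooth_on S (\<lambda>x. L (f x))"
  by (simp add: smooth_on_def Ck_on_bounded_linear)

lemma smooth_on_bilinear:
  "bounded_bilinear p \<Longrightarrow> open S \<Longrightarrow> smooth_on S f \<Longrightarrow> smooth_on S g \<Longrightarrow>
    smooth_on S (\<lambda>x. p (f x) (g x))"
  by (simp add: smooth_on_def Ck_on_bilinear)

lemma smooth_on_scaleR: "open S \<Longrightarrow> smooth_on S f \<Longrightarrow> smooth_on S (\<lambda>x. c *\<^sub>R f x)"
  by (rule smooth_on_bounded_linear[OF bounded_linear_scaleR_right])

lemma smooth_on_minus: "open S \<Longrightarrow> smooth_on S f \<Longrightarrow> smooth_on S (\<lambda>x. - f x)"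
  by (rule smooth_on_bounded_linear[OF bounded_linear_minus[OF bounded_linear_ident]])

lemma smooth_on_diff: "open S \<Longrightarrow> smooth_on S f \<Longrightarrow> smooth_on S g \<Longrightarrow> smooth_on S (\<lambda>x. f x - g x)"
  using smooth_on_add[of S f "\<lambda>x. - g x"] smooth_on_minus[of S g] by simp

lemma smooth_on_sum:
  "open S \<Longrightarrow> (\<And>t. t \<in> T \<Longrightarrow> smooth_on S (f t)) \<Longrightarrow> smooth_on S (\<lambda>x. \<Sum>t\<in>T. f t x)"
  by (induction T rule: infinite_finite_induct) (simp_all add: smooth_on_add)

lemma smooth_on_pd: "smooth_on S f \<Longrightarrow> smooth_on S (pd i f)"
  unfolding smooth_on_def by (metis Ck_on.simps(2))

lemma smooth_on_differentiable: "smooth_on S f \<Longrightarrow> x \<in> S \<Longrightarrow> f differentiable (at x)"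
  unfolding smooth_on_def by (metis Ck_on.simps(2))

lemma smooth_on_continuous_on: "smooth_on S f \<Longrightarrow> continuous_on S f"
  unfolding smooth_on_def by (metis Ck_on.simps(1))

lemma smooth_on_subset: "smooth_on T f \<Longrightarrow> S \<subseteq> T \<Longrightarrow> smooth_on S f"
proof -
  have "Ck_on k f T \<Longrightarrow> S \<subseteq> T \<Longrightarrow> Ck_on k f S" for k
    by (induction k arbitrary: f) (auto intro: continuous_on_subset)
  then show "smooth_on T f \<Longrightarrow> S \<subseteq> T \<Longrightarrow> smooth_on S f" by (auto simp: smooth_on_def)
qed

section \<open>Symmetry of mixed partial derivatives\<close>

lemma has_real_derivative_pd:
  fixes f :: "real^'n \<Rightarrow> real"
  assumes "f differentiable (at (y + s *\<^sub>R axis i 1))"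
  shows "((\<lambda>s. f (y + s *\<^sub>R axis i 1)) has_real_derivative pd i f (y + s *\<^sub>R axis i 1)) (at s)"
proof -
  let ?D = "frechet_derivative f (at (y + s *\<^sub>R axis i 1))"
  have "((\<lambda>s. y + s *\<^sub>R axis i 1) has_derivative (\<lambda>h. h *\<^sub>R axis i 1)) (at s)"
    by (auto intro!: derivative_eq_intros)
  from diff_chain_at[OF this has_derivative_frechet[OF assms]]
  have "((\<lambda>s. f (y + s *\<^sub>R axis i 1)) has_derivative (\<lambda>h. ?D (h *\<^sub>R axis i 1))) (at s)"
    by (simp add: o_def)
  also have "(\<lambda>h. ?D (h *\<^sub>R axis i 1)) = (*) (pd i f (y + s *\<^sub>R axis i 1))"
    using linear_frechet_derivative[OF assms] by (simp add: fun_eq_iff linear_cmul pd_def)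
  finally show ?thesis by (simp add: has_field_derivative_def)
qed

text \<open>The mean value theorem is applied in direction i to the increment of f in direction j,
  and then in direction j to the i-th partial derivative. The second difference itself is symmetric
  in i and j.\<close>

lemma second_difference:
  fixes f :: "real^'n \<Rightarrow> real"
  assumes "smooth_on S f" "ball x r \<subseteq> S" "0 < h" "2 * h < r"
  obtains z where "dist z x \<le> 2 * h"
    "f (x + h *\<^sub>R axis i 1 + h *\<^sub>R axis j 1) - f (x + h *\<^sub>R axis i 1) - f (x + h *\<^sub>R axis j 1) + f x
      = h\<^sup>2 * pd j (pd i f) z"
proof -
  let ?p = "\<lambda>s t. x + s *\<^sub>R axis i 1 + t *\<^sub>R axis j (1::real)"
  have dist: "dist (?p s t) x \<le> 2 * h" if "0 \<le> s" "s \<le> h" "0 \<le> t" "t \<le> h" for s t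
  proof -
    have "dist (?p s t) x = norm (s *\<^sub>R axis i 1 + t *\<^sub>R axis j (1::real))"
      by (simp add: dist_norm algebra_simps)
    also have "\<dots> \<le> \<bar>s\<bar> + \<bar>t\<bar>"
      by (rule order_trans[OF norm_triangle_ineq]) (simp add: norm_axis_1)
    finally show ?thesis using that by simp
  qed
  have S: "?p s t \<in> S" if "0 \<le> s" "s \<le> h" "0 \<le> t" "t \<le> h" for s t
    using dist[OF that] assms by (auto simp: dist_commute subset_iff)
  have swap: "?p s t = (x + t *\<^sub>R axis j 1) + s *\<^sub>R axis i 1" for s t by simp
  have 1: "((\<lambda>s. f (?p s h) - f (?p s 0)) has_real_derivative pd i f (?p s h) - pd i f (?p s 0)) (at s)"
    if "0 \<le> s" "s \<le> h" for s
    unfolding swap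
    by (intro DERIV_diff has_real_derivative_pd smooth_on_differentiable[OF assms(1)])
       (use S[of s h] S[of s 0] that assms in \<open>auto simp: swap\<close>)
  obtain s where s: "0 < s" "s < h" "f (?p h h) - f (?p h 0) - (f (?p 0 h) - f (?p 0 0))
      = (h - 0) * (pd i f (?p s h) - pd i f (?p s 0))"
    using MVT2[OF \<open>0 < h\<close> 1] by blast
  have 2: "((\<lambda>t. pd i f (?p s t)) has_real_derivative pd j (pd i f) (?p s t)) (at t)"
    if "0 \<le> t" "t \<le> h" for t
    by (intro has_real_derivative_pd smooth_on_differentiable[OF smooth_on_pd[OF assms(1)]] S)
       (use s that in auto)
  obtain t where t: "0 < t" "t < h" "pd i f (?p s h) - pd i f (?p s 0) = (h - 0) * pd j (pd i f) (?p s t)"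
    using MVT2[OF \<open>0 < h\<close> 2] by blast
  show thesis
    by (rule that[of "?p s t"]) (use dist s t in \<open>auto simp: power2_eq_square algebra_simps\<close>)
qed

text \<open>The symmetric second difference equals h^2 times either mixed derivative, each at some
  point within 2 h of x, and both mixed derivatives are continuous at x.\<close>

lemma pd_commute_real:
  fixes f :: "real^'n \<Rightarrow> real"
  assumes f: "smooth_on S f" and S: "open S" "x \<in> S"
  shows "pd i (pd j f) x = pd j (pd i f) x"
proof (rule ccontr)
  define e where "e = \<bar>pd i (pd j f) x - pd j (pd i f) x\<bar> / 2"
  assume "pd i (pd j f) x \<noteq> pd j (pd i f) x"
  then have e: "e > 0" by (simp add: e_def)
  have cont: "\<exists>d>0. \<forall>z. dist z x < d \<longrightarrow> dist (pd a (pd b f) z) (pd a (pd b f) x) < e" for a b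
  proof -
    have "isCont (pd a (pd b f)) x"
      using smooth_on_continuous_on[OF smooth_on_pd[OF smooth_on_pd[OF f]]] S
      by (simp add: continuous_on_eq_continuous_at)
    then show ?thesis using e by (auto simp: continuous_at_eps_delta)
  qed
  obtain d1 where d1: "d1 > 0" "\<And>z. dist z x < d1 \<Longrightarrow> dist (pd i (pd j f) z) (pd i (pd j f) x) < e"
    using cont by blast
  obtain d2 where d2: "d2 > 0" "\<And>z. dist z x < d2 \<Longrightarrow> dist (pd j (pd i f) z) (pd j (pd i f) x) < e"
    using cont by blast
  obtain r where r: "r > 0" "ball x r \<subseteq> S" using S openE by blast
  define h where "h = Min {d1, d2, r} / 4"
  have h: "0 < h" "2 * h < r" "2 * h < d1" "2 * h < d2"
    using d1 d2 r by (auto simp: h_def)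
  obtain z where z: "dist z x \<le> 2 * h" "f (x + h *\<^sub>R axis i 1 + h *\<^sub>R axis j 1) - f (x + h *\<^sub>R axis i 1) - f (x + h *\<^sub>R axis j 1) + f x
      = h\<^sup>2 * pd j (pd i f) z"
    using second_difference[OF f r(2) h(1,2)] by blast
  obtain w where w: "dist w x \<le> 2 * h" "f (x + h *\<^sub>R axis j 1 + h *\<^sub>R axis i 1) - f (x + h *\<^sub>R axis j 1) - f (x + h *\<^sub>R axis i 1) + f x
      = h\<^sup>2 * pd i (pd j f) w"
    using second_difference[OF f r(2) h(1,2)] by blast
  have "f (x + h *\<^sub>R axis j 1 + h *\<^sub>R axis i 1) = f (x + h *\<^sub>R axis i 1 + h *\<^sub>R axis j 1)"
    by (simp add: add_ac)
  then have "h\<^sup>2 * pd j (pd i f) z = h\<^sup>2 * pd i (pd j f) w"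
    using z(2) w(2) by linarith
  then have "pd j (pd i f) z = pd i (pd j f) w" using h by simp
  moreover have "\<bar>pd i (pd j f) w - pd i (pd j f) x\<bar> < e" "\<bar>pd j (pd i f) z - pd j (pd i f) x\<bar> < e"
    using d1(2)[of w] d2(2)[of z] z(1) w(1) h by (simp_all add: dist_real_def)
  moreover have "\<bar>a - b\<bar> \<le> \<bar>c - a\<bar> + \<bar>c - b\<bar>" for a b c :: real by arith
  from this[of "pd i (pd j f) x" "pd j (pd i f) x" "pd i (pd j f) w"]
  have "2 * e \<le> \<bar>pd i (pd j f) w - pd i (pd j f) x\<bar> + \<bar>pd i (pd j f) w - pd j (pd i f) x\<bar>"
    by (simp add: e_def)
  ultimately show False by simp
qed

lemma pd_commute:
  fixes f :: "real^'n \<Rightarrow> 'b::euclidean_space"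
  assumes f: "smooth_on S f" and S: "open S" "x \<in> S"
  shows "pd i (pd j f) x = pd j (pd i f) x"
proof (rule euclidean_eqI)
  fix b :: 'b
  have L: "bounded_linear (\<lambda>y. y \<bullet> b)" by (rule bounded_linear_inner_left)
  have comm: "pd i (pd j f) x \<bullet> b = pd i (pd j (\<lambda>y. f y \<bullet> b)) x" for i j
  proof -
    have "pd i (pd j f) x \<bullet> b = pd i (\<lambda>y. pd j f y \<bullet> b) x"
      using pd_bounded_linear[OF L smooth_on_differentiable[OF smooth_on_pd[OF f] S(2)]] by simp
    also have "\<dots> = pd i (pd j (\<lambda>y. f y \<bullet> b)) x"
      by (rule pd_cong_open[OF S])
         (simp add: pd_bounded_linear[OF L smooth_on_differentiable[OF f]])
    finally show ?thesis .
  qed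
  show "pd i (pd j f) x \<bullet> b = pd j (pd i f) x \<bullet> b"
    unfolding comm by (rule pd_commute_real[OF smooth_on_bounded_linear[OF L S(1) f] S])
qed

section \<open>Matrices of forms\<close>

lemma norm_vec_le_sum: "norm v \<le> (\<Sum>i\<in>UNIV. norm (v $ i))"
  for v :: "'b::real_normed_vector^'k"
  unfolding norm_vec_def by (rule L2_set_le_sum) simp

lemma norm_matrix_le: "norm A \<le> (\<Sum>i\<in>UNIV. \<Sum>j\<in>UNIV. norm (A $ i $ j))"
  for A :: "'a::real_normed_vector^'n^'m"
  by (rule order_trans[OF norm_vec_le_sum]) (intro sum_mono norm_vec_le_sum)

lemma norm_entry_le: "norm (A $ i $ j) \<le> norm A"
  for A :: "'a::real_normed_vector^'n^'m"
  using Finite_Cartesian_Product.norm_nth_le[of A i] Finite_Cartesian_Product.norm_nth_le[of "A $ i" j] by linarith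

lemma bounded_bilinear_matrix_mult:
  "bounded_bilinear ((**) :: 'a::real_normed_algebra_1^'n^'m \<Rightarrow> 'a^'p^'n \<Rightarrow> 'a^'p^'m)"
proof
  let ?K = "\<Sum>i\<in>(UNIV :: 'm set). \<Sum>j\<in>(UNIV :: 'p set). \<Sum>k\<in>(UNIV :: 'n set). (1::real)"
  show "\<exists>K. \<forall>(A :: 'a^'n^'m) (B :: 'a^'p^'n). norm (A ** B) \<le> norm A * norm B * K"
  proof (intro exI allI)
    fix A :: "'a^'n^'m" and B :: "'a^'p^'n"
    have "norm (A ** B) \<le> (\<Sum>i\<in>UNIV. \<Sum>j\<in>UNIV. norm ((A ** B) $ i $ j))"
      by (rule norm_matrix_le)
    also have "\<dots> \<le> (\<Sum>i\<in>(UNIV :: 'm set). \<Sum>j\<in>(UNIV :: 'p set). \<Sum>k\<in>(UNIV :: 'n set). norm A * norm B)"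
      unfolding matrix_matrix_mult_def vec_lambda_beta
      by (intro sum_mono order_trans[OF norm_sum] order_trans[OF norm_mult_ineq] mult_mono norm_entry_le) auto
    also have "\<dots> = norm A * norm B * ?K" by simp
    finally show "norm (A ** B) \<le> norm A * norm B * ?K" .
  qed
qed (simp_all add: matrix_mult_simps)

lemma bounded_linear_matrix_map:
  fixes f :: "'a::real_normed_vector \<Rightarrow> 'b::real_normed_vector"
  assumes "bounded_linear f"
  shows "bounded_linear (\<lambda>A :: 'a^'n^'m. \<chi> i j. f (A $ i $ j))"
proof -
  interpret bounded_linear f by fact
  obtain K where K: "\<And>x. norm (f x) \<le> norm x * K" "K \<ge> 0" using nonneg_bounded by blast
  show ?thesis
  proof (rule bounded_linear_intro)
    fix A :: "'a^'n^'m"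
    have "norm (\<chi> i j. f (A $ i $ j)) \<le> (\<Sum>i\<in>(UNIV::'m set). \<Sum>j\<in>(UNIV::'n set). norm A * K)"
      by (intro order_trans[OF norm_matrix_le] sum_mono)
         (auto intro!: order_trans[OF K(1)] mult_right_mono norm_entry_le K)
    then show "norm (\<chi> i j. f (A $ i $ j)) \<le> norm A * (of_nat CARD('m) * (of_nat CARD('n) * K))"
      by (simp add: mult_ac)
  qed (simp_all add: vec_eq_iff add scaleR)
qed

text \<open>Real matrices as matrices of 0-forms. Connection and curvature matrices are sums of
  products \<open>mat a ** emb B\<close>; real entries are central, so the form part and the
  endomorphism part multiply independently (\<open>mat_emb_mult\<close>).\<close>

definition emb :: "real^'b^'a \<Rightarrow> ('n::{finite,linorder}) ext^'b^'a" where
  "emb A = (\<chi> i j. of_real (A $ i $ j))"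

lemma emb_simps:
  "emb 0 = 0" "emb (A + B) = emb A + emb B" "emb (A - B) = emb A - emb B" "emb (- A) = - emb A"
  "emb (r *\<^sub>R A) = r *\<^sub>R emb A" "emb (C ** E) = emb C ** emb E" "emb (mat 1) = mat 1"
  by (simp_all add: emb_def vec_eq_iff matrix_matrix_mult_def mat_def of_real_def scaleR_left.sum)
     (simp_all add: scaleR_add_left scaleR_diff_left mult.commute)

lemma bounded_linear_emb: "bounded_linear emb"
  unfolding emb_def[abs_def] by (rule bounded_linear_matrix_map[OF bounded_linear_of_real])

lemma emb_sum: "emb (sum f S) = (\<Sum>s\<in>S. emb (f s))"
  by (induction S rule: infinite_finite_induct) (simp_all add: emb_simps)

text \<open>Real entries are central, so with one real factor the trace is cyclic without any
  sign.\<close>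

lemma trace_emb_commute: "trace (emb A ** B) = trace (B ** emb A)"
  unfolding trace_def matrix_matrix_mult_def vec_lambda_beta emb_def of_real_def
  by (subst sum.swap) simp

lemma mat_mult_emb: "mat a ** emb B = emb B ** mat a"
  by (simp add: emb_def mat_def matrix_matrix_mult_def vec_eq_iff of_real_def if_distrib if_distribR cong: if_cong)

lemma mat_mult_nth: "(mat a ** B) $ i $ j = a * B $ i $ j" "(B ** mat a) $ i $ j = B $ i $ j * a"
  for a :: "'a::ring_1"
proof -
  have "(if P then a else 0) * c = (if P then a * c else 0)"
    "c * (if P then a else 0) = (if P then c * a else 0)" for P c by simp_all
  then show "(mat a ** B) $ i $ j = a * B $ i $ j" "(B ** mat a) $ i $ j = B $ i $ j * a"
    by (simp_all add: mat_def matrix_matrix_mult_def)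
qed

lemma mat_mult_mat: "mat a ** mat b = mat (a * b)"
  for a b :: "'a::ring_1"
  by (simp add: vec_eq_iff mat_mult_nth) (simp add: mat_def)

lemma mat_simps: "mat (a + b) = mat a + mat b" "mat (- a) = - mat a" "mat 0 = 0" "mat (a - b) = mat a - mat b"
  for a b :: "'a::ring_1"
  by (simp_all add: mat_def vec_eq_iff)

lemma mat_scaleR: "mat (r *\<^sub>R a) = r *\<^sub>R mat a"
  for a :: "'a::real_algebra_1"
  by (simp add: mat_def vec_eq_iff)

lemma mat_sum: "mat (sum f S) = (\<Sum>s\<in>S. mat (f s))"
  for f :: "'i \<Rightarrow> 'a::ring_1"
  by (induction S rule: infinite_finite_induct) (simp_all add: mat_simps)

definition mhomog :: "nat \<Rightarrow> 'n ext^'b^'a \<Rightarrow> bool" where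
  "mhomog k A \<longleftrightarrow> (\<forall>i j. homog k (A $ i $ j))"

lemma mhomog_simps:
  "mhomog k 0"
  "mhomog k A \<Longrightarrow> mhomog k B \<Longrightarrow> mhomog k (A + B)"
  "mhomog k A \<Longrightarrow> mhomog k B \<Longrightarrow> mhomog k (A - B)"
  "mhomog k A \<Longrightarrow> mhomog k (r *\<^sub>R A)"
  by (simp_all add: mhomog_def)

lemma mhomog_sum: "(\<And>s. s \<in> S \<Longrightarrow> mhomog k (f s)) \<Longrightarrow> mhomog k (sum f S)"
  by (induction S rule: infinite_finite_induct) (simp_all add: mhomog_simps)

lemma mhomog_mult: "mhomog j A \<Longrightarrow> mhomog k B \<Longrightarrow> mhomog (j + k) (A ** B)"
  by (auto simp: mhomog_def matrix_matrix_mult_def intro!: homog_sum homog_mult)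

lemma mhomog_mat: "homog k a \<Longrightarrow> mhomog k (mat a)"
  by (simp add: mhomog_def mat_def)

lemma mhomog_emb: "mhomog 0 (emb A)"
  by (simp add: mhomog_def emb_def of_real_def)

lemma mhomog_mpow: "mhomog j A \<Longrightarrow> mhomog (k * j) (mpow A k)"
proof (induction k)
  case 0
  show ?case using mhomog_emb[of "mat 1"] by (simp add: emb_simps)
qed (simp add: mhomog_mult)

lemma homog_trace: "mhomog k A \<Longrightarrow> homog k (trace A)"
  by (auto simp: mhomog_def trace_def intro: homog_sum)

text \<open>Graded cyclicity, the substitute for \<open>trace_mul_sym\<close> on matrices of forms:
  each exchange of two entries contributes (-1)^(j k).\<close>

lemma trace_homog_commute:
  assumes "mhomog j A" "mhomog k B"
  shows "trace (A ** B) = (- 1) ^ (j * k) * trace (B ** A)"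
proof -
  have "trace (A ** B) = (\<Sum>i\<in>UNIV. \<Sum>l\<in>UNIV. (- 1) ^ (j * k) * (B $ l $ i * A $ i $ l))"
    unfolding trace_def matrix_matrix_mult_def vec_lambda_beta
    using assms by (intro sum.cong refl homog_commute) (auto simp: mhomog_def)
  then show ?thesis
    unfolding trace_def matrix_matrix_mult_def vec_lambda_beta
    by (subst (asm) sum.swap) (simp add: sum_distrib_left)
qed

lemma mat_dx_mult:
  assumes "mhomog k A"
  shows "A ** mat (dx i) = (- 1) ^ k *\<^sub>R (mat (dx i) ** A)"
proof -
  have "a * dx i = (- 1) ^ k *\<^sub>R (dx i * a)" if "homog k a" for a
    using homog_commute[OF that, of 1 "dx i"] by (cases "even k") auto
  then show ?thesis using assms by (simp add: vec_eq_iff mat_mult_nth mhomog_def)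
qed

subsection \<open>Exterior derivative\<close>

text \<open>The exterior derivative in a single chart, with the derivative of the form as a
  vector-valued function in place of derivatives of its coefficients;
  \<open>ext_deriv_eq_ederiv\<close> links it to \<open>ext_deriv\<close>.\<close>

definition ederiv :: "(real^('n::{finite,linorder}) \<Rightarrow> 'n ext) \<Rightarrow> real^('n::{finite,linorder}) \<Rightarrow> 'n ext" where
  "ederiv f x = (\<Sum>i\<in>UNIV. dx i * pd i f x)"

definition mderiv :: "(real^('n::{finite,linorder}) \<Rightarrow> 'n ext^'b^'a) \<Rightarrow> real^('n::{finite,linorder}) \<Rightarrow> 'n ext^'b^'a" where
  "mderiv M x = (\<Sum>i\<in>UNIV. mat (dx i) ** pd i M x)"

lemma ederiv_mult:
  assumes "f differentiable (at x)" "g differentiable (at x)" "homog k (f x)"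
  shows "ederiv (\<lambda>x. f x * g x) x = ederiv f x * g x + (- 1) ^ k *\<^sub>R (f x * ederiv g x)"
proof -
  have "dx i * f x = (- 1) ^ k *\<^sub>R (f x * dx i)" for i
    using homog_commute[OF _ assms(3), of 1 "dx i"] by (cases "even k") auto
  then show ?thesis
    by (simp add: ederiv_def pd_bilinear[OF bounded_bilinear_mult assms(1,2)] distrib_left sum.distrib
        sum_distrib_left sum_distrib_right mult.assoc[symmetric] scaleR_sum_right)
qed

text \<open>The sign arises from moving \<open>dx i\<close> past \<open>A x\<close>, so homogeneity
  is required only at the point x.\<close>

lemma mderiv_mult:
  assumes "A differentiable (at x)" "B differentiable (at x)" "mhomog k (A x)"
  shows "mderiv (\<lambda>x. A x ** B x) x = mderiv A x ** B x + (- 1) ^ k *\<^sub>R (A x ** mderiv B x)"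
proof -
  have "mat (dx i) ** A x = (- 1) ^ k *\<^sub>R (A x ** mat (dx i))" for i
    using mat_dx_mult[OF assms(3), of i] by (cases "even k") auto
  then show ?thesis
    by (simp add: mderiv_def pd_bilinear[OF bounded_bilinear_matrix_mult assms(1,2)] matrix_mult_simps sum.distrib
        matrix_mul_assoc scaleR_sum_right)
qed

lemma bounded_linear_trace: "bounded_linear (trace :: 'a::real_normed_algebra_1^'n^'n \<Rightarrow> 'a)"
proof (rule bounded_linear_intro)
  fix A :: "'a^'n^'n"
  have "norm (trace A) \<le> (\<Sum>i\<in>(UNIV :: 'n set). norm A)"
    unfolding trace_def by (intro order_trans[OF norm_sum] sum_mono norm_entry_le)
  then show "norm (trace A) \<le> norm A * of_nat CARD('n)" by (simp add: mult.commute)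
qed (simp_all add: trace_simps)

lemma ederiv_trace:
  fixes M :: "real^('n::{finite,linorder}) \<Rightarrow> 'n ext^'a^'a"
  assumes "M differentiable (at x)"
  shows "ederiv (\<lambda>x. trace (M x)) x = trace (mderiv M x)"
proof -
  have "trace (mat a ** B) = a * trace B" for a and B :: "'n ext^'a^'a"
    by (simp add: trace_def mat_mult_nth sum_distrib_left)
  then show ?thesis
    by (simp add: ederiv_def mderiv_def pd_bounded_linear[OF bounded_linear_trace assms] trace_simps)
qed

lemma mderiv_cong: "open S \<Longrightarrow> x \<in> S \<Longrightarrow> (\<And>y. y \<in> S \<Longrightarrow> f y = g y) \<Longrightarrow> mderiv f x = mderiv g x"
  using pd_cong_open[of S x f g] by (simp add: mderiv_def)

lemma ederiv_sum: "(\<And>s. s \<in> T \<Longrightarrow> f s differentiable (at x)) \<Longrightarrow>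
    ederiv (\<lambda>x. \<Sum>s\<in>T. f s x) x = (\<Sum>s\<in>T. ederiv (f s) x)"
  by (simp add: ederiv_def pd_sum sum_distrib_left) (rule sum.swap)

lemma ederiv_add: "f differentiable (at x) \<Longrightarrow> g differentiable (at x) \<Longrightarrow>
    ederiv (\<lambda>x. f x + g x) x = ederiv f x + ederiv g x"
  by (simp add: ederiv_def pd_add distrib_left sum.distrib)

lemma mderiv_add: "f differentiable (at x) \<Longrightarrow> g differentiable (at x) \<Longrightarrow>
    mderiv (\<lambda>x. f x + g x) x = mderiv f x + mderiv g x"
  by (simp add: mderiv_def pd_add matrix_mult_simps sum.distrib)

lemma ederiv_scaleR: "f differentiable (at x) \<Longrightarrow> ederiv (\<lambda>x. r *\<^sub>R f x) x = r *\<^sub>R ederiv f x"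
  by (simp add: ederiv_def pd_bounded_linear[OF bounded_linear_scaleR_right] scaleR_sum_right)

lemma mderiv_scaleR: "f differentiable (at x) \<Longrightarrow> mderiv (\<lambda>x. r *\<^sub>R f x) x = r *\<^sub>R mderiv f x"
  by (simp add: mderiv_def pd_bounded_linear[OF bounded_linear_scaleR_right] scaleR_sum_right matrix_mult_simps)

lemma ederiv_const [simp]: "ederiv (\<lambda>x. c) x = 0"
  by (simp add: ederiv_def)

lemma smooth_on_matrix_mult:
  "open S \<Longrightarrow> smooth_on S A \<Longrightarrow> smooth_on S B \<Longrightarrow> smooth_on S (\<lambda>x. A x ** B x)"
  for A :: "real^'k \<Rightarrow> 'a::real_normed_algebra_1^'n^'m"
  by (rule smooth_on_bilinear[OF bounded_bilinear_matrix_mult])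

lemma smooth_on_mult:
  "open S \<Longrightarrow> smooth_on S f \<Longrightarrow> smooth_on S g \<Longrightarrow> smooth_on S (\<lambda>x. f x * g x)"
  for f :: "real^'k \<Rightarrow> 'a::real_normed_algebra"
  by (rule smooth_on_bilinear[OF bounded_bilinear_mult])

lemma smooth_on_emb: "open S \<Longrightarrow> smooth_on S f \<Longrightarrow> smooth_on S (\<lambda>x. emb (f x))"
  by (rule smooth_on_bounded_linear[OF bounded_linear_emb])

lemma smooth_on_trace: "open S \<Longrightarrow> smooth_on S f \<Longrightarrow> smooth_on S (\<lambda>x. trace (f x))"
  for f :: "real^'k \<Rightarrow> 'a::real_normed_algebra_1^'n^'n"
  by (rule smooth_on_bounded_linear[OF bounded_linear_trace])

lemma smooth_on_mpow: "open S \<Longrightarrow> smooth_on S f \<Longrightarrow> smooth_on S (\<lambda>x. mpow (f x) k)"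
  for f :: "real^'k \<Rightarrow> 'a::real_normed_algebra_1^'n^'n"
  by (induction k) (simp_all add: smooth_on_matrix_mult)

section \<open>Local Chern-Weil theory\<close>

definition conn_form :: "(real^('n::{finite,linorder}) \<Rightarrow> 'n \<Rightarrow> real^'b^'b) \<Rightarrow> real^('n::{finite,linorder}) \<Rightarrow> 'n ext^'b^'b" where
  "conn_form \<Gamma> x = (\<Sum>i\<in>UNIV. mat (dx i) ** emb (\<Gamma> x i))"

definition tens :: "('n::{finite,linorder} \<Rightarrow> 'n \<Rightarrow> real^'b^'b) \<Rightarrow> 'n ext^'b^'b" where
  "tens B = (\<Sum>i\<in>UNIV. \<Sum>j\<in>UNIV. mat (dx i * dx j) ** emb (B i j))"

definition curv :: "(real^'n \<Rightarrow> 'n \<Rightarrow> real^'b^'b) \<Rightarrow> real^'n \<Rightarrow> 'n \<Rightarrow> 'n \<Rightarrow> real^'b^'b" where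
  "curv \<Gamma> x i j = pd i (\<lambda>y. \<Gamma> y j) x - pd j (\<lambda>y. \<Gamma> y i) x + \<Gamma> x i ** \<Gamma> x j - \<Gamma> x j ** \<Gamma> x i"

text \<open>The factor 1/2 compensates for the ordered pairs in \<open>tens\<close>. The rank of the
  bundle is a type of its own: the local theory is that of any vector bundle with
  connection.\<close>

definition curv_form :: "(real^('n::{finite,linorder}) \<Rightarrow> 'n \<Rightarrow> real^'b^'b) \<Rightarrow> real^('n::{finite,linorder}) \<Rightarrow> 'n ext^'b^'b" where
  "curv_form \<Gamma> x = (1 / 2) *\<^sub>R tens (curv \<Gamma> x)"

lemma tens_add: "tens (\<lambda>i j. A i j + B i j) = tens A + tens B"
  and tens_diff: "tens (\<lambda>i j. A i j - B i j) = tens A - tens B"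
  by (simp_all add: tens_def emb_simps matrix_mult_simps sum.distrib sum_subtractf)

lemma tens_swap: "tens (\<lambda>i j. B j i) = - tens B"
proof -
  have "mat (dx j * dx i) ** emb (B i j) = - (mat (dx i * dx j) ** emb (B i j))" for i j
    by (subst dx_anticommute) (simp add: mat_simps matrix_mult_simps)
  then have "tens (\<lambda>i j. B j i) = (\<Sum>j\<in>UNIV. \<Sum>i\<in>UNIV. - (mat (dx i * dx j) ** emb (B i j)))"
    by (simp add: tens_def)
  also have "\<dots> = - tens B"
    by (subst sum.swap) (simp add: tens_def sum_negf)
  finally show ?thesis .
qed

lemma mat_emb_mult: "mat a ** emb A ** (mat b ** emb B) = mat (a * b) ** emb (A ** B)"
proof -
  have "mat a ** emb A ** (mat b ** emb B) = mat a ** (emb A ** mat b) ** emb B"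
    by (simp only: matrix_mul_assoc)
  also have "\<dots> = mat a ** (mat b ** emb A) ** emb B"
    by (simp only: mat_mult_emb)
  also have "\<dots> = mat (a * b) ** emb (A ** B)"
    by (simp only: matrix_mul_assoc mat_mult_mat[symmetric] emb_simps)
  finally show ?thesis .
qed

lemma conn_form_mult:
  fixes \<Gamma> \<Delta> :: "real^('n::{finite,linorder}) \<Rightarrow> 'n \<Rightarrow> real^'b^'b"
  shows "conn_form \<Gamma> x ** conn_form \<Delta> x = tens (\<lambda>i j. \<Gamma> x i ** \<Delta> x j)"
  unfolding conn_form_def tens_def by (simp add: matrix_mult_simps mat_emb_mult) (rule sum.swap)

lemma mhomog_conn_form: "mhomog 1 (conn_form \<Gamma> x)"
  unfolding conn_form_def
  using mhomog_mult[OF mhomog_mat mhomog_emb] by (intro mhomog_sum) fastforce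

lemma mhomog_tens: "mhomog 2 (tens B)"
proof -
  have "homog 2 (dx i * dx j)" for i j :: 'a
    using homog_mult[of 1 "dx i" 1 "dx j"] by (simp add: numeral_2_eq_2)
  then show ?thesis
    unfolding tens_def using mhomog_mult[OF mhomog_mat mhomog_emb] by (intro mhomog_sum) fastforce
qed

lemma mhomog_curv_form: "mhomog 2 (curv_form \<Gamma> x)"
  unfolding curv_form_def by (intro mhomog_simps mhomog_tens)

lemma bounded_linear_mult_emb: "bounded_linear (\<lambda>A. M ** emb A)"
  using bounded_linear_compose[OF bounded_bilinear.bounded_linear_right[OF bounded_bilinear_matrix_mult] bounded_linear_emb] .

lemma mderiv_sum: "(\<And>s. s \<in> T \<Longrightarrow> f s differentiable (at x)) \<Longrightarrow>
    mderiv (\<lambda>x. \<Sum>s\<in>T. f s x) x = (\<Sum>s\<in>T. mderiv (f s) x)"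
  by (simp add: mderiv_def pd_sum matrix_mult_simps) (rule sum.swap)

lemma mderiv_mat_emb:
  assumes "f differentiable (at x)"
  shows "mderiv (\<lambda>x. mat a ** emb (f x)) x = (\<Sum>i\<in>UNIV. mat (dx i * a) ** emb (pd i f x))"
  by (simp add: mderiv_def pd_bounded_linear[OF bounded_linear_mult_emb assms] matrix_mul_assoc mat_mult_mat)

lemma mderiv_conn_form:
  assumes "\<And>i. (\<lambda>y. \<Gamma> y i) differentiable (at x)"
  shows "mderiv (conn_form \<Gamma>) x = tens (\<lambda>i j. pd i (\<lambda>y. \<Gamma> y j) x)"
  unfolding conn_form_def[abs_def] using assms
  by (simp add: mderiv_sum differentiable_bounded_linear[OF bounded_linear_mult_emb] mderiv_mat_emb tens_def)
     (rule sum.swap)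

text \<open>Cartan's structure equation. Both halves of the curvature are antisymmetrised in i and
  j, and \<open>tens\<close> changes sign when the two indices are exchanged, so the factor 1/2
  cancels.\<close>

lemma curv_form_eq:
  assumes "\<And>i. (\<lambda>y. \<Gamma> y i) differentiable (at x)"
  shows "curv_form \<Gamma> x = mderiv (conn_form \<Gamma>) x + conn_form \<Gamma> x ** conn_form \<Gamma> x"
proof -
  let ?P = "tens (\<lambda>i j. pd i (\<lambda>y. \<Gamma> y j) x)" and ?Q = "tens (\<lambda>i j. \<Gamma> x i ** \<Gamma> x j)"
  have "tens (curv \<Gamma> x) = ?P - tens (\<lambda>i j. pd j (\<lambda>y. \<Gamma> y i) x) + ?Q - tens (\<lambda>i j. \<Gamma> x j ** \<Gamma> x i)"
    by (simp add: curv_def[abs_def] tens_add tens_diff)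
  also have "\<dots> = 2 *\<^sub>R (?P + ?Q)"
    using tens_swap[of "\<lambda>i j. pd i (\<lambda>y. \<Gamma> y j) x"] tens_swap[of "\<lambda>i j. \<Gamma> x i ** \<Gamma> x j"]
    by (simp add: scaleR_2)
  finally show ?thesis
    by (simp add: curv_form_def mderiv_conn_form[OF assms] conn_form_mult)
qed

context
  fixes S :: "(real^('n::{finite,linorder})) set" and \<Gamma> :: "real^('n::{finite,linorder}) \<Rightarrow> 'n \<Rightarrow> real^'b^'b"
  assumes S: "open S" and smooth: "\<And>i. smooth_on S (\<lambda>x. \<Gamma> x i)"
begin

lemma differentiable_conn: "x \<in> S \<Longrightarrow> (\<lambda>y. \<Gamma> y i) differentiable (at x)"
  by (rule smooth_on_differentiable[OF smooth])

lemma smooth_on_conn_form: "smooth_on S (conn_form \<Gamma>)"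
  unfolding conn_form_def[abs_def]
  by (intro smooth_on_sum S smooth_on_matrix_mult smooth_on_const smooth_on_emb smooth)

lemma smooth_on_tens_pd: "smooth_on S (\<lambda>x. tens (\<lambda>i j. pd i (\<lambda>y. \<Gamma> y j) x))"
  unfolding tens_def
  by (intro smooth_on_sum S smooth_on_matrix_mult smooth_on_const smooth_on_emb smooth_on_pd smooth)

lemma smooth_on_mderiv_conn_form: "smooth_on S (mderiv (conn_form \<Gamma>))"
  using smooth_on_cong[OF S, of "mderiv (conn_form \<Gamma>)"] smooth_on_tens_pd
  by (simp add: mderiv_conn_form differentiable_conn)

lemma smooth_on_curv_form: "smooth_on S (curv_form \<Gamma>)"
  using smooth_on_cong[OF S, of "curv_form \<Gamma>" "\<lambda>x. mderiv (conn_form \<Gamma>) x + conn_form \<Gamma> x ** conn_form \<Gamma> x"]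
  by (simp add: curv_form_eq differentiable_conn smooth_on_add smooth_on_matrix_mult S
      smooth_on_mderiv_conn_form smooth_on_conn_form)

text \<open>Second derivatives are symmetric in the indices k and i while the product of
  \<open>dx k\<close> and \<open>dx i\<close> is antisymmetric; renaming the indices shows that the
  sum is its own negative.\<close>

lemma mderiv_mderiv_conn_form:
  assumes x: "x \<in> S"
  shows "mderiv (mderiv (conn_form \<Gamma>)) x = 0"
proof -
  let ?f = "\<lambda>k i j. pd k (\<lambda>y. pd i (\<lambda>y. \<Gamma> y j) y) x"
  let ?X = "\<Sum>i\<in>UNIV. \<Sum>j\<in>UNIV. \<Sum>k\<in>UNIV. mat (dx k * (dx i * dx j)) ** emb (?f k i j)"
  have diff: "(\<lambda>y. pd i (\<lambda>y. \<Gamma> y j) y) differentiable (at x)" for i j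
    by (rule smooth_on_differentiable[OF smooth_on_pd[OF smooth] x])
  have "mderiv (mderiv (conn_form \<Gamma>)) x = mderiv (\<lambda>x. tens (\<lambda>i j. pd i (\<lambda>y. \<Gamma> y j) x)) x"
    by (rule mderiv_cong[OF S x]) (simp add: mderiv_conn_form differentiable_conn)
  also have "\<dots> = ?X"
    unfolding tens_def
    using diff by (simp add: mderiv_sum differentiable_bounded_linear[OF bounded_linear_mult_emb] mderiv_mat_emb
        differentiable_sum)
  also have "?X = - ?X"
  proof -
    have "mat (dx k * (dx i * dx j)) ** emb (?f k i j) = - (mat (dx i * (dx k * dx j)) ** emb (?f i k j))" for i j k
    proof -
      have "dx k * (dx i * dx j) = - (dx i * (dx k * dx j))"
        using dx_anticommute[of k i] by (simp add: mult.assoc[symmetric])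
      moreover have "?f k i j = ?f i k j"
        using pd_commute[OF smooth S x, of k i j] by (simp add: eta_contract_eq)
      ultimately show ?thesis by (simp add: mat_simps matrix_mult_simps)
    qed
    then have "?X = (\<Sum>i\<in>UNIV. \<Sum>j\<in>UNIV. \<Sum>k\<in>UNIV. - (mat (dx i * (dx k * dx j)) ** emb (?f i k j)))"
      by (intro sum.cong refl)
    also have "\<dots> = (\<Sum>j\<in>UNIV. \<Sum>i\<in>UNIV. \<Sum>k\<in>UNIV. - (mat (dx i * (dx k * dx j)) ** emb (?f i k j)))"
      by (rule sum.swap)
    also have "\<dots> = (\<Sum>j\<in>UNIV. \<Sum>k\<in>UNIV. \<Sum>i\<in>UNIV. - (mat (dx i * (dx k * dx j)) ** emb (?f i k j)))"
      by (intro sum.cong refl sum.swap)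
    also have "\<dots> = (\<Sum>k\<in>UNIV. \<Sum>j\<in>UNIV. \<Sum>i\<in>UNIV. - (mat (dx i * (dx k * dx j)) ** emb (?f i k j)))"
      by (rule sum.swap)
    also have "\<dots> = - ?X" by (simp add: sum_negf)
    finally show ?thesis .
  qed
  then have "?X = 0" by (simp add: eq_neg_iff_add_eq_0 scaleR_2[symmetric])
  finally show ?thesis .
qed

text \<open>The structure equation is differentiated once more. When the derivative of the
  connection form is replaced by curvature minus square, the cubic terms cancel.\<close>

lemma bianchi:
  assumes x: "x \<in> S"
  shows "mderiv (curv_form \<Gamma>) x = curv_form \<Gamma> x ** conn_form \<Gamma> x - conn_form \<Gamma> x ** curv_form \<Gamma> x"
proof -
  note diff = smooth_on_differentiable[OF _ x]
  have "mderiv (curv_form \<Gamma>) x = mderiv (\<lambda>x. mderiv (conn_form \<Gamma>) x + conn_form \<Gamma> x ** conn_form \<Gamma> x) x"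
    by (rule mderiv_cong[OF S x]) (simp add: curv_form_eq differentiable_conn)
  also have "\<dots> = mderiv (mderiv (conn_form \<Gamma>)) x + mderiv (\<lambda>x. conn_form \<Gamma> x ** conn_form \<Gamma> x) x"
    by (intro mderiv_add diff smooth_on_mderiv_conn_form smooth_on_matrix_mult S smooth_on_conn_form)
  also have "\<dots> = mderiv (conn_form \<Gamma>) x ** conn_form \<Gamma> x - conn_form \<Gamma> x ** mderiv (conn_form \<Gamma>) x"
    using mderiv_mult[OF diff diff mhomog_conn_form] smooth_on_conn_form
    by (simp add: mderiv_mderiv_conn_form[OF x])
  also have "\<dots> = curv_form \<Gamma> x ** conn_form \<Gamma> x - conn_form \<Gamma> x ** curv_form \<Gamma> x"
    by (simp add: curv_form_eq differentiable_conn[OF x] matrix_mult_simps matrix_mul_assoc)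
  finally show ?thesis .
qed

lemma mderiv_mpow_curv_form:
  assumes x: "x \<in> S"
  shows "mderiv (\<lambda>x. mpow (curv_form \<Gamma> x) k) x
    = mpow (curv_form \<Gamma> x) k ** conn_form \<Gamma> x - conn_form \<Gamma> x ** mpow (curv_form \<Gamma> x) k"
proof (induction k)
  case 0
  show ?case by (simp add: mderiv_def matrix_mult_simps)
next
  case (Suc k)
  note diff = smooth_on_differentiable[OF _ x]
  have "mderiv (\<lambda>x. mpow (curv_form \<Gamma> x) (Suc k)) x
      = mderiv (curv_form \<Gamma>) x ** mpow (curv_form \<Gamma> x) k + curv_form \<Gamma> x ** mderiv (\<lambda>x. mpow (curv_form \<Gamma> x) k) x"
    using mderiv_mult[OF diff[OF smooth_on_curv_form] diff[OF smooth_on_mpow[OF S smooth_on_curv_form]] mhomog_curv_form]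
    by simp
  then show ?case
    by (simp add: Suc bianchi[OF x] matrix_mult_simps matrix_mul_assoc)
qed

text \<open>The derivative of a power of the curvature is its commutator with the connection form;
  the power has even degree, so this commutator has trace zero.\<close>

lemma ederiv_trace_mpow_curv_form:
  assumes x: "x \<in> S"
  shows "ederiv (\<lambda>x. trace (mpow (curv_form \<Gamma> x) k)) x = 0"
proof -
  have "trace (mpow (curv_form \<Gamma> x) k ** conn_form \<Gamma> x) = trace (conn_form \<Gamma> x ** mpow (curv_form \<Gamma> x) k)"
    using trace_homog_commute[OF mhomog_mpow[OF mhomog_curv_form] mhomog_conn_form] by simp
  then show ?thesis
    using smooth_on_differentiable[OF smooth_on_mpow[OF S smooth_on_curv_form] x]
    by (simp add: ederiv_trace mderiv_mpow_curv_form[OF x] trace_simps)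
qed

text \<open>Under the trace only the covariant derivative of the 1-form \<alpha> survives. When
  \<alpha> is the difference of two connections, this covariant derivative is the velocity of the
  curvature along the segment between them.\<close>

lemma ederiv_trace_mpow_curv_form_mult:
  assumes x: "x \<in> S" and \<alpha>: "smooth_on S \<alpha>" "mhomog 1 (\<alpha> x)"
  shows "ederiv (\<lambda>x. trace (mpow (curv_form \<Gamma> x) k ** \<alpha> x)) x
    = trace (mpow (curv_form \<Gamma> x) k ** (mderiv \<alpha> x + conn_form \<Gamma> x ** \<alpha> x + \<alpha> x ** conn_form \<Gamma> x))"
proof -
  let ?C = "mpow (curv_form \<Gamma> x) k"
  note diff = smooth_on_differentiable[OF _ x]
  have hom: "mhomog (k * 2) (mpow (curv_form \<Gamma> x) k)" for x by (rule mhomog_mpow[OF mhomog_curv_form])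
  have "trace (conn_form \<Gamma> x ** (?C ** \<alpha> x)) = (- 1) ^ (1 * (k * 2 + 1)) * trace (?C ** \<alpha> x ** conn_form \<Gamma> x)"
    by (rule trace_homog_commute[OF mhomog_conn_form mhomog_mult[OF hom \<alpha>(2)]])
  then have *: "trace (conn_form \<Gamma> x ** ?C ** \<alpha> x) = - trace (?C ** \<alpha> x ** conn_form \<Gamma> x)"
    by (simp add: matrix_mul_assoc)
  have "ederiv (\<lambda>x. trace (mpow (curv_form \<Gamma> x) k ** \<alpha> x)) x = trace (mderiv (\<lambda>x. mpow (curv_form \<Gamma> x) k ** \<alpha> x) x)"
    by (intro ederiv_trace diff smooth_on_matrix_mult S \<alpha> smooth_on_mpow smooth_on_curv_form)
  also have "mderiv (\<lambda>x. mpow (curv_form \<Gamma> x) k ** \<alpha> x) x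
      = mderiv (\<lambda>x. mpow (curv_form \<Gamma> x) k) x ** \<alpha> x + ?C ** mderiv \<alpha> x"
    using mderiv_mult[OF diff[OF smooth_on_mpow[OF S smooth_on_curv_form]] diff[OF \<alpha>(1)] hom] by simp
  finally show ?thesis
    by (simp add: mderiv_mpow_curv_form[OF x] matrix_mult_simps trace_simps * matrix_mul_assoc)
qed

end

subsection \<open>Newton polynomials in power sums\<close>

text \<open>If \<open>p i\<close> is the trace of the \<open>i\<close>-th power of an \<open>n \<times> n\<close> matrix \<open>N\<close>, this is the coefficient of
  \<open>t^(n - k)\<close> in \<open>det (t I - N)\<close>; the value \<open>p 0\<close> is irrelevant.\<close>

fun newton :: "(nat \<Rightarrow> 'a::real_algebra_1) \<Rightarrow> nat \<Rightarrow> 'a" where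
  "newton p 0 = 1"
| "newton p (Suc k) = - (1 / real (Suc k)) *\<^sub>R (\<Sum>i\<le>k. newton p (k - i) * p (Suc i))"

text \<open>The derivative of \<open>newton p k\<close> when \<open>p\<close> varies with velocity \<open>q\<close>.\<close>

fun newton_diff :: "(nat \<Rightarrow> 'a::real_algebra_1) \<Rightarrow> (nat \<Rightarrow> 'a) \<Rightarrow> nat \<Rightarrow> 'a" where
  "newton_diff p q 0 = 0"
| "newton_diff p q (Suc k) = - (1 / real (Suc k)) *\<^sub>R
    (\<Sum>i\<le>k. newton_diff p q (k - i) * p (Suc i) + newton p (k - i) * q (Suc i))"

lemma homog_subst: "homog j a \<Longrightarrow> j = k \<Longrightarrow> homog k a"
  by simp

lemma homog_newton:
  fixes p :: "nat \<Rightarrow> 'n::{finite,linorder} ext"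
  assumes "\<And>i. homog (2 * i) (p i)"
  shows "homog (2 * k) (newton p k)"
proof (induction k rule: less_induct)
  case (less k)
  show ?case
  proof (cases k)
    case (Suc m)
    have "homog (2 * Suc m) (newton p (m - i) * p (Suc i))" if "i \<le> m" for i
      by (rule homog_subst[OF homog_mult[OF less.IH assms]]) (use that Suc in auto)
    then show ?thesis
      unfolding Suc newton.simps by (intro homog_simps homog_sum) auto
  qed auto
qed

lemma homog_newton_diff:
  fixes p q :: "nat \<Rightarrow> 'n::{finite,linorder} ext"
  assumes "\<And>i. homog (2 * i) (p i)" "\<And>i. homog (2 * i + 1) (q (Suc i))"
  shows "homog (2 * k + 1) (newton_diff p q (Suc k))"
proof (induction k rule: less_induct)
  case (less k)
  have "homog (2 * k + 1) (newton_diff p q (k - i) * p (Suc i))" if "i \<le> k" for i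
  proof (cases "k - i")
    case (Suc m)
    show ?thesis
      unfolding Suc by (rule homog_subst[OF homog_mult[OF less.IH assms(1)]]) (use that Suc in auto)
  qed simp
  moreover have "homog (2 * k + 1) (newton p (k - i) * q (Suc i))" if "i \<le> k" for i
    by (rule homog_subst[OF homog_mult[OF homog_newton[OF assms(1)] assms(2)]]) (use that in auto)
  ultimately show ?case
    unfolding newton_diff.simps by (intro homog_simps homog_sum) auto
qed

lemma smooth_on_newton:
  fixes p :: "real^'k \<Rightarrow> nat \<Rightarrow> 'a::real_normed_algebra_1"
  assumes "open S" "\<And>i. smooth_on S (\<lambda>x. p x i)"
  shows "smooth_on S (\<lambda>x. newton (p x) k)"
proof (induction k rule: less_induct)
  case (less k)
  show ?case
    by (cases k) (auto intro!: smooth_on_scaleR smooth_on_minus smooth_on_sum smooth_on_mult assms less.IH)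
qed

lemma smooth_on_newton_diff:
  fixes p q :: "real^'k \<Rightarrow> nat \<Rightarrow> 'a::real_normed_algebra_1"
  assumes "open S" "\<And>i. smooth_on S (\<lambda>x. p x i)" "\<And>i. smooth_on S (\<lambda>x. q x i)"
  shows "smooth_on S (\<lambda>x. newton_diff (p x) (q x) k)"
proof (induction k rule: less_induct)
  case (less k)
  show ?case
    by (cases k) (auto intro!: smooth_on_scaleR smooth_on_minus smooth_on_add smooth_on_sum smooth_on_mult
        smooth_on_newton assms less.IH)
qed

lemma ederiv_newton:
  assumes S: "open S" "x \<in> S" and p: "\<And>i. smooth_on S (\<lambda>x. p x i)" "\<And>x i. homog (2 * i) (p x i)"
    and closed: "\<And>i. ederiv (\<lambda>x. p x i) x = 0"
  shows "ederiv (\<lambda>x. newton (p x) k) x = 0"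
proof (induction k rule: less_induct)
  case (less k)
  note diff = smooth_on_differentiable[OF _ S(2)]
  show ?case
  proof (cases k)
    case (Suc m)
    have *: "ederiv (\<lambda>x. newton (p x) (m - i) * p x (Suc i)) x = 0" for i
    proof -
      have "ederiv (\<lambda>x. newton (p x) (m - i) * p x (Suc i)) x = ederiv (\<lambda>x. newton (p x) (m - i)) x * p x (Suc i)
          + (- 1) ^ (2 * (m - i)) *\<^sub>R (newton (p x) (m - i) * ederiv (\<lambda>x. p x (Suc i)) x)"
        by (intro ederiv_mult diff smooth_on_newton homog_newton S p)
      then show ?thesis using less.IH[of "m - i"] closed Suc by simp
    qed
    have "(\<lambda>x. newton (p x) (m - i) * p x (Suc i)) differentiable (at x)" for i
      by (intro diff smooth_on_mult smooth_on_newton S p)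
    then show ?thesis
      unfolding Suc newton.simps by (subst ederiv_scaleR) (simp_all add: ederiv_sum * differentiable_sum)
  qed simp
qed

text \<open>Once the power sums \<open>p\<close> are closed, the derivative acts on the velocities
  \<open>q\<close> only; the factors in front of them have even degree and cause no sign.\<close>

lemma ederiv_newton_diff:
  assumes S: "open S" "x \<in> S" and p: "\<And>i. smooth_on S (\<lambda>x. p x i)" "\<And>x i. homog (2 * i) (p x i)"
    and closed: "\<And>i. ederiv (\<lambda>x. p x i) x = 0"
    and q: "\<And>i. smooth_on S (\<lambda>x. q x i)" "\<And>x i. homog (2 * i + 1) (q x (Suc i))"
  shows "ederiv (\<lambda>x. newton_diff (p x) (q x) k) x = newton_diff (p x) (\<lambda>i. ederiv (\<lambda>x. q x i) x) k"
proof (induction k rule: less_induct)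
  case (less k)
  note diff = smooth_on_differentiable[OF _ S(2)]
  show ?case
  proof (cases k)
    case (Suc m)
    let ?dq = "\<lambda>i. ederiv (\<lambda>x. q x i) x"
    \<comment> \<open>The degree only enters through the sign of a term containing the derivative of
      a power sum, which vanishes; hence its mere existence is enough.\<close>
    have hom: "\<exists>l. homog l (newton_diff (p x) (q x) j)" for j
      using homog_newton_diff[of "p x" "q x", OF p(2) q(2)] by (cases j) (auto simp del: newton_diff.simps(2))
    have 1: "ederiv (\<lambda>x. newton_diff (p x) (q x) (m - i) * p x (Suc i)) x
        = newton_diff (p x) ?dq (m - i) * p x (Suc i)" for i
    proof -
      obtain l where "homog l (newton_diff (p x) (q x) (m - i))" using hom by blast
      then have "ederiv (\<lambda>x. newton_diff (p x) (q x) (m - i) * p x (Suc i)) x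
          = ederiv (\<lambda>x. newton_diff (p x) (q x) (m - i)) x * p x (Suc i)
          + (- 1) ^ l *\<^sub>R (newton_diff (p x) (q x) (m - i) * ederiv (\<lambda>x. p x (Suc i)) x)"
        by (intro ederiv_mult diff smooth_on_newton_diff S p q)
      then show ?thesis using less.IH[of "m - i"] closed Suc by simp
    qed
    have 2: "ederiv (\<lambda>x. newton (p x) (m - i) * q x (Suc i)) x = newton (p x) (m - i) * ?dq (Suc i)" for i
    proof -
      have "ederiv (\<lambda>x. newton (p x) (m - i) * q x (Suc i)) x = ederiv (\<lambda>x. newton (p x) (m - i)) x * q x (Suc i)
          + (- 1) ^ (2 * (m - i)) *\<^sub>R (newton (p x) (m - i) * ederiv (\<lambda>x. q x (Suc i)) x)"
        by (intro ederiv_mult diff smooth_on_newton homog_newton S p q)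
      then show ?thesis using ederiv_newton[OF S p closed] by simp
    qed
    have d1: "(\<lambda>x. newton_diff (p x) (q x) (m - i) * p x (Suc i)) differentiable (at x)" for i
      by (intro diff smooth_on_mult smooth_on_newton_diff S p q)
    have d2: "(\<lambda>x. newton (p x) (m - i) * q x (Suc i)) differentiable (at x)" for i
      by (intro diff smooth_on_mult smooth_on_newton S p q)
    show ?thesis
      unfolding Suc newton_diff.simps
      by (subst ederiv_scaleR)
         (simp_all add: ederiv_sum ederiv_add d1 d2 1 2 differentiable_sum differentiable_add)
  qed simp
qed

lemma newton_has_vector_derivative:
  fixes p q :: "real \<Rightarrow> nat \<Rightarrow> 'a::real_normed_algebra_1"
  assumes "\<And>i. ((\<lambda>t. p t i) has_vector_derivative q t i) (at t)"
  shows "((\<lambda>t. newton (p t) k) has_vector_derivative newton_diff (p t) (q t) k) (at t)"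
proof (induction k rule: less_induct)
  case (less k)
  show ?case
  proof (cases k)
    case (Suc m)
    have "((\<lambda>t. newton (p t) (m - i) * p t (Suc i)) has_vector_derivative
        newton p' (m - i) * q t (Suc i) + newton_diff p' (q t) (m - i) * p' (Suc i)) (at t)"
      if "p' = p t" for i p'
      unfolding that by (rule has_vector_derivative_mult) (use less.IH[of "m - i"] Suc assms in auto)
    then show ?thesis
      unfolding Suc newton.simps newton_diff.simps
      by (intro bounded_linear.has_vector_derivative[OF bounded_linear_scaleR_right] has_vector_derivative_sum)
         (simp add: add.commute)
  qed simp
qed

subsection \<open>Exact quadrature of polynomial paths\<close>

text \<open>Weights with prescribed moments at the nodes 0, ..., m. Multiplication by j - (m + 1)
  removes the new node, so the old nodes are solved for the moments c (l + 1) - (m + 1) c l; the new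
  weight is then fixed by the zeroth moment, and the recursion in l yields the others.\<close>

lemma vandermonde_solution: "\<exists>w. \<forall>l\<le>m. (\<Sum>j\<le>m. w j * real j ^ l) = c l"
proof (induction m arbitrary: c)
  case 0
  show ?case by (rule exI[of _ "\<lambda>j. c 0"]) simp
next
  case (Suc m)
  let ?b = "real (Suc m)"
  obtain v where v: "\<And>l. l \<le> m \<Longrightarrow> (\<Sum>j\<le>m. v j * real j ^ l) = c (Suc l) - ?b * c l"
    using Suc[of "\<lambda>l. c (Suc l) - ?b * c l"] by blast
  define u where "u j = v j / (real j - ?b)" for j
  define w where "w j = (if j \<le> m then u j else c 0 - (\<Sum>j\<le>m. u j))" for j
  have w: "(\<Sum>j\<le>Suc m. w j * real j ^ l) = (\<Sum>j\<le>m. u j * real j ^ l) + (c 0 - (\<Sum>j\<le>m. u j)) * ?b ^ l" for l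
    by (simp add: w_def)
  have "(\<Sum>j\<le>Suc m. w j * real j ^ l) = c l" if "l \<le> Suc m" for l
    using that
  proof (induction l)
    case 0
    show ?case unfolding w by simp
  next
    case (Suc l)
    have "(\<Sum>j\<le>m. u j * real j ^ Suc l) - ?b * (\<Sum>j\<le>m. u j * real j ^ l) = (\<Sum>j\<le>m. v j * real j ^ l)"
      unfolding sum_distrib_left sum_subtractf[symmetric]
    proof (intro sum.cong refl)
      fix j assume "j \<in> {..m}"
      then have "v j = u j * (real j - ?b)" by (auto simp: u_def)
      moreover have "u j * real j ^ Suc l - ?b * (u j * real j ^ l) = u j * (real j - ?b) * real j ^ l"
        by (simp add: algebra_simps)
      ultimately show "u j * real j ^ Suc l - ?b * (u j * real j ^ l) = v j * real j ^ l" by simp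
    qed
    moreover have "(\<Sum>j\<le>m. u j * real j ^ l) + (c 0 - (\<Sum>j\<le>m. u j)) * ?b ^ l = c l"
      using Suc unfolding w by simp
    then have "(c 0 - (\<Sum>j\<le>m. u j)) * ?b ^ l = c l - (\<Sum>j\<le>m. u j * real j ^ l)" by simp
    then have "(c 0 - (\<Sum>j\<le>m. u j)) * ?b ^ Suc l = ?b * (c l - (\<Sum>j\<le>m. u j * real j ^ l))"
      by (simp only: power_Suc mult.left_commute)
    ultimately show ?case
      using Suc.prems v[of l] unfolding w by (simp only: right_diff_distrib)
  qed
  then show ?case by blast
qed

definition polyfn :: "nat \<Rightarrow> (real \<Rightarrow> 'a::real_vector) \<Rightarrow> bool" where
  "polyfn m f \<longleftrightarrow> (\<exists>a. \<forall>t. f t = (\<Sum>j\<le>m. t ^ j *\<^sub>R a j))"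

lemma polyfn_const: "polyfn m (\<lambda>t. c)"
  unfolding polyfn_def
proof (intro exI allI)
  show "c = (\<Sum>j\<le>m. t ^ j *\<^sub>R (if j = 0 then c else 0))" for t
    by (simp add: if_distrib cong: if_cong)
qed

lemma polyfn_add: "polyfn m f \<Longrightarrow> polyfn m g \<Longrightarrow> polyfn m (\<lambda>t. f t + g t)"
proof -
  assume "polyfn m f" "polyfn m g"
  then obtain a b where "\<And>t. f t = (\<Sum>j\<le>m. t ^ j *\<^sub>R a j)" "\<And>t. g t = (\<Sum>j\<le>m. t ^ j *\<^sub>R b j)"
    unfolding polyfn_def by blast
  then show ?thesis
    unfolding polyfn_def by (intro exI[of _ "\<lambda>j. a j + b j"]) (simp add: scaleR_add_right sum.distrib)
qed

lemma polyfn_linear: "linear L \<Longrightarrow> polyfn m f \<Longrightarrow> polyfn m (\<lambda>t. L (f t))"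
proof -
  assume L: "linear L" and "polyfn m f"
  then obtain a where "\<And>t. f t = (\<Sum>j\<le>m. t ^ j *\<^sub>R a j)" unfolding polyfn_def by blast
  then show ?thesis
    unfolding polyfn_def by (intro exI[of _ "\<lambda>j. L (a j)"]) (simp add: linear_sum[OF L] linear_cmul[OF L])
qed

lemma polyfn_sum: "(\<And>s. s \<in> S \<Longrightarrow> polyfn m (f s)) \<Longrightarrow> polyfn m (\<lambda>t. \<Sum>s\<in>S. f s t)"
  by (induction S rule: infinite_finite_induct) (simp_all add: polyfn_const polyfn_add)

lemma polyfn_monomial: "j \<le> m \<Longrightarrow> polyfn m (\<lambda>t. t ^ j *\<^sub>R a)"
  unfolding polyfn_def
proof (intro exI allI)
  show "j \<le> m \<Longrightarrow> t ^ j *\<^sub>R a = (\<Sum>l\<le>m. t ^ l *\<^sub>R (if l = j then a else 0))" for t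
    by (simp add: if_distrib cong: if_cong)
qed

lemma polyfn_bilinear:
  assumes p: "bounded_bilinear p" and "polyfn m f" "polyfn n g" "m + n \<le> l"
  shows "polyfn l (\<lambda>t. p (f t) (g t))"
proof -
  interpret bounded_bilinear p by fact
  obtain a b where "\<And>t. f t = (\<Sum>j\<le>m. t ^ j *\<^sub>R a j)" "\<And>t. g t = (\<Sum>j\<le>n. t ^ j *\<^sub>R b j)"
    using assms unfolding polyfn_def by blast
  then have "(\<lambda>t. p (f t) (g t)) = (\<lambda>t. \<Sum>i\<le>m. \<Sum>j\<le>n. t ^ (i + j) *\<^sub>R p (a i) (b j))"
    by (simp add: fun_eq_iff sum_left sum_right scaleR_left scaleR_right power_add scaleR_sum_right
        sum.swap[of _ "{..n}" "{..m}"] mult.commute)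
  then show ?thesis
    using assms(4) by (auto intro!: polyfn_sum polyfn_monomial)
qed

text \<open>Replacing the integral over the path of connections by a finite sum makes the smoothness of
  the transgression form immediate.\<close>

lemma polyfn_quadrature:
  obtains w :: "nat \<Rightarrow> real" where
    "\<And>(f :: real \<Rightarrow> 'a::real_normed_vector) f'. polyfn m f \<Longrightarrow> (\<And>t. (f has_vector_derivative f' t) (at t)) \<Longrightarrow>
      f 1 - f 0 = (\<Sum>j\<le>m. w j *\<^sub>R f' (real j))"
proof -
  \<comment> \<open>The moments 1 / (l + 1) are the integrals of t^l over the unit interval, so the
    weights integrate polynomials of degree at most m exactly.\<close>
  obtain w where w: "\<And>l. l \<le> m \<Longrightarrow> (\<Sum>j\<le>m. w j * real j ^ l) = 1 / real (Suc l)"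
    using vandermonde_solution[of m "\<lambda>l. 1 / real (Suc l)"] by blast
  show thesis
  proof (rule that)
    fix f f' :: "real \<Rightarrow> 'a"
    assume "polyfn m f" and f': "\<And>t. (f has_vector_derivative f' t) (at t)"
    then obtain a where a: "\<And>t. f t = (\<Sum>i\<le>m. t ^ i *\<^sub>R a i)" unfolding polyfn_def by blast
    have "((\<lambda>t. \<Sum>i\<le>m. t ^ i *\<^sub>R a i) has_vector_derivative (\<Sum>i\<le>m. (real i * t ^ (i - 1)) *\<^sub>R a i)) (at t)" for t
      by (auto intro!: derivative_eq_intros has_vector_derivative_sum)
    then have eq: "f' t = (\<Sum>i\<le>m. (real i * t ^ (i - 1)) *\<^sub>R a i)" for t
      using f'[of t] vector_derivative_unique_at a by (metis (no_types, lifting) ext)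
    have "(\<Sum>j\<le>m. w j *\<^sub>R f' (real j)) = (\<Sum>i\<le>m. (real i * (\<Sum>j\<le>m. w j * real j ^ (i - 1))) *\<^sub>R a i)"
      unfolding eq scaleR_sum_right sum_distrib_left scaleR_sum_left
      by (subst sum.swap) (simp add: mult_ac)
    \<comment> \<open>For i = 0 the factor \<open>real i\<close> vanishes, so the truncated exponent
      i - 1 does no harm.\<close>
    also have "\<dots> = (\<Sum>i\<le>m. (if i = 0 then 0 else 1) *\<^sub>R a i)"
      by (intro sum.cong refl arg_cong2[where f = scaleR]) (auto simp: w)
    also have "\<dots> = (\<Sum>i\<le>m. (1 ^ i - 0 ^ i) *\<^sub>R a i)"
      by (intro sum.cong refl) auto
    also have "\<dots> = f 1 - f 0" by (simp add: a scaleR_diff_left sum_subtractf)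
    finally show "f 1 - f 0 = (\<Sum>j\<le>m. w j *\<^sub>R f' (real j))" by simp
  qed
qed

lemma polyfn_newton:
  fixes p :: "real \<Rightarrow> nat \<Rightarrow> 'a::real_normed_algebra_1"
  assumes "\<And>i. polyfn (2 * i) (\<lambda>t. p t i)"
  shows "polyfn (2 * k) (\<lambda>t. newton (p t) k)"
proof (induction k rule: less_induct)
  case (less k)
  show ?case
  proof (cases k)
    case (Suc m)
    have "polyfn (2 * Suc m) (\<lambda>t. newton (p t) (m - i) * p t (Suc i))" if "i \<le> m" for i
      by (rule polyfn_bilinear[OF bounded_bilinear_mult less.IH assms]) (use that Suc in auto)
    then show ?thesis
      unfolding Suc newton.simps by (intro polyfn_linear[OF linear_scaleR] polyfn_sum) auto
  qed (simp add: polyfn_const)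
qed

subsection \<open>Transgression\<close>

definition conn_path :: "(real^'n \<Rightarrow> 'n \<Rightarrow> real^'b^'b) \<Rightarrow> (real^'n \<Rightarrow> 'n \<Rightarrow> real^'b^'b) \<Rightarrow> real \<Rightarrow> real^'n \<Rightarrow> 'n \<Rightarrow> real^'b^'b" where
  "conn_path \<Gamma>\<^sub>0 \<Gamma>\<^sub>1 t x i = \<Gamma>\<^sub>0 x i + t *\<^sub>R (\<Gamma>\<^sub>1 x i - \<Gamma>\<^sub>0 x i)"

definition conn_diff :: "(real^'n \<Rightarrow> 'n \<Rightarrow> real^'b^'b) \<Rightarrow> (real^'n \<Rightarrow> 'n \<Rightarrow> real^'b^'b) \<Rightarrow> real^'n \<Rightarrow> 'n \<Rightarrow> real^'b^'b" where
  "conn_diff \<Gamma>\<^sub>0 \<Gamma>\<^sub>1 x i = \<Gamma>\<^sub>1 x i - \<Gamma>\<^sub>0 x i"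

definition char_coeff :: "(real^('n::{finite,linorder}) \<Rightarrow> 'n \<Rightarrow> real^'b^'b) \<Rightarrow> nat \<Rightarrow> real^('n::{finite,linorder}) \<Rightarrow> 'n ext" where
  "char_coeff \<Gamma> k x = newton (\<lambda>i. trace (mpow (curv_form \<Gamma> x) i)) k"

text \<open>The velocities i tr (Omega^(i-1) Delta) have odd degree, and their exterior derivatives
  are the velocities of tr Omega^i when the connection moves in the direction Delta. At i = 0 the
  truncated exponent is masked by the factor i.\<close>

definition transgression_at :: "(real^('n::{finite,linorder}) \<Rightarrow> 'n \<Rightarrow> real^'b^'b) \<Rightarrow> (real^('n::{finite,linorder}) \<Rightarrow> 'n \<Rightarrow> real^'b^'b) \<Rightarrow>
    nat \<Rightarrow> real^('n::{finite,linorder}) \<Rightarrow> 'n ext" where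
  "transgression_at \<Gamma> \<Delta> k x = newton_diff (\<lambda>i. trace (mpow (curv_form \<Gamma> x) i))
     (\<lambda>i. real i *\<^sub>R trace (mpow (curv_form \<Gamma> x) (i - 1) ** conn_form \<Delta> x)) k"

lemma conn_form_path: "conn_form (conn_path \<Gamma>\<^sub>0 \<Gamma>\<^sub>1 t) x = conn_form \<Gamma>\<^sub>0 x + t *\<^sub>R conn_form (conn_diff \<Gamma>\<^sub>0 \<Gamma>\<^sub>1) x"
  by (simp add: conn_form_def conn_path_def conn_diff_def emb_simps matrix_mult_simps sum.distrib scaleR_sum_right)

lemma homog_transgression_at: "homog (2 * k + 1) (transgression_at \<Gamma> \<Delta> (Suc k) x)"
  unfolding transgression_at_def
proof (rule homog_newton_diff)
  show "homog (2 * i) (trace (mpow (curv_form \<Gamma> x) i))" for i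
    using homog_trace[OF mhomog_mpow[OF mhomog_curv_form]] by (simp add: mult.commute)
  show "homog (2 * i + 1) (real (Suc i) *\<^sub>R trace (mpow (curv_form \<Gamma> x) (Suc i - 1) ** conn_form \<Delta> x))" for i
    using homog_trace[OF mhomog_mult[OF mhomog_mpow[OF mhomog_curv_form] mhomog_conn_form], of i \<Gamma> x \<Delta> x]
    by (simp add: mult.commute)
qed

lemma trace_mpow_deriv:
  fixes C :: "real \<Rightarrow> ('n::{finite,linorder}) ext^'b^'b"
  assumes C': "(C has_vector_derivative C') (at t)" and hom: "mhomog 2 (C t)" "mhomog 2 C'"
  shows "((\<lambda>t. trace (mpow (C t) k)) has_vector_derivative real k *\<^sub>R trace (mpow (C t) (k - 1) ** C')) (at t)"
proof -
  \<comment> \<open>The derivative \<open>M\<close> of the k-th power is not k C^(k-1) C', since the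
    factors do not commute. It agrees with it only under the trace, and the induction needs this
    with an arbitrary power of \<open>C t\<close> in front. Degree 2 makes the trace cyclic without
    sign.\<close>
  have "\<exists>M. ((\<lambda>t. mpow (C t) k) has_vector_derivative M) (at t) \<and> mhomog (k * 2) M \<and>
      (\<forall>j. trace (mpow (C t) j ** M) = real k *\<^sub>R trace (mpow (C t) (j + (k - 1)) ** C'))"
  proof (induction k)
    case 0
    show ?case
      by (rule exI[of _ 0]) (simp add: mhomog_simps matrix_mult_simps trace_simps)
  next
    case (Suc k)
    then obtain M where M: "((\<lambda>t. mpow (C t) k) has_vector_derivative M) (at t)" "mhomog (k * 2) M"
      "\<And>j. trace (mpow (C t) j ** M) = real k *\<^sub>R trace (mpow (C t) (j + (k - 1)) ** C')" by blast
    have "((\<lambda>t. mpow (C t) (Suc k)) has_vector_derivative C t ** M + C' ** mpow (C t) k) (at t)"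
      using bounded_bilinear.has_vector_derivative[OF bounded_bilinear_matrix_mult C' M(1)] by simp
    moreover have "mhomog (Suc k * 2) (C t ** M + C' ** mpow (C t) k)"
      using mhomog_mult[OF hom(1) M(2)] mhomog_mult[OF hom(2) mhomog_mpow[OF hom(1)], of k]
      by (intro mhomog_simps) auto
    moreover have "trace (mpow (C t) j ** (C t ** M + C' ** mpow (C t) k))
        = real (Suc k) *\<^sub>R trace (mpow (C t) (j + k) ** C')" for j
    proof -
      have "trace (mpow (C t) j ** (C t ** M)) = trace (mpow (C t) (Suc j) ** M)"
        by (simp add: mpow_Suc_right matrix_mul_assoc del: mpow.simps)
      also have "\<dots> = real k *\<^sub>R trace (mpow (C t) (j + k) ** C')"
        unfolding M(3) by (cases k) auto
      finally have 1: "trace (mpow (C t) j ** (C t ** M)) = real k *\<^sub>R trace (mpow (C t) (j + k) ** C')" .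
      have "trace (mpow (C t) j ** (C' ** mpow (C t) k)) = trace (mpow (C t) k ** (mpow (C t) j ** C'))"
        using trace_homog_commute[OF mhomog_mult[OF mhomog_mpow[OF hom(1)] hom(2)] mhomog_mpow[OF hom(1)], of j k]
        by (simp add: matrix_mul_assoc)
      also have "\<dots> = trace (mpow (C t) (j + k) ** C')"
        by (simp add: matrix_mul_assoc mpow_add[symmetric] add.commute)
      finally show ?thesis
        using 1 by (simp add: matrix_mult_simps trace_simps scaleR_add_left)
    qed
    ultimately show ?case by auto
  qed
  then obtain M where M: "((\<lambda>t. mpow (C t) k) has_vector_derivative M) (at t)"
    "trace (mpow (C t) 0 ** M) = real k *\<^sub>R trace (mpow (C t) (0 + (k - 1)) ** C')" by blast
  then show ?thesis
    using bounded_linear.has_vector_derivative[OF bounded_linear_trace M(1)] by simp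
qed

context
  fixes S :: "(real^('n::{finite,linorder})) set" and \<Gamma>\<^sub>0 \<Gamma>\<^sub>1 :: "real^('n::{finite,linorder}) \<Rightarrow> 'n \<Rightarrow> real^'b^'b"
  assumes S: "open S" and smooth0: "\<And>i. smooth_on S (\<lambda>x. \<Gamma>\<^sub>0 x i)" and smooth1: "\<And>i. smooth_on S (\<lambda>x. \<Gamma>\<^sub>1 x i)"
begin

lemma smooth_conn_path: "smooth_on S (\<lambda>x. conn_path \<Gamma>\<^sub>0 \<Gamma>\<^sub>1 t x i)"
  unfolding conn_path_def by (intro smooth_on_add smooth_on_scaleR smooth_on_diff S smooth0 smooth1)

lemma smooth_conn_diff: "smooth_on S (\<lambda>x. (conn_diff \<Gamma>\<^sub>0 \<Gamma>\<^sub>1) x i)"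
  unfolding conn_diff_def by (intro smooth_on_diff S smooth0 smooth1)

lemma smooth_on_transgression_at: "smooth_on S (transgression_at (conn_path \<Gamma>\<^sub>0 \<Gamma>\<^sub>1 t) (conn_diff \<Gamma>\<^sub>0 \<Gamma>\<^sub>1) k)"
  unfolding transgression_at_def[abs_def]
  by (intro smooth_on_newton_diff smooth_on_scaleR smooth_on_trace smooth_on_matrix_mult smooth_on_mpow
      smooth_on_curv_form smooth_on_conn_form smooth_conn_path smooth_conn_diff S)

text \<open>The curvature is quadratic in t; this bounds the degree of the characteristic
  coefficients in t and makes a finite quadrature exact.\<close>

lemma curv_form_path:
  assumes x: "x \<in> S"
  shows "curv_form (conn_path \<Gamma>\<^sub>0 \<Gamma>\<^sub>1 t) x = curv_form \<Gamma>\<^sub>0 x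
    + t *\<^sub>R (mderiv (conn_form (conn_diff \<Gamma>\<^sub>0 \<Gamma>\<^sub>1)) x + conn_form \<Gamma>\<^sub>0 x ** conn_form (conn_diff \<Gamma>\<^sub>0 \<Gamma>\<^sub>1) x + conn_form (conn_diff \<Gamma>\<^sub>0 \<Gamma>\<^sub>1) x ** conn_form \<Gamma>\<^sub>0 x)
    + t\<^sup>2 *\<^sub>R (conn_form (conn_diff \<Gamma>\<^sub>0 \<Gamma>\<^sub>1) x ** conn_form (conn_diff \<Gamma>\<^sub>0 \<Gamma>\<^sub>1) x)"
proof -
  note diff = smooth_on_differentiable[OF _ x]
  have "mderiv (conn_form (conn_path \<Gamma>\<^sub>0 \<Gamma>\<^sub>1 t)) x = mderiv (conn_form \<Gamma>\<^sub>0) x + t *\<^sub>R mderiv (conn_form (conn_diff \<Gamma>\<^sub>0 \<Gamma>\<^sub>1)) x"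
  proof -
    have d: "conn_form \<Gamma>\<^sub>0 differentiable (at x)" "conn_form (conn_diff \<Gamma>\<^sub>0 \<Gamma>\<^sub>1) differentiable (at x)"
      "(\<lambda>x. t *\<^sub>R conn_form (conn_diff \<Gamma>\<^sub>0 \<Gamma>\<^sub>1) x) differentiable (at x)"
      by (intro diff smooth_on_scaleR smooth_on_conn_form smooth_conn_diff smooth0 S)+
    show ?thesis
      unfolding conn_form_path[abs_def] mderiv_add[OF d(1,3)] mderiv_scaleR[OF d(2)] ..
  qed
  then show ?thesis
    by (simp add: curv_form_eq diff[OF smooth_conn_path] diff[OF smooth0] conn_form_path matrix_mult_simps
        scaleR_add_right power2_eq_square)
qed

lemma curv_form_path_derivative:
  assumes x: "x \<in> S"
  shows "((\<lambda>t. curv_form (conn_path \<Gamma>\<^sub>0 \<Gamma>\<^sub>1 t) x) has_vector_derivative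
    mderiv (conn_form (conn_diff \<Gamma>\<^sub>0 \<Gamma>\<^sub>1)) x + conn_form (conn_path \<Gamma>\<^sub>0 \<Gamma>\<^sub>1 t) x ** conn_form (conn_diff \<Gamma>\<^sub>0 \<Gamma>\<^sub>1) x + conn_form (conn_diff \<Gamma>\<^sub>0 \<Gamma>\<^sub>1) x ** conn_form (conn_path \<Gamma>\<^sub>0 \<Gamma>\<^sub>1 t) x) (at t)"
proof -
  have "((\<lambda>t. a + t *\<^sub>R b + t\<^sup>2 *\<^sub>R c) has_vector_derivative b + (2 * t) *\<^sub>R c) (at t)" for a b c :: "'n ext^'b^'b"
    by (auto intro!: derivative_eq_intros)
  moreover have "mderiv (conn_form (conn_diff \<Gamma>\<^sub>0 \<Gamma>\<^sub>1)) x + conn_form (conn_path \<Gamma>\<^sub>0 \<Gamma>\<^sub>1 t) x ** conn_form (conn_diff \<Gamma>\<^sub>0 \<Gamma>\<^sub>1) x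
        + conn_form (conn_diff \<Gamma>\<^sub>0 \<Gamma>\<^sub>1) x ** conn_form (conn_path \<Gamma>\<^sub>0 \<Gamma>\<^sub>1 t) x
      = (mderiv (conn_form (conn_diff \<Gamma>\<^sub>0 \<Gamma>\<^sub>1)) x + conn_form \<Gamma>\<^sub>0 x ** conn_form (conn_diff \<Gamma>\<^sub>0 \<Gamma>\<^sub>1) x
        + conn_form (conn_diff \<Gamma>\<^sub>0 \<Gamma>\<^sub>1) x ** conn_form \<Gamma>\<^sub>0 x)
        + (2 * t) *\<^sub>R (conn_form (conn_diff \<Gamma>\<^sub>0 \<Gamma>\<^sub>1) x ** conn_form (conn_diff \<Gamma>\<^sub>0 \<Gamma>\<^sub>1) x)"
    by (simp add: conn_form_path matrix_mult_simps scaleR_2[symmetric])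
  ultimately show ?thesis
    unfolding curv_form_path[OF x] by (simp only:)
qed

text \<open>Both sides are \<open>newton_diff\<close> of the same power sums with the same
  velocities: in t by \<open>trace_mpow_deriv\<close>, in x because the power sums are closed and
  \<open>ederiv_trace_mpow_curv_form_mult\<close> differentiates the transgression
  velocities.\<close>

lemma char_coeff_path_derivative:
  assumes x: "x \<in> S"
  shows "((\<lambda>t. char_coeff (conn_path \<Gamma>\<^sub>0 \<Gamma>\<^sub>1 t) k x) has_vector_derivative
    ederiv (transgression_at (conn_path \<Gamma>\<^sub>0 \<Gamma>\<^sub>1 t) (conn_diff \<Gamma>\<^sub>0 \<Gamma>\<^sub>1) k) x) (at t)"
proof -
  let ?p = "\<lambda>t x i. trace (mpow (curv_form (conn_path \<Gamma>\<^sub>0 \<Gamma>\<^sub>1 t) x) i)"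
  let ?q = "\<lambda>t x i. real i *\<^sub>R trace (mpow (curv_form (conn_path \<Gamma>\<^sub>0 \<Gamma>\<^sub>1 t) x) (i - 1) ** conn_form (conn_diff \<Gamma>\<^sub>0 \<Gamma>\<^sub>1) x)"
  let ?C' = "mderiv (conn_form (conn_diff \<Gamma>\<^sub>0 \<Gamma>\<^sub>1)) x + conn_form (conn_path \<Gamma>\<^sub>0 \<Gamma>\<^sub>1 t) x ** conn_form (conn_diff \<Gamma>\<^sub>0 \<Gamma>\<^sub>1) x + conn_form (conn_diff \<Gamma>\<^sub>0 \<Gamma>\<^sub>1) x ** conn_form (conn_path \<Gamma>\<^sub>0 \<Gamma>\<^sub>1 t) x"
  have "mhomog 2 ?C'"
  proof (intro mhomog_simps)
    show "mhomog 2 (mderiv (conn_form (conn_diff \<Gamma>\<^sub>0 \<Gamma>\<^sub>1)) x)"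
      by (simp add: mderiv_conn_form smooth_on_differentiable[OF smooth_conn_diff x] mhomog_tens)
    show "mhomog 2 (conn_form (conn_path \<Gamma>\<^sub>0 \<Gamma>\<^sub>1 t) x ** conn_form (conn_diff \<Gamma>\<^sub>0 \<Gamma>\<^sub>1) x)" "mhomog 2 (conn_form (conn_diff \<Gamma>\<^sub>0 \<Gamma>\<^sub>1) x ** conn_form (conn_path \<Gamma>\<^sub>0 \<Gamma>\<^sub>1 t) x)"
      using mhomog_mult[OF mhomog_conn_form mhomog_conn_form] by (metis one_add_one)+
  qed
  then have p': "((\<lambda>t. ?p t x i) has_vector_derivative real i *\<^sub>R trace (mpow (curv_form (conn_path \<Gamma>\<^sub>0 \<Gamma>\<^sub>1 t) x) (i - 1) ** ?C')) (at t)" for i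
    by (intro trace_mpow_deriv curv_form_path_derivative[OF x] mhomog_curv_form)
  have q: "ederiv (\<lambda>x. ?q t x i) x = real i *\<^sub>R trace (mpow (curv_form (conn_path \<Gamma>\<^sub>0 \<Gamma>\<^sub>1 t) x) (i - 1) ** ?C')" for i
  proof -
    have "(\<lambda>x. trace (mpow (curv_form (conn_path \<Gamma>\<^sub>0 \<Gamma>\<^sub>1 t) x) (i - 1) ** conn_form (conn_diff \<Gamma>\<^sub>0 \<Gamma>\<^sub>1) x)) differentiable (at x)"
      by (intro smooth_on_differentiable[OF _ x] smooth_on_trace smooth_on_matrix_mult smooth_on_mpow
          smooth_on_curv_form smooth_on_conn_form smooth_conn_path smooth_conn_diff S)
    then show ?thesis
      using ederiv_trace_mpow_curv_form_mult[OF S smooth_conn_path x smooth_on_conn_form[OF S smooth_conn_diff] mhomog_conn_form]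
      by (simp add: ederiv_scaleR)
  qed
  have "((\<lambda>t. newton (?p t x) k) has_vector_derivative newton_diff (?p t x) (\<lambda>i. ederiv (\<lambda>x. ?q t x i) x) k) (at t)"
    unfolding q
    by (rule newton_has_vector_derivative[of "\<lambda>t. ?p t x"
          "\<lambda>_ i. real i *\<^sub>R trace (mpow (curv_form (conn_path \<Gamma>\<^sub>0 \<Gamma>\<^sub>1 t) x) (i - 1) ** ?C')"]) (rule p')
  also have "newton_diff (?p t x) (\<lambda>i. ederiv (\<lambda>x. ?q t x i) x) k = ederiv (\<lambda>x. newton_diff (?p t x) (?q t x) k) x"
  proof (rule ederiv_newton_diff[symmetric, OF S x])
    show "smooth_on S (\<lambda>x. ?p t x i)" for i
      by (intro smooth_on_trace smooth_on_mpow smooth_on_curv_form smooth_conn_path S)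
    show "homog (2 * i) (?p t x i)" for x i
      using homog_trace[OF mhomog_mpow[OF mhomog_curv_form]] by (simp add: mult.commute)
    show "ederiv (\<lambda>x. ?p t x i) x = 0" for i
      by (rule ederiv_trace_mpow_curv_form[OF S smooth_conn_path x])
    show "smooth_on S (\<lambda>x. ?q t x i)" for i
      by (intro smooth_on_scaleR smooth_on_trace smooth_on_matrix_mult smooth_on_mpow
          smooth_on_curv_form smooth_on_conn_form smooth_conn_path smooth_conn_diff S)
    show "homog (2 * i + 1) (?q t x (Suc i))" for x i
      using homog_trace[OF mhomog_mult[OF mhomog_mpow[OF mhomog_curv_form] mhomog_conn_form], of i "conn_path \<Gamma>\<^sub>0 \<Gamma>\<^sub>1 t" x "conn_diff \<Gamma>\<^sub>0 \<Gamma>\<^sub>1" x]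
      by (simp add: mult.commute)
  qed
  finally show ?thesis by (simp add: char_coeff_def transgression_at_def[abs_def])
qed

lemma polyfn_char_coeff:
  assumes x: "x \<in> S"
  shows "polyfn (2 * k) (\<lambda>t. char_coeff (conn_path \<Gamma>\<^sub>0 \<Gamma>\<^sub>1 t) k x)"
  unfolding char_coeff_def
proof (rule polyfn_newton)
  have C: "polyfn 2 (\<lambda>t. curv_form (conn_path \<Gamma>\<^sub>0 \<Gamma>\<^sub>1 t) x)"
    unfolding curv_form_path[OF x]
    using polyfn_monomial[of 1 2] polyfn_monomial[of 2 2] by (intro polyfn_add polyfn_const) auto
  have "polyfn (2 * i) (\<lambda>t. mpow (curv_form (conn_path \<Gamma>\<^sub>0 \<Gamma>\<^sub>1 t) x) i)" for i
    by (induction i) (auto intro: polyfn_const polyfn_bilinear[OF bounded_bilinear_matrix_mult C])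
  then show "polyfn (2 * i) (\<lambda>t. trace (mpow (curv_form (conn_path \<Gamma>\<^sub>0 \<Gamma>\<^sub>1 t) x) i))" for i
    by (intro polyfn_linear[OF bounded_linear.linear[OF bounded_linear_trace]])
qed

end

section \<open>Behaviour under changes of charts\<close>

definition mpull :: "real^('n::{finite,linorder})^('n::{finite,linorder}) \<Rightarrow> 'n ext^'b^'a \<Rightarrow> 'n ext^'b^'a" where
  "mpull J M = (\<chi> i j. pull_back J (M $ i $ j))"

lemma pull_back_of_real [simp]: "pull_back J (of_real r) = of_real r"
  by (simp add: of_real_def)

lemma mpull_simps:
  "mpull J (A + B) = mpull J A + mpull J B" "mpull J (r *\<^sub>R A) = r *\<^sub>R mpull J A"
  "mpull J (emb E) = emb E" "mpull J (mat a) = mat (pull_back J a)" "mpull J (C ** M) = mpull J C ** mpull J M"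
  "trace (mpull J N) = pull_back J (trace N)"
  by (simp_all add: mpull_def vec_eq_iff emb_def mat_def if_distrib matrix_matrix_mult_def trace_def pull_back_sum
      pull_back_mult cong: if_cong)

lemma mpull_sum: "mpull J (sum f S) = (\<Sum>s\<in>S. mpull J (f s))"
  by (simp add: mpull_def vec_eq_iff pull_back_sum sum_component)

lemma pull_back_newton: "pull_back J (newton p k) = newton (\<lambda>i. pull_back J (p i)) k"
proof (induction k rule: less_induct)
  case (less k)
  then show ?case by (cases k) (simp_all add: pull_back_sum pull_back_mult)
qed

lemma pull_back_newton_diff:
  "pull_back J (newton_diff p q k) = newton_diff (\<lambda>i. pull_back J (p i)) (\<lambda>i. pull_back J (q i)) k"
proof (induction k rule: less_induct)
  case (less k)
  then show ?case by (cases k) (simp_all add: pull_back_sum pull_back_mult pull_back_newton)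
qed

lemma mpull_tens:
  "mpull J (tens B) = tens (\<lambda>i j. \<Sum>k\<in>UNIV. \<Sum>l\<in>UNIV. (J $ k $ i * J $ l $ j) *\<^sub>R B k l)"
proof -
  let ?f = "\<lambda>k l i j. (J $ k $ i * J $ l $ j) *\<^sub>R (mat (dx i * dx j) ** emb (B k l))"
  have "mat (pull_back J (dx k) * pull_back J (dx l)) ** emb (B k l) = (\<Sum>i\<in>UNIV. \<Sum>j\<in>UNIV. ?f k l i j)" for k l
    by (simp add: pull_back_dx sum_distrib_left sum_distrib_right mat_sum mat_scaleR matrix_mult_simps
        scaleR_sum_right mult.commute) (rule sum.swap)
  then have "mpull J (tens B) = (\<Sum>k\<in>UNIV. \<Sum>l\<in>UNIV. \<Sum>i\<in>UNIV. \<Sum>j\<in>UNIV. ?f k l i j)"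
    by (simp add: tens_def mpull_sum mpull_simps pull_back_mult)
  also have "\<dots> = (\<Sum>k\<in>UNIV. \<Sum>i\<in>UNIV. \<Sum>l\<in>UNIV. \<Sum>j\<in>UNIV. ?f k l i j)"
    by (intro sum.cong refl sum.swap)
  also have "\<dots> = (\<Sum>i\<in>UNIV. \<Sum>k\<in>UNIV. \<Sum>l\<in>UNIV. \<Sum>j\<in>UNIV. ?f k l i j)"
    by (rule sum.swap)
  also have "\<dots> = (\<Sum>i\<in>UNIV. \<Sum>k\<in>UNIV. \<Sum>j\<in>UNIV. \<Sum>l\<in>UNIV. ?f k l i j)"
    by (intro sum.cong refl sum.swap)
  also have "\<dots> = (\<Sum>i\<in>UNIV. \<Sum>j\<in>UNIV. \<Sum>k\<in>UNIV. \<Sum>l\<in>UNIV. ?f k l i j)"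
    by (intro sum.cong refl sum.swap)
  also have "\<dots> = tens (\<lambda>i j. \<Sum>k\<in>UNIV. \<Sum>l\<in>UNIV. (J $ k $ i * J $ l $ j) *\<^sub>R B k l)"
    by (simp add: tens_def emb_sum emb_simps matrix_mult_simps)
  finally show ?thesis .
qed

lemma mpull_one: "mpull J (mat 1) = mat 1"
  by (simp add: mpull_simps)

lemma emb_mult_mat_emb: "emb J ** (mat a ** emb B) = mat a ** emb (J ** B)"
  by (simp only: matrix_mul_assoc mat_mult_emb[symmetric] emb_simps)

text \<open>Covariance under a Jacobian is written as an intertwining relation rather than as
  conjugation: it needs no inverse and is stable under products. The inverse enters only when a
  trace is taken.\<close>

lemma tens_intertwine:
  assumes "\<And>i j. J ** B i j = (\<Sum>k\<in>UNIV. \<Sum>l\<in>UNIV. (J $ k $ i * J $ l $ j) *\<^sub>R B' k l) ** J"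
  shows "emb J ** tens B = mpull J (tens B') ** emb J"
proof -
  have "emb J ** tens B = (\<Sum>i\<in>UNIV. \<Sum>j\<in>UNIV. mat (dx i * dx j) ** emb (J ** B i j))"
    by (simp add: tens_def matrix_mult_simps emb_mult_mat_emb)
  also have "\<dots> = tens (\<lambda>i j. \<Sum>k\<in>UNIV. \<Sum>l\<in>UNIV. (J $ k $ i * J $ l $ j) *\<^sub>R B' k l) ** emb J"
    unfolding assms emb_simps(6) by (simp add: tens_def matrix_mult_sum_left matrix_mul_assoc)
  finally show ?thesis by (simp add: mpull_tens)
qed

lemma conn_form_intertwine:
  assumes "\<And>i. J ** \<Delta> x i = (\<Sum>l\<in>UNIV. J $ l $ i *\<^sub>R \<Delta>' y l) ** J"
  shows "emb J ** conn_form \<Delta> x = mpull J (conn_form \<Delta>' y) ** emb J"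
proof -
  have "emb J ** conn_form \<Delta> x = (\<Sum>i\<in>UNIV. mat (dx i) ** emb (J ** \<Delta> x i))"
    by (simp add: conn_form_def matrix_mult_simps emb_mult_mat_emb)
  also have "\<dots> = (\<Sum>i\<in>UNIV. \<Sum>l\<in>UNIV. J $ l $ i *\<^sub>R (mat (dx i) ** emb (\<Delta>' y l) ** emb J))"
    by (simp add: assms emb_simps emb_sum matrix_mult_simps matrix_mul_assoc)
  also have "\<dots> = mpull J (conn_form \<Delta>' y) ** emb J"
    by (subst sum.swap)
       (simp add: conn_form_def mpull_sum mpull_simps pull_back_dx mat_sum mat_scaleR matrix_mult_simps)
  finally show ?thesis .
qed

text \<open>\<open>J\<close> and its inverse have real entries, so the trace is cyclic for them and
  the conjugation drops out.\<close>

lemma trace_intertwine: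
  fixes J K :: "((real, 'n::{finite,linorder}) vec, 'n) vec"
  assumes J: "K ** J = mat 1" and X: "emb J ** X = mpull J Y ** emb J"
  shows "trace X = pull_back J (trace Y)"
proof -
  have "J ** K = mat 1" using J by (simp add: matrix_left_right_inverse)
  then have JK: "emb J ** emb K = (mat 1 :: (('n ext, 'n) vec, 'n) vec)"
    by (simp add: emb_simps(6)[symmetric] emb_simps(7))
  have "emb K ** emb J = (mat 1 :: (('n ext, 'n) vec, 'n) vec)"
    using J by (simp add: emb_simps(6)[symmetric] emb_simps(7))
  then have "X = emb K ** (emb J ** X)" by (simp add: matrix_mul_assoc)
  then have "trace X = trace (emb K ** (mpull J Y ** emb J))" by (simp add: X)
  also have "\<dots> = trace ((mpull J Y ** emb J) ** emb K)"
    by (rule trace_emb_commute)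
  also have "\<dots> = trace (mpull J Y ** (emb J ** emb K))"
    by (simp only: matrix_mul_assoc)
  finally show ?thesis by (simp add: JK mpull_simps)
qed

lemma intertwine_mult:
  assumes "emb J ** X = mpull J Y ** emb J" "emb J ** X' = mpull J Y' ** emb J"
  shows "emb J ** (X ** X') = mpull J (Y ** Y') ** emb J"
  by (simp add: mpull_simps matrix_mul_assoc assms(1)) (simp add: matrix_mul_assoc[symmetric] assms(2))

lemma intertwine_mpow:
  assumes "emb J ** X = mpull J Y ** emb J"
  shows "emb J ** mpow X k = mpull J (mpow Y k) ** emb J"
proof (induction k)
  case 0
  show ?case by (simp add: mpull_one)
next
  case (Suc k)
  then show ?case using intertwine_mult[OF assms] by simp
qed

lemma transgression_at_intertwine:
  assumes J: "K ** J = mat 1" and C: "emb J ** curv_form \<Gamma> x = mpull J (curv_form \<Gamma>' y) ** emb J"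
    and \<Delta>: "emb J ** conn_form \<Delta> x = mpull J (conn_form \<Delta>' y) ** emb J"
  shows "transgression_at \<Gamma> \<Delta> k x = pull_back J (transgression_at \<Gamma>' \<Delta>' k y)"
  by (simp add: transgression_at_def pull_back_newton_diff trace_intertwine[OF J intertwine_mpow[OF C]]
      trace_intertwine[OF J intertwine_mult[OF intertwine_mpow[OF C] \<Delta>]])

lemma pd_chain:
  assumes "\<tau> differentiable (at x)" "f differentiable (at (\<tau> x))"
  shows "pd j (\<lambda>y. f (\<tau> y)) x = (\<Sum>k\<in>UNIV. (pd j \<tau> x $ k) *\<^sub>R pd k f (\<tau> x))"
proof -
  let ?D = "frechet_derivative f (at (\<tau> x))"
  have lin: "linear ?D" by (rule linear_frechet_derivative[OF assms(2)])
  have "((\<lambda>y. f (\<tau> y)) has_derivative (\<lambda>h. ?D (frechet_derivative \<tau> (at x) h))) (at x)"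
    using diff_chain_at[OF has_derivative_frechet[OF assms(1)] has_derivative_frechet[OF assms(2)]]
    by (simp add: o_def)
  then have "pd j (\<lambda>y. f (\<tau> y)) x = ?D (pd j \<tau> x)"
    using pd_eqI by (fastforce simp: pd_def)
  also have "pd j \<tau> x = (\<Sum>k\<in>UNIV. (pd j \<tau> x $ k) *\<^sub>R axis k 1)"
    by (simp add: vec_eq_iff axis_def if_distrib cong: if_cong)
  also have "?D \<dots> = (\<Sum>k\<in>UNIV. (pd j \<tau> x $ k) *\<^sub>R pd k f (\<tau> x))"
    by (simp add: linear_sum[OF lin] linear_cmul[OF lin] pd_def)
  finally show ?thesis .
qed

section \<open>Charts, transition maps and the tensoriality of the curvature\<close>

lemma jac_nth: "jac c d x $ k $ i = pd i (transition c d) x $ k"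
  by (simp add: jac_def jacobian_def matrix_def pd_def)

context
  fixes A :: "('a::t2_space, 'n::{finite,linorder}) chart set"
  assumes atlas: "smooth_atlas A"
begin

lemma chart_inverse: "c \<in> A \<Longrightarrow> p \<in> fst c \<Longrightarrow> inv_into (fst c) (snd c) (snd c p) = p"
  using atlas by (auto simp: smooth_atlas_def is_chart_def homeomorphism_def)

lemma open_chart_image: "c \<in> A \<Longrightarrow> open (snd c ` fst c)"
  using atlas by (auto simp: smooth_atlas_def is_chart_def)

lemma open_overlap:
  assumes "c \<in> A" "d \<in> A"
  shows "open (snd c ` (fst c \<inter> fst d))"
proof -
  have "homeomorphism (fst c) (snd c ` fst c) (snd c) (inv_into (fst c) (snd c))" "open (fst d)"
    using atlas assms by (auto simp: smooth_atlas_def is_chart_def)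
  then have "openin (top_of_set (snd c ` fst c)) (snd c ` (fst c \<inter> fst d))"
    by (intro homeomorphism_imp_open_map[of "fst c"]) auto
  then show ?thesis
    using open_chart_image[OF assms(1)] by (meson openin_open_eq)
qed

lemma transition_chart: "c \<in> A \<Longrightarrow> p \<in> fst c \<Longrightarrow> transition c d (snd c p) = snd d p"
  by (simp add: transition_def chart_inverse)

lemma smooth_transition: "c \<in> A \<Longrightarrow> d \<in> A \<Longrightarrow> smooth_on (snd c ` (fst c \<inter> fst d)) (transition c d)"
  using atlas by (auto simp: smooth_atlas_def)

lemma smooth_jac:
  assumes "c \<in> A" "d \<in> A"
  shows "smooth_on (snd c ` (fst c \<inter> fst d)) (jac c d)"
proof -
  let ?L = "\<lambda>i v. (\<chi> a b. if b = i then v $ a else 0) :: ((real, 'n) vec, 'n) vec"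
  have "linear (?L i)" for i by (intro linearI) (auto simp: vec_eq_iff)
  then have L: "bounded_linear (?L i)" for i by (simp add: linear_conv_bounded_linear)
  have "jac c d = (\<lambda>x. \<Sum>i\<in>UNIV. ?L i (pd i (transition c d) x))"
    by (simp add: fun_eq_iff vec_eq_iff jac_nth sum_component)
  then show ?thesis
    using assms by (auto intro!: smooth_on_sum smooth_on_bounded_linear[OF L] smooth_on_pd smooth_transition open_overlap)
qed

lemma pd_jac_nth:
  assumes "c \<in> A" "d \<in> A" "x \<in> snd c ` (fst c \<inter> fst d)"
  shows "pd j (jac c d) x $ k $ i = pd j (pd i (transition c d)) x $ k"
proof -
  have "bounded_linear (\<lambda>M :: ((real, 'n) vec, 'n) vec. M $ k $ i)"
    by (auto simp: linear_conv_bounded_linear[symmetric] intro!: linearI)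
  then have 1: "pd j (\<lambda>y. jac c d y $ k $ i) x = pd j (jac c d) x $ k $ i"
    by (rule pd_bounded_linear[OF _ smooth_on_differentiable[OF smooth_jac[OF assms(1,2)] assms(3)]])
  have "bounded_linear (\<lambda>v :: (real, 'n) vec. v $ k)"
    by (auto simp: linear_conv_bounded_linear[symmetric] intro!: linearI)
  then have 2: "pd j (\<lambda>y. pd i (transition c d) y $ k) x = pd j (pd i (transition c d)) x $ k"
    by (rule pd_bounded_linear[OF _ smooth_on_differentiable[OF smooth_on_pd[OF smooth_transition[OF assms(1,2)]] assms(3)]])
  show ?thesis using 1 2 by (simp add: jac_nth)
qed

lemma pd_jac_commute:
  assumes "c \<in> A" "d \<in> A" "x \<in> snd c ` (fst c \<inter> fst d)"
  shows "pd j (jac c d) x $ k $ i = pd i (jac c d) x $ k $ j"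
  using pd_commute[OF smooth_transition open_overlap assms(3), of j i] assms by (simp add: pd_jac_nth)

lemma jac_inverse:
  assumes "c \<in> A" "d \<in> A" "x \<in> snd c ` (fst c \<inter> fst d)"
  shows "jac d c (transition c d x) ** jac c d x = mat 1"
proof -
  let ?\<tau> = "transition c d" and ?S = "snd c ` (fst c \<inter> fst d)"
  obtain p where p: "p \<in> fst c \<inter> fst d" "x = snd c p" using assms(3) by auto
  have \<tau>x: "?\<tau> x \<in> snd d ` (fst d \<inter> fst c)" using p assms by (simp add: transition_chart)
  have "transition d c (?\<tau> y) = y" if "y \<in> ?S" for y
    using that assms by (auto simp: transition_chart)
  then have 1: "pd j (\<lambda>y. transition d c (?\<tau> y)) x = pd j (\<lambda>y. y) x" for j
    by (rule pd_cong_open[OF open_overlap[OF assms(1,2)] assms(3)])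
  have 2: "pd j (\<lambda>y. y) x = axis j 1" for j
    by (rule pd_eqI[OF has_derivative_ident])
  have "pd j (\<lambda>y. transition d c (?\<tau> y)) x
      = (\<Sum>k\<in>UNIV. (pd j ?\<tau> x $ k) *\<^sub>R pd k (transition d c) (?\<tau> x))" for j
    by (intro pd_chain smooth_on_differentiable[OF smooth_transition] assms \<tau>x)
  then have "(\<Sum>k\<in>UNIV. (pd j ?\<tau> x $ k) *\<^sub>R pd k (transition d c) (?\<tau> x)) = axis j 1" for j
    using 1 2 by simp
  from this[THEN arg_cong[where f = "\<lambda>v. v $ i" for i]]
  show ?thesis
    by (auto simp: vec_eq_iff matrix_matrix_mult_def jac_nth mat_def axis_def sum_component mult.commute)
qed

text \<open>The transformation law of the connection is differentiated in direction i and
  antisymmetrised in i and j. Second derivatives of the Jacobian commute, and the first derivatives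
  contribute a symmetric term because the Jacobian is itself a derivative; both cancel.\<close>

lemma curv_transform:
  assumes D: "is_connection A D" and cd: "c \<in> A" "d \<in> A" and x: "x \<in> snd c ` (fst c \<inter> fst d)"
  defines "J \<equiv> jac c d x" and "y \<equiv> transition c d x"
  shows "J ** curv (D c) x i j = (\<Sum>k\<in>UNIV. \<Sum>l\<in>UNIV. (J $ k $ i * J $ l $ j) *\<^sub>R curv (D d) y k l) ** J"
proof -
  let ?S = "snd c ` (fst c \<inter> fst d)" and ?\<tau> = "transition c d"
  \<comment> \<open>\<open>Q i\<close> is the i-th component of the connection pulled back from the
    chart d. Its derivative splits into \<open>H\<close>, where the Jacobian is differentiated, and
    \<open>K\<close>, where the connection is.\<close>
  define Q where "Q i z = (\<Sum>l\<in>UNIV. jac c d z $ l $ i *\<^sub>R D d (?\<tau> z) l)" for i z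
  define dJ where "dJ i = pd i (jac c d) x" for i
  define dD where "dD i j = pd i (\<lambda>z. D c z j) x" for i j
  define K where "K i j = (\<Sum>l\<in>UNIV. J $ l $ j *\<^sub>R (\<Sum>k\<in>UNIV. J $ k $ i *\<^sub>R pd k (\<lambda>z. D d z l) y))" for i j
  define H where "H i j = (\<Sum>l\<in>UNIV. dJ i $ l $ j *\<^sub>R D d y l)" for i j
  have law: "jac c d z ** D c z i = pd i (jac c d) z + Q i z ** jac c d z" if "z \<in> ?S" for z i
    using D cd that unfolding is_connection_def Q_def by blast
  have yd: "y \<in> snd d ` fst d"
    using x cd by (auto simp: y_def transition_chart)
  have diffJ: "jac c d differentiable (at x)" and diffdJ: "pd i (jac c d) differentiable (at x)" for i
    using smooth_jac[OF cd] smooth_on_pd smooth_on_differentiable[OF _ x] by blast+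
  have diffD: "(\<lambda>z. D c z i) differentiable (at x)" for i
    using D cd x by (intro smooth_on_differentiable[of "snd c ` fst c"]) (auto simp: is_connection_def)
  have diffD': "(\<lambda>z. D d z l) differentiable (at y)" for l
    using D cd yd by (intro smooth_on_differentiable[of "snd d ` fst d"]) (auto simp: is_connection_def)
  have diff\<tau>: "?\<tau> differentiable (at x)" using smooth_on_differentiable[OF smooth_transition[OF cd] x] .
  have diffD\<tau>: "(\<lambda>z. D d (?\<tau> z) l) differentiable (at x)" for l
    using differentiable_chain_at[OF diff\<tau>] diffD'[of l] by (simp add: y_def o_def)
  have bl: "bounded_linear (\<lambda>M :: ((real, 'n) vec, 'n) vec. M $ k $ i)" for k i
    by (auto simp: linear_conv_bounded_linear[symmetric] intro!: linearI)
  have diffJn: "(\<lambda>z. jac c d z $ k $ i) differentiable (at x)" for k i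
    by (rule differentiable_bounded_linear[OF bl diffJ])
  have diffQ: "Q i differentiable (at x)" for i
    unfolding Q_def by (intro differentiable_sum ballI differentiable_scaleR diffJn diffD\<tau>) simp
  have dQ: "pd i (Q j) x = H i j + K i j" for i j
  proof -
    have "pd i (\<lambda>z. D d (?\<tau> z) l) x = (\<Sum>k\<in>UNIV. J $ k $ i *\<^sub>R pd k (\<lambda>z. D d z l) y)" for l
      using pd_chain[OF diff\<tau>, of "\<lambda>z. D d z l"] diffD' by (simp add: y_def J_def jac_nth)
    moreover have "pd i (\<lambda>z. jac c d z $ l $ j) x = dJ i $ l $ j" for l
      by (simp add: dJ_def pd_bounded_linear[OF bl diffJ])
    ultimately show ?thesis
      unfolding Q_def[abs_def]
      by (simp add: pd_sum differentiable_scaleR diffJn diffD\<tau> pd_bilinear[OF bounded_bilinear_scaleR]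
          H_def K_def sum.distrib add.commute flip: y_def J_def)
  qed
  have d2: "dJ i ** D c x j + J ** dD i j = pd i (pd j (jac c d)) x + ((H i j + K i j) ** J + Q j x ** dJ i)" for i j
  proof -
    have "pd i (\<lambda>z. jac c d z ** D c z j) x = pd i (\<lambda>z. pd j (jac c d) z + Q j z ** jac c d z) x"
      by (rule pd_cong_open[OF open_overlap[OF cd] x]) (rule law)
    then show ?thesis
      by (simp add: pd_add pd_bilinear[OF bounded_bilinear_matrix_mult] differentiable_bilinear[OF bounded_bilinear_matrix_mult]
          diffJ diffD diffdJ diffQ dQ dJ_def dD_def flip: J_def)
  qed
  have sym: "pd i (pd j (jac c d)) x = pd j (pd i (jac c d)) x"
    by (rule pd_commute[OF smooth_jac open_overlap x]) (rule cd)+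
  have Hsym: "H i j = H j i"
    by (simp add: H_def dJ_def pd_jac_commute[OF cd x, of i _ j])
  have dJ: "dJ i = J ** D c x i - Q i x ** J" for i
    using law[OF x, of i] by (simp add: dJ_def J_def)
  have "J ** dD i j - J ** dD j i = (K i j - K j i) ** J + Q j x ** dJ i - Q i x ** dJ j - dJ i ** D c x j + dJ j ** D c x i"
    using d2[of i j] d2[of j i] sym Hsym by (simp add: matrix_mult_simps algebra_simps)
  then have "J ** (dD i j - dD j i + D c x i ** D c x j - D c x j ** D c x i)
      = (K i j - K j i + Q i x ** Q j x - Q j x ** Q i x) ** J"
    unfolding dJ by (simp add: matrix_mult_simps matrix_mul_assoc algebra_simps)
  moreover have "K i j - K j i + Q i x ** Q j x - Q j x ** Q i x
      = (\<Sum>k\<in>UNIV. \<Sum>l\<in>UNIV. (J $ k $ i * J $ l $ j) *\<^sub>R curv (D d) y k l)"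
  proof -
    have 1: "K i j = (\<Sum>k\<in>UNIV. \<Sum>l\<in>UNIV. (J $ k $ i * J $ l $ j) *\<^sub>R pd k (\<lambda>z. D d z l) y)"
      unfolding K_def scaleR_sum_right by (subst sum.swap) (simp add: mult.commute)
    have 2: "K j i = (\<Sum>k\<in>UNIV. \<Sum>l\<in>UNIV. (J $ k $ i * J $ l $ j) *\<^sub>R pd l (\<lambda>z. D d z k) y)"
      unfolding K_def scaleR_sum_right by simp
    have 3: "Q i x ** Q j x = (\<Sum>k\<in>UNIV. \<Sum>l\<in>UNIV. (J $ k $ i * J $ l $ j) *\<^sub>R (D d y k ** D d y l))"
      by (simp add: Q_def matrix_mult_simps scaleR_sum_right flip: J_def y_def) (subst sum.swap, simp add: mult.commute)
    have 4: "Q j x ** Q i x = (\<Sum>k\<in>UNIV. \<Sum>l\<in>UNIV. (J $ k $ i * J $ l $ j) *\<^sub>R (D d y l ** D d y k))"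
      by (simp add: Q_def matrix_mult_simps scaleR_sum_right flip: J_def y_def) 
    show ?thesis
      unfolding 1 2 3 4 curv_def
      by (simp add: scaleR_add_right scaleR_diff_right sum.distrib sum_subtractf)
  qed
  ultimately show ?thesis by (simp add: curv_def dD_def)
qed

lemma curv_form_transform:
  assumes D: "is_connection A D" and cd: "c \<in> A" "d \<in> A" and x: "x \<in> snd c ` (fst c \<inter> fst d)"
  shows "emb (jac c d x) ** curv_form (D c) x = mpull (jac c d x) (curv_form (D d) (transition c d x)) ** emb (jac c d x)"
  using tens_intertwine[OF curv_transform[OF D cd x]]
  by (simp add: curv_form_def matrix_mult_simps mpull_simps)

lemma is_connection_path:
  assumes D0: "is_connection A D\<^sub>0" and D1: "is_connection A D\<^sub>1"
  shows "is_connection A (\<lambda>c. conn_path (D\<^sub>0 c) (D\<^sub>1 c) t)"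
  unfolding is_connection_def
proof (intro conjI ballI allI)
  fix c i assume "c \<in> A"
  then show "smooth_on (snd c ` fst c) (\<lambda>x. conn_path (D\<^sub>0 c) (D\<^sub>1 c) t x i)"
    unfolding conn_path_def using assms open_chart_image
    by (intro smooth_on_add smooth_on_scaleR smooth_on_diff) (auto simp: is_connection_def)
next
  fix c d x i assume cd: "c \<in> A" "d \<in> A" and x: "x \<in> snd c ` (fst c \<inter> fst d)"
  have law: "jac c d x ** D c x i = pd i (jac c d) x + (\<Sum>l\<in>UNIV. jac c d x $ l $ i *\<^sub>R D d (transition c d x) l) ** jac c d x"
    if "D = D\<^sub>0 \<or> D = D\<^sub>1" for D
    using that cd x assms unfolding is_connection_def by blast
  have "jac c d x ** conn_path (D\<^sub>0 c) (D\<^sub>1 c) t x i = jac c d x ** D\<^sub>0 c x i + t *\<^sub>R (jac c d x ** D\<^sub>1 c x i - jac c d x ** D\<^sub>0 c x i)"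
    by (simp add: conn_path_def matrix_mult_simps)
  also have "\<dots> = pd i (jac c d) x + (\<Sum>l\<in>UNIV. jac c d x $ l $ i *\<^sub>R conn_path (D\<^sub>0 d) (D\<^sub>1 d) t (transition c d x) l) ** jac c d x"
    by (simp add: law conn_path_def matrix_mult_simps scaleR_add_right scaleR_diff_right sum.distrib sum_subtractf
        scaleR_sum_right mult.commute)
  finally show "jac c d x ** conn_path (D\<^sub>0 c) (D\<^sub>1 c) t x i = \<dots>" .
qed

text \<open>Both connections have the same inhomogeneous term, so their difference is
  tensorial.\<close>

lemma conn_diff_transform:
  assumes D0: "is_connection A D\<^sub>0" and D1: "is_connection A D\<^sub>1"
    and cd: "c \<in> A" "d \<in> A" and x: "x \<in> snd c ` (fst c \<inter> fst d)"
  shows "emb (jac c d x) ** conn_form (conn_diff (D\<^sub>0 c) (D\<^sub>1 c)) x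
    = mpull (jac c d x) (conn_form (conn_diff (D\<^sub>0 d) (D\<^sub>1 d)) (transition c d x)) ** emb (jac c d x)"
proof (rule conn_form_intertwine)
  fix i
  have law: "jac c d x ** D c x i = pd i (jac c d) x + (\<Sum>l\<in>UNIV. jac c d x $ l $ i *\<^sub>R D d (transition c d x) l) ** jac c d x"
    if "D = D\<^sub>0 \<or> D = D\<^sub>1" for D
    using that cd x assms unfolding is_connection_def by blast
  show "jac c d x ** conn_diff (D\<^sub>0 c) (D\<^sub>1 c) x i
      = (\<Sum>l\<in>UNIV. jac c d x $ l $ i *\<^sub>R conn_diff (D\<^sub>0 d) (D\<^sub>1 d) (transition c d x) l) ** jac c d x"
    by (simp add: conn_diff_def law matrix_mult_simps scaleR_diff_right sum_subtractf)
qed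

end

section \<open>Pontrjagin classes are independent of the connection\<close>

lemma ext_deriv_eq_ederiv:
  assumes "\<omega> c differentiable (at x)"
  shows "ext_deriv \<omega> c x = ederiv (\<omega> c) x"
proof -
  have "Ext (\<lambda>I. pd i (\<lambda>y. ecoeff (\<omega> c y) I) x) = pd i (\<omega> c) x" for i
    by (simp add: pd_bounded_linear[OF bounded_linear_ecoeff assms] ecoeff_inverse)
  then show ?thesis by (simp add: ext_deriv_def ederiv_def)
qed

lemma ext_deriv_linear:
  assumes \<eta>: "is_form A k \<eta>" and \<theta>: "is_form A k \<theta>" and "c \<in> A" "x \<in> snd c ` fst c"
  shows "ext_deriv (\<lambda>c x. \<eta> c x + r *\<^sub>R \<theta> c x) c x = ext_deriv \<eta> c x + r *\<^sub>R ext_deriv \<theta> c x"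
proof -
  have diff: "(\<lambda>x. ecoeff (\<omega> c x) I) differentiable (at x)" if "is_form A k \<omega>" for \<omega> I
    using that assms(3,4) smooth_on_differentiable unfolding is_form_def by blast
  have "pd i (\<lambda>x. ecoeff (\<eta> c x) I + r * ecoeff (\<theta> c x) I) x
      = pd i (\<lambda>x. ecoeff (\<eta> c x) I) x + r * pd i (\<lambda>x. ecoeff (\<theta> c x) I) x" for i I
    using pd_add[OF diff[OF \<eta>] differentiable_bounded_linear[OF bounded_linear_mult_right diff[OF \<theta>]]]
      pd_bounded_linear[OF bounded_linear_mult_right diff[OF \<theta>]] by simp
  then have "Ext (\<lambda>I. pd i (\<lambda>x. ecoeff (\<eta> c x + r *\<^sub>R \<theta> c x) I) x)
      = Ext (\<lambda>I. pd i (\<lambda>x. ecoeff (\<eta> c x) I) x) + r *\<^sub>R Ext (\<lambda>I. pd i (\<lambda>x. ecoeff (\<theta> c x) I) x)" for i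
    by (auto intro!: ext_eqI simp: Ext_inverse)
  then show ?thesis
    by (simp add: ext_deriv_def distrib_left sum.distrib scaleR_sum_right)
qed

text \<open>The exact difference is absorbed into the primitive of each member of the class. The
  scalar \<open>r\<close> serves twice: the opposite inclusion is the case - r, and the
  normalisation by powers of 2 pi can be carried along.\<close>

lemma de_rham_class_subset:
  fixes A :: "('a::t2_space, 'n::{finite,linorder}) chart set"
  assumes A: "smooth_atlas A" and \<theta>: "is_form A (k - 1) \<theta>"
    and eq: "\<And>c x. c \<in> A \<Longrightarrow> x \<in> snd c ` fst c \<Longrightarrow> \<omega> c x = \<omega>' c x + r *\<^sub>R ext_deriv \<theta> c x"
  shows "de_rham_class A k \<omega> \<subseteq> de_rham_class A k \<omega>'"
proof
  fix \<eta> assume "\<eta> \<in> de_rham_class A k \<omega>"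
  then obtain \<theta>' where \<theta>': "is_form A (k - 1) \<theta>'" "closed_form A k \<eta>"
    "\<And>c x. c \<in> A \<Longrightarrow> x \<in> snd c ` fst c \<Longrightarrow> \<eta> c x = \<omega> c x + ext_deriv \<theta>' c x"
    unfolding de_rham_class_def by blast
  have "is_form A (k - 1) (\<lambda>c x. \<theta>' c x + r *\<^sub>R \<theta> c x)"
    unfolding is_form_def
  proof (intro conjI ballI allI impI)
    fix c I assume c: "c \<in> A"
    have "smooth_on (snd c ` fst c) (\<lambda>x. ecoeff (\<omega> c x) I)" if "is_form A (k - 1) \<omega>" for \<omega>
      using that c unfolding is_form_def by blast
    note s = this[OF \<theta>] this[OF \<theta>'(1)]
    show "smooth_on (snd c ` fst c) (\<lambda>x. ecoeff (\<theta>' c x + r *\<^sub>R \<theta> c x) I)"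
      unfolding ecoeff_simps
      by (intro smooth_on_add smooth_on_bounded_linear[OF bounded_linear_mult_right] open_chart_image[OF A c] s)
  next
    fix c x I assume "c \<in> A" "x \<in> snd c ` fst c" "card (I :: 'n set) \<noteq> k - 1"
    then have "ecoeff (\<theta> c x) I = 0" "ecoeff (\<theta>' c x) I = 0"
      using \<theta> \<theta>'(1) unfolding is_form_def by blast+
    then show "ecoeff (\<theta>' c x + r *\<^sub>R \<theta> c x) I = 0" by simp
  next
    fix c d x assume "c \<in> A" "d \<in> A" "x \<in> snd c ` (fst c \<inter> fst d)"
    then have "\<theta> c x = pull_back (jac c d x) (\<theta> d (transition c d x))"
      "\<theta>' c x = pull_back (jac c d x) (\<theta>' d (transition c d x))"
      using \<theta> \<theta>'(1) unfolding is_form_def by blast+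
    then show "\<theta>' c x + r *\<^sub>R \<theta> c x
        = pull_back (jac c d x) (\<theta>' d (transition c d x) + r *\<^sub>R \<theta> d (transition c d x))"
      by simp
  qed
  moreover have "\<eta> c x = \<omega>' c x + ext_deriv (\<lambda>c x. \<theta>' c x + r *\<^sub>R \<theta> c x) c x"
    if "c \<in> A" "x \<in> snd c ` fst c" for c x
    using that by (simp add: \<theta>'(3) eq ext_deriv_linear[OF \<theta>'(1) \<theta>])
  ultimately show "\<eta> \<in> de_rham_class A k \<omega>'"
    using \<theta>'(2) unfolding de_rham_class_def by blast
qed

lemma de_rham_class_eqI:
  fixes A :: "('a::t2_space, 'n::{finite,linorder}) chart set"
  assumes A: "smooth_atlas A" and \<theta>: "is_form A (k - 1) \<theta>"
    and eq: "\<And>c x. c \<in> A \<Longrightarrow> x \<in> snd c ` fst c \<Longrightarrow> \<omega> c x = \<omega>' c x + r *\<^sub>R ext_deriv \<theta> c x"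
  shows "de_rham_class A k \<omega> = de_rham_class A k \<omega>'"
proof
  show "de_rham_class A k \<omega> \<subseteq> de_rham_class A k \<omega>'"
    by (rule de_rham_class_subset[OF A \<theta> eq])
  show "de_rham_class A k \<omega>' \<subseteq> de_rham_class A k \<omega>"
    by (rule de_rham_class_subset[OF A \<theta>, of _ _ "- r"]) (simp add: eq)
qed

lemma de_rham_class_cong:
  assumes "\<And>c x. c \<in> A \<Longrightarrow> x \<in> snd c ` fst c \<Longrightarrow> \<omega> c x = \<omega>' c x"
  shows "de_rham_class A k \<omega> = de_rham_class A k \<omega>'"
  using assms unfolding de_rham_class_def by auto

text \<open>Affine combinations of two connections are connections for every real t, so the integer
  nodes of the quadrature give global transgression forms even outside the unit interval; the
  weighted sum of these forms is the primitive.\<close>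

theorem chern_weil:
  fixes A :: "('a::t2_space, 'n::{finite,linorder}) chart set"
  assumes A: "smooth_atlas A" and D0: "is_connection A D\<^sub>0" and D1: "is_connection A D\<^sub>1"
  obtains \<theta> where "is_form A (2 * Suc k - 1) \<theta>"
    "\<And>c x. c \<in> A \<Longrightarrow> x \<in> snd c ` fst c \<Longrightarrow>
      char_coeff (D\<^sub>1 c) (Suc k) x = char_coeff (D\<^sub>0 c) (Suc k) x + ext_deriv \<theta> c x"
proof -
  define m where "m = 2 * Suc k"
  let ?T = "\<lambda>t c. transgression_at (conn_path (D\<^sub>0 c) (D\<^sub>1 c) t) (conn_diff (D\<^sub>0 c) (D\<^sub>1 c)) (Suc k)"
  obtain w where w: "\<And>(f :: real \<Rightarrow> 'n ext) f'. polyfn m f \<Longrightarrow> (\<And>t. (f has_vector_derivative f' t) (at t)) \<Longrightarrow>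
      f 1 - f 0 = (\<Sum>j\<le>m. w j *\<^sub>R f' (real j))"
    using polyfn_quadrature by blast
  define \<theta> where "\<theta> c x = (\<Sum>j\<le>m. w j *\<^sub>R ?T (real j) c x)" for c x
  have smooth0: "smooth_on (snd c ` fst c) (\<lambda>x. D\<^sub>0 c x i)"
    and smooth1: "smooth_on (snd c ` fst c) (\<lambda>x. D\<^sub>1 c x i)" if "c \<in> A" for c i
    using that D0 D1 by (auto simp: is_connection_def)
  have op: "open (snd c ` fst c)" if "c \<in> A" for c by (rule open_chart_image[OF A that])
  have smooth_T: "smooth_on (snd c ` fst c) (?T t c)" if "c \<in> A" for c t
    by (intro smooth_on_transgression_at op smooth0 smooth1 that)
  have smooth_\<theta>: "smooth_on (snd c ` fst c) (\<theta> c)" if "c \<in> A" for c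
    unfolding \<theta>_def[abs_def] by (intro smooth_on_sum smooth_on_scaleR op smooth_T that)
  show thesis
  proof (rule that)
    show "is_form A (2 * Suc k - 1) \<theta>"
      unfolding is_form_def
    proof (intro conjI ballI allI impI)
      fix c I assume "c \<in> A"
      then show "smooth_on (snd c ` fst c) (\<lambda>x. ecoeff (\<theta> c x) I)"
        by (intro smooth_on_bounded_linear[OF bounded_linear_ecoeff] op smooth_\<theta>)
    next
      fix c x I assume "card (I :: 'n set) \<noteq> 2 * Suc k - 1"
      moreover have "homog (2 * k + 1) (\<theta> c x)"
        unfolding \<theta>_def by (intro homog_sum homog_simps homog_transgression_at)
      ultimately show "ecoeff (\<theta> c x) I = 0" by (simp add: homog_def)
    next
      fix c d x assume cd: "c \<in> A" "d \<in> A" and x: "x \<in> snd c ` (fst c \<inter> fst d)"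
      have "?T t c x = pull_back (jac c d x) (?T t d (transition c d x))" for t
        by (rule transgression_at_intertwine[OF jac_inverse[OF A cd x]
              curv_form_transform[OF A is_connection_path[OF A D0 D1] cd x] conn_diff_transform[OF A D0 D1 cd x]])
      then show "\<theta> c x = pull_back (jac c d x) (\<theta> d (transition c d x))"
        by (simp add: \<theta>_def pull_back_sum)
    qed
  next
    fix c x assume c: "c \<in> A" and x: "x \<in> snd c ` fst c"
    have "polyfn m (\<lambda>t. char_coeff (conn_path (D\<^sub>0 c) (D\<^sub>1 c) t) (Suc k) x)"
      unfolding m_def by (intro polyfn_char_coeff[OF op[OF c]] smooth0 smooth1 c x)
    then have "char_coeff (conn_path (D\<^sub>0 c) (D\<^sub>1 c) 1) (Suc k) x - char_coeff (conn_path (D\<^sub>0 c) (D\<^sub>1 c) 0) (Suc k) x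
        = (\<Sum>j\<le>m. w j *\<^sub>R ederiv (?T (real j) c) x)"
      by (intro w char_coeff_path_derivative[OF op[OF c]] smooth0 smooth1 c x)
    also have "\<dots> = ederiv (\<theta> c) x"
      unfolding \<theta>_def[abs_def] using smooth_on_differentiable[OF smooth_T[OF c] x]
      by (simp add: ederiv_sum ederiv_scaleR differentiable_scaleR)
    also have "\<dots> = ext_deriv \<theta> c x"
      using ext_deriv_eq_ederiv[of \<theta> c x] smooth_on_differentiable[OF smooth_\<theta>[OF c] x] by simp
    finally show "char_coeff (D\<^sub>1 c) (Suc k) x = char_coeff (D\<^sub>0 c) (Suc k) x + ext_deriv \<theta> c x"
      by (simp add: conn_path_def[abs_def] algebra_simps)
  qed
qed

text \<open>In the real algebra of even forms Newton's identity can be divided by k, which turns it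
  into the recursion defining \<open>newton\<close>.\<close>

lemma char_form_coeff:
  fixes N :: "('n::{finite,linorder} even_ext)^'m^'m"
  assumes "k \<le> CARD('m)"
  shows "coeff (char_form N) (CARD('m) - k) = newton (\<lambda>i. trace (mpow N i)) k"
  using assms
proof (induction k rule: less_induct)
  case (less k)
  show ?case
  proof (cases k)
    case 0
    then show ?thesis by (simp add: char_form_def char_poly_lead)
  next
    case (Suc m)
    let ?e = "\<lambda>k. coeff (char_form N) (CARD('m) - k)"
    have "of_nat k * ?e k = - (\<Sum>i\<le>m. ?e (m - i) * trace (mpow N (Suc i)))"
      using newton_identity[of m N] less.prems unfolding Suc char_form_def by simp
    also have "\<dots> = - (\<Sum>i\<le>m. newton (\<lambda>i. trace (mpow N i)) (m - i) * trace (mpow N (Suc i)))"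
      using less.prems Suc by (intro arg_cong[where f = uminus] sum.cong refl arg_cong2[where f = "(*)"] less.IH) auto
    finally have eq: "real k *\<^sub>R ?e k = \<dots>"
      by (simp add: scaleR_conv_of_real)
    have "?e k = (1 / real k) *\<^sub>R (real k *\<^sub>R ?e k)"
      using Suc by simp
    then have "?e k = (1 / real k) *\<^sub>R (- (\<Sum>i\<le>m. newton (\<lambda>i. trace (mpow N i)) (m - i) * trace (mpow N (Suc i))))"
      unfolding eq .
    then show ?thesis by (simp add: Suc)
  qed
qed

text \<open>Every product in the recursion has total weight k when the i-th power sum has weight
  i.\<close>

lemma newton_scaleR: "newton (\<lambda>i. r ^ i *\<^sub>R p i) k = r ^ k *\<^sub>R newton p k"
proof (induction k rule: less_induct)
  case (less k)
  show ?case
  proof (cases k)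
    case (Suc m)
    have "newton (\<lambda>i. r ^ i *\<^sub>R p i) (m - i) * r ^ Suc i *\<^sub>R p (Suc i) = r ^ Suc m *\<^sub>R (newton p (m - i) * p (Suc i))"
      if "i \<le> m" for i
    proof -
      have "r ^ (m - i) * r ^ Suc i = r ^ Suc m"
        using that by (simp add: power_add[symmetric] del: power_Suc)
      then show ?thesis using less.IH[of "m - i"] Suc by (simp add: mult.commute)
    qed
    then show ?thesis by (simp add: Suc scaleR_sum_right mult.commute)
  qed simp
qed

lemma form_of_newton: "form_of (newton p k) = newton (\<lambda>i. form_of (p i)) k"
proof (induction k rule: less_induct)
  case (less k)
  then show ?case by (cases k) (simp_all add: form_of_sum)
qed

lemma form_of_trace_mpow: "form_of (trace (mpow N k)) = trace (mpow (\<chi> i j. form_of (N $ i $ j)) k)"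
proof -
  have eq: "(\<chi> i j. form_of (mpow N k $ i $ j)) = mpow (\<chi> i j. form_of (N $ i $ j)) k"
  proof (induction k)
    case 0
    then show ?case by (simp add: mat_def vec_eq_iff)
  next
    case (Suc k)
    then show ?case by (simp add: vec_eq_iff matrix_matrix_mult_def form_of_sum)
  qed
  have "form_of (trace (mpow N k)) = trace (\<chi> i j. form_of (mpow N k $ i $ j))"
    by (simp add: trace_def form_of_sum)
  then show ?thesis unfolding eq .
qed

lemma mpow_scaleR: "mpow (r *\<^sub>R N) k = r ^ k *\<^sub>R mpow N k"
  for N :: "'a::real_algebra_1^'n^'n"
  by (induction k) (simp_all add: matrix_mult_simps)

lemma curvature_forms_eq:
  "(\<chi> i j. form_of (curvature_forms D c x $ i $ j)) = curv_form (D c) x"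
proof -
  have "form_of (two_form (\<lambda>i j. curvature D c x i j $ k $ l))
      = (1 / 2) *\<^sub>R (\<Sum>i\<in>UNIV. \<Sum>j\<in>UNIV. curvature D c x i j $ k $ l *\<^sub>R (dx i * dx j))" for k l
    by (rule form_of_two_form) (simp add: curvature_def)
  moreover have "curv (D c) x = curvature D c x"
    by (simp add: fun_eq_iff curv_def curvature_def)
  ultimately show ?thesis
    by (simp add: vec_eq_iff curvature_forms_def curv_form_def tens_def sum_component mat_mult_nth emb_def of_real_def)
qed

lemma pontrjagin_form_eq:
  fixes D :: "('a, 'n::{finite,linorder}) connection"
  assumes "2 * k \<le> CARD('n)"
  shows "pontrjagin_form D k c x = (1 / (2 * pi)) ^ (2 * k) *\<^sub>R char_coeff (D c) (2 * k) x"
proof -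
  let ?r = "1 / (2 * pi)"
  have "pontrjagin_form D k c x = newton (\<lambda>i. trace (mpow (\<chi> a b. form_of (?r *\<^sub>R curvature_forms D c x $ a $ b)) i)) (2 * k)"
    unfolding pontrjagin_form_def char_form_coeff[OF assms] form_of_newton form_of_trace_mpow by simp
  also have "(\<chi> a b. form_of (?r *\<^sub>R curvature_forms D c x $ a $ b)) = ?r *\<^sub>R curv_form (D c) x"
    unfolding curvature_forms_eq[symmetric] by (simp add: vec_eq_iff)
  finally show ?thesis
    by (simp only: mpow_scaleR trace_scaleR newton_scaleR char_coeff_def)
qed

text \<open>The connection selected by \<open>SOME\<close> in the class and the given
  \<open>D\<close> have characteristic coefficients that differ by an exact form.\<close>

theorem pontrjagin_class_eq:
  fixes A :: "('a::t2_space, 'n::{finite,linorder}) chart set"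
  assumes A: "smooth_atlas A" and D: "is_connection A D" and k: "0 < k" "2 * k \<le> CARD('n)"
  shows "pontrjagin_class A k = de_rham_class A (4 * k) (\<lambda>c x. (1 / (2 * pi)) ^ (2 * k) *\<^sub>R char_coeff (D c) (2 * k) x)"
proof -
  define D' where "D' = (SOME D. is_connection A D)"
  have D': "is_connection A D'" unfolding D'_def by (rule someI[of "is_connection A" D, OF D])
  have k2: "2 * k = Suc (2 * k - 1)" using k by simp
  obtain \<theta> where \<theta>: "is_form A (2 * Suc (2 * k - 1) - 1) \<theta>"
    "\<And>c x. c \<in> A \<Longrightarrow> x \<in> snd c ` fst c \<Longrightarrow>
      char_coeff (D' c) (Suc (2 * k - 1)) x = char_coeff (D c) (Suc (2 * k - 1)) x + ext_deriv \<theta> c x"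
    using chern_weil[OF A D D'] by blast
  show ?thesis
    unfolding pontrjagin_class_def D'_def[symmetric]
  proof (rule de_rham_class_eqI[OF A])
    show "is_form A (4 * k - 1) \<theta>" using \<theta>(1) k by (simp add: k2[symmetric] mult.assoc[symmetric])
    show "pontrjagin_form D' k c x = (1 / (2 * pi)) ^ (2 * k) *\<^sub>R char_coeff (D c) (2 * k) x
        + (1 / (2 * pi)) ^ (2 * k) *\<^sub>R ext_deriv \<theta> c x" if "c \<in> A" "x \<in> snd c ` fst c" for c x
      using \<theta>(2)[OF that] k2 by (simp add: pontrjagin_form_eq[OF k(2)] scaleR_add_right)
  qed
qed

section \<open>Clifford systems of rank 9 on 16-dimensional space\<close>

lemma ex_not_in_9: "card (S :: 9 set) < 9 \<Longrightarrow> \<exists>x. x \<notin> S"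
proof -
  assume "card S < 9"
  then have "S \<noteq> UNIV" by auto
  then show ?thesis by auto
qed

text \<open>Membership of 0 is determined by the parity of the rest, which leaves 2^8 choices. The
  number 256 is the dimension 16^2 of the matrix space, so the even products can form a
  basis.\<close>

lemma card_even_subsets_9: "card {I :: 9 set. even (card I)} = 256"
proof -
  let ?f = "\<lambda>I :: 9 set. if even (card I) then I else insert 0 I"
  have "bij_betw ?f (Pow (UNIV - {0})) {I. even (card I)}"
  proof (rule bij_betwI[where g = "\<lambda>I. I - {0}"])
    show "?f \<in> Pow (UNIV - {0}) \<rightarrow> {I. even (card I)}"
      by (auto simp: card_insert_if finite_subset)
    show "?f (I - {0}) = I" if "I \<in> {I. even (card I)}" for I
      using that by (cases "0 \<in> I") (auto simp: card_Diff_singleton insert_absorb card_gt_0_iff)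
  qed auto
  then have "card {I :: 9 set. even (card I)} = card (Pow (UNIV - {0 :: 9}))"
    by (simp add: bij_betw_same_card)
  then show ?thesis by (simp add: card_Pow)
qed

definition skew_adjoint :: "real^'n^'n \<Rightarrow> real^'n^'n \<Rightarrow> bool" where
  "skew_adjoint G X \<longleftrightarrow> transpose X ** G = - (G ** X)"

lemma transpose_simps:
  fixes A B :: "'a::real_vector^'n^'m"
  shows "transpose (A + B) = transpose A + transpose B" "transpose (A - B) = transpose A - transpose B"
    "transpose (- A) = - transpose A" "transpose (0 :: 'a^'n^'m) = 0" "transpose (r *\<^sub>R A) = r *\<^sub>R transpose A"
  by (simp_all add: transpose_def vec_eq_iff)

locale spin9_module =
  fixes G :: "real^'n^'n" and E :: "9 \<Rightarrow> real^'n^'n"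
  assumes cliff: "clifford_system G E" and card_n: "CARD('n) = 16"
    and G: "transpose G = G" "invertible G"
begin

lemma E_square: "E \<alpha> ** E \<alpha> = mat 1" and E_adjoint: "transpose (E \<alpha>) ** G = G ** E \<alpha>"
  and E_anticommute: "\<alpha> \<noteq> \<beta> \<Longrightarrow> E \<alpha> ** E \<beta> = - (E \<beta> ** E \<alpha>)"
  using cliff unfolding clifford_system_def by blast+

lemma E_square_mult: "E \<alpha> ** (E \<alpha> ** X) = X" "X ** E \<alpha> ** E \<alpha> = X"
  by (simp_all add: matrix_mul_assoc E_square) (simp add: matrix_mul_assoc[symmetric] E_square)

section \<open>The basis of even Clifford products\<close>

primrec cprod :: "9 list \<Rightarrow> real^'n^'n" where
  "cprod [] = mat 1"
| "cprod (\<alpha> # xs) = E \<alpha> ** cprod xs"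

lemma cprod_append: "cprod (xs @ ys) = cprod xs ** cprod ys"
  by (induction xs) (simp_all add: matrix_mul_assoc)

lemma cprod_commute:
  "E \<beta> ** cprod xs = (- 1) ^ (length xs + count_list xs \<beta>) *\<^sub>R (cprod xs ** E \<beta>)"
proof (induction xs)
  case (Cons \<alpha> xs)
  show ?case
  proof (cases "\<alpha> = \<beta>")
    case True
    then show ?thesis by (simp add: Cons matrix_mult_simps matrix_mul_assoc)
  next
    case False
    then have "E \<beta> ** cprod (\<alpha> # xs) = - (E \<alpha> ** (E \<beta> ** cprod xs))"
      using E_anticommute[of \<beta> \<alpha>] by (simp add: matrix_mul_assoc matrix_mult_simps)
    then show ?thesis using False by (simp add: Cons matrix_mult_simps matrix_mul_assoc)
  qed
qed simp

text \<open>Each factor other than \<beta> contributes one sign; for even length only the membership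
  of \<beta> remains visible.\<close>

lemma cprod_conj:
  assumes "distinct xs" "even (length xs)"
  shows "E \<beta> ** cprod xs ** E \<beta> = (if \<beta> \<in> set xs then - 1 else 1) *\<^sub>R cprod xs"
proof -
  have "E \<beta> ** cprod xs ** E \<beta> = (- 1) ^ count_list xs \<beta> *\<^sub>R cprod xs"
    using assms(2) by (simp add: cprod_commute matrix_mult_simps E_square_mult power_add)
  moreover have "count_list xs \<beta> = (if \<beta> \<in> set xs then 1 else 0)"
    using assms(1) by (induction xs) auto
  ultimately show ?thesis by simp
qed

lemma cprod_rev: "cprod (rev xs) ** cprod xs = mat 1"
  by (induction xs) (simp_all add: cprod_append matrix_mul_assoc E_square_mult)

text \<open>Conjugation by an involution preserves the trace. Traces of Clifford products below are
  shown to vanish by finding a suitable \<beta>.\<close>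

lemma trace_conj_zero: "E \<beta> ** X ** E \<beta> = - X \<Longrightarrow> trace X = 0"
proof -
  assume X: "E \<beta> ** X ** E \<beta> = - X"
  have "trace (E \<beta> ** X ** E \<beta>) = trace (E \<beta> ** (E \<beta> ** X))"
    by (subst trace_mul_sym) simp
  then show ?thesis unfolding X by (simp add: E_square_mult trace_simps)
qed

lemma conj_mult: "E \<beta> ** (X ** Y) ** E \<beta> = (E \<beta> ** X ** E \<beta>) ** (E \<beta> ** Y ** E \<beta>)"
  by (simp add: matrix_mul_assoc E_square_mult)

abbreviation eset :: "9 set \<Rightarrow> real^'n^'n" where
  "eset I \<equiv> cprod (sorted_list_of_set I)"

text \<open>Conjugation by an index lying in exactly one of \<open>I\<close> and \<open>J\<close>
  negates the product, so distinct even products are orthogonal for the trace form.\<close>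

lemma trace_eset:
  assumes "even (card I)" "even (card J)"
  shows "trace (cprod (rev (sorted_list_of_set J)) ** eset I) = (if I = J then 16 else 0)"
proof (cases "I = J")
  case True
  then show ?thesis by (simp add: cprod_rev trace_I card_n)
next
  case False
  then obtain \<beta> where \<beta>: "\<beta> \<in> I \<longleftrightarrow> \<beta> \<notin> J" by blast
  have "trace (cprod (rev (sorted_list_of_set J)) ** eset I) = 0"
    by (rule trace_conj_zero[of \<beta>]) (use \<beta> assms in \<open>auto simp: conj_mult cprod_conj matrix_mult_simps\<close>)
  then show ?thesis using False by simp
qed

text \<open>Orthogonality gives independence, and there are as many even products as the dimension
  of the matrix space.\<close>

lemma span_eset: "span (eset ` {I. even (card I)}) = UNIV"
proof -
  let ?Ev = "{I :: 9 set. even (card I)}"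
  have coeff: "u J = 0" if "J \<in> ?Ev" "(\<Sum>I\<in>?Ev. u I *\<^sub>R eset I) = 0" for u :: "9 set \<Rightarrow> real" and J
  proof -
    have "0 = trace (cprod (rev (sorted_list_of_set J)) ** (\<Sum>I\<in>?Ev. u I *\<^sub>R eset I))"
      by (simp add: that(2) matrix_mult_simps trace_simps)
    also have "\<dots> = (\<Sum>I\<in>?Ev. if I = J then u J * 16 else 0)"
      unfolding matrix_mult_simps trace_simps by (rule sum.cong) (use that(1) in \<open>auto simp: trace_eset\<close>)
    also have "\<dots> = u J * 16"
      using that(1) by simp
    finally show ?thesis by simp
  qed
  have inj: "inj_on eset ?Ev"
  proof (rule inj_onI)
    fix I J assume IJ: "I \<in> ?Ev" "J \<in> ?Ev" "eset I = eset J"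
    then have "trace (cprod (rev (sorted_list_of_set J)) ** eset I) = 16"
      using trace_eset[of J J] by simp
    then show "I = J" using trace_eset[of I J] IJ by (auto split: if_splits)
  qed
  have "independent (eset ` ?Ev)"
    unfolding independent_explicit
  proof (intro conjI allI impI ballI)
    fix u v assume u: "(\<Sum>v\<in>eset ` ?Ev. u v *\<^sub>R v) = 0" and v: "v \<in> eset ` ?Ev"
    then obtain J where J: "J \<in> ?Ev" "v = eset J" by auto
    have "(\<Sum>I\<in>?Ev. u (eset I) *\<^sub>R eset I) = 0"
      using u by (simp add: sum.reindex[OF inj] o_def)
    then show "u v = 0" using coeff[OF J(1), of "\<lambda>I. u (eset I)"] J by simp
  qed simp
  moreover have "dim (UNIV :: (real^'n^'n) set) \<le> card (eset ` ?Ev)"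
    by (simp add: card_image[OF inj] card_even_subsets_9 card_n)
  ultimately show ?thesis
    using card_ge_dim_independent[of "eset ` ?Ev" UNIV] by auto
qed

lemma linear_eq_on_cprod:
  assumes "linear f" "linear g" "\<And>xs. distinct xs \<Longrightarrow> even (length xs) \<Longrightarrow> f (cprod xs) = g (cprod xs)"
  shows "f X = g X"
proof (rule linear_eq_on_span[OF assms(1,2), of "eset ` {I. even (card I)}"])
  show "X \<in> span (eset ` {I. even (card I)})" by (simp add: span_eset)
qed (auto intro!: assms(3))

lemma cprod_adjoint: "transpose (cprod xs) ** G = G ** cprod (rev xs)"
proof (induction xs)
  case (Cons \<alpha> xs)
  have "transpose (cprod (\<alpha> # xs)) ** G = transpose (cprod xs) ** (transpose (E \<alpha>) ** G)"
    by (simp add: matrix_transpose_mul matrix_mul_assoc)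
  also have "\<dots> = (transpose (cprod xs) ** G) ** E \<alpha>"
    by (simp add: E_adjoint matrix_mul_assoc)
  finally show ?case by (simp add: Cons cprod_append matrix_mul_assoc)
qed simp

lemma cprod_rev_sign: "distinct xs \<Longrightarrow> cprod (rev xs) = (- 1) ^ (length xs * (length xs - 1) div 2) *\<^sub>R cprod xs"
proof (induction xs)
  case (Cons \<alpha> xs)
  then have "cprod (rev (\<alpha> # xs)) = (- 1) ^ (length xs * (length xs - 1) div 2) *\<^sub>R (cprod xs ** E \<alpha>)"
    by (simp add: cprod_append matrix_mult_simps)
  also have "cprod xs ** E \<alpha> = (- 1) ^ length xs *\<^sub>R (E \<alpha> ** cprod xs)"
    using Cons.prems by (simp add: cprod_commute count_list_0_iff power_add[symmetric])
  finally have "cprod (rev (\<alpha> # xs)) = (- 1) ^ (length xs * (length xs - 1) div 2 + length xs) *\<^sub>R cprod (\<alpha> # xs)"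
    by (simp add: power_add)
  also have "length xs * (length xs - 1) div 2 + length xs = Suc (length xs) * (Suc (length xs) - 1) div 2"
  proof -
    have "Suc (length xs) * (Suc (length xs) - 1) = length xs * (length xs - 1) + length xs * 2"
      by (cases "length xs") auto
    then show ?thesis by simp
  qed
  finally show ?case by simp
qed simp

text \<open>The adjoint reverses a product, with sign (-1)^(k (k - 1) / 2). Among the even lengths
  this is negative for 2 and 6 only, so the skew-adjoint endomorphisms are the sum of the second and
  the sixth exterior power of \<open>V\<close>, of dimension 36 + 84 = 120.\<close>

lemma linear_eq_on_skew_adjoint:
  assumes f: "linear f" and g: "linear g"
    and eq: "\<And>xs. distinct xs \<Longrightarrow> length xs = 2 \<or> length xs = 6 \<Longrightarrow> f (cprod xs) = g (cprod xs)"
    and X: "skew_adjoint G X"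
  shows "f X = g X"
proof -
  obtain H where H: "G ** H = mat 1" "H ** G = mat 1"
    using G(2) unfolding invertible_def by blast
  \<comment> \<open>The projection onto the skew-adjoint part: \<open>H ** transpose X ** G\<close>
    is the adjoint of \<open>X\<close> with respect to \<open>G\<close>.\<close>
  define p where "p X = (1 / 2) *\<^sub>R (X - H ** transpose X ** G)" for X
  have p: "linear p"
    by (intro linearI) (simp_all add: p_def transpose_simps matrix_mult_simps algebra_simps)
  have "(f \<circ> p) X = (g \<circ> p) X"
  proof (rule linear_eq_on_cprod[OF linear_compose[OF p f] linear_compose[OF p g]])
    fix xs :: "9 list" assume xs: "distinct xs" "even (length xs)"
    have "H ** transpose (cprod xs) ** G = H ** (G ** cprod (rev xs))"
      by (simp add: cprod_adjoint matrix_mul_assoc[symmetric])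
    also have "\<dots> = cprod (rev xs)" by (simp add: matrix_mul_assoc H)
    finally have pc: "p (cprod xs) = (1 / 2) *\<^sub>R (cprod xs - cprod (rev xs))" by (simp add: p_def)
    have "length xs \<le> 9"
      using distinct_card[OF xs(1)] card_mono[of UNIV "set xs"] by simp
    then have "length xs = 0 \<or> length xs = 2 \<or> length xs = 4 \<or> length xs = 6 \<or> length xs = 8"
      using xs(2) by presburger
    then consider "length xs = 2 \<or> length xs = 6" | "length xs = 0 \<or> length xs = 4 \<or> length xs = 8"
      by blast
    then show "(f \<circ> p) (cprod xs) = (g \<circ> p) (cprod xs)"
    proof cases
      case 1
      then have "p (cprod xs) = cprod xs"
        by (auto simp: pc cprod_rev_sign[OF xs(1)] scaleR_2[symmetric])
      then show ?thesis using eq[OF xs(1) 1] by simp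
    next
      case 2
      then have "p (cprod xs) = 0"
        by (auto simp: pc cprod_rev_sign[OF xs(1)])
      then show ?thesis by (simp add: linear_0[OF f] linear_0[OF g])
    qed
  qed
  moreover have "p X = X"
    using X by (simp add: p_def skew_adjoint_def matrix_mul_assoc[symmetric] matrix_mult_simps)
      (simp add: matrix_mul_assoc H scaleR_2[symmetric])
  ultimately show ?thesis by simp
qed

section \<open>The conjugation sum \<open>T\<close> and the Fierz identity\<close>

definition T :: "real^'n^'n \<Rightarrow> real^'n^'n" where
  "T X = (\<Sum>\<alpha>\<in>UNIV. E \<alpha> ** X ** E \<alpha>)"

text \<open>The zero diagonal makes \<open>F\<close> antisymmetric, so sums over spin(9) can run
  over all pairs, with each generator counted twice.\<close>

definition F :: "9 \<Rightarrow> 9 \<Rightarrow> real^'n^'n" where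
  "F \<alpha> \<beta> = (if \<alpha> = \<beta> then 0 else E \<alpha> ** E \<beta>)"

lemma linear_T: "linear T"
  by (intro linearI) (simp_all add: T_def matrix_mult_simps matrix_add_distrib_right sum.distrib scaleR_sum_right)

text \<open>Of the nine conjugations, those by the k factors negate the product and the other 9 - k
  fix it.\<close>

lemma T_cprod:
  assumes "distinct xs" "even (length xs)"
  shows "T (cprod xs) = (9 - 2 * real (length xs)) *\<^sub>R cprod xs"
proof -
  have "(\<Sum>\<beta>\<in>(UNIV :: 9 set). if \<beta> \<in> set xs then - 1 else 1 :: real) = 9 - 2 * real (length xs)"
    using distinct_card[OF assms(1)] card_mono[of UNIV "set xs"]
    by (simp add: sum.If_cases Compl_eq_Diff_UNIV card_Diff_subset of_nat_diff)
  then show ?thesis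
    using assms by (simp add: T_def cprod_conj scaleR_sum_left[symmetric])
qed

lemma F_antisym: "F \<beta> \<alpha> = - F \<alpha> \<beta>"
  using E_anticommute[of \<alpha> \<beta>] by (simp add: F_def)

lemma F_diag [simp]: "F \<alpha> \<alpha> = 0"
  by (simp add: F_def)

lemma F_square: "\<alpha> \<noteq> \<beta> \<Longrightarrow> F \<alpha> \<beta> ** F \<alpha> \<beta> = - mat 1"
proof -
  assume ne: "\<alpha> \<noteq> \<beta>"
  then have "F \<alpha> \<beta> ** F \<alpha> \<beta> = - (F \<alpha> \<beta> ** F \<beta> \<alpha>)"
    using F_antisym[of \<alpha> \<beta>] by (simp add: matrix_mult_simps)
  also have "F \<alpha> \<beta> ** F \<beta> \<alpha> = E \<alpha> ** (E \<beta> ** E \<beta>) ** E \<alpha>"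
    using ne by (simp add: F_def matrix_mul_assoc)
  finally show ?thesis by (simp add: E_square)
qed

lemma F_conj: "E \<gamma> ** F \<alpha> \<beta> ** E \<gamma> = (if \<gamma> = \<alpha> \<or> \<gamma> = \<beta> then - 1 else 1) *\<^sub>R F \<alpha> \<beta>"
proof (cases "\<alpha> = \<beta>")
  case False
  then have "F \<alpha> \<beta> = cprod [\<alpha>, \<beta>]" by (simp add: F_def)
  then show ?thesis using cprod_conj[of "[\<alpha>, \<beta>]" \<gamma>] False by (auto simp del: cprod.simps)
qed (simp add: matrix_mult_simps)

lemma skew_adjoint_F: "skew_adjoint G (F \<alpha> \<beta>)"
proof (cases "\<alpha> = \<beta>")
  case False
  then have "transpose (F \<alpha> \<beta>) ** G = G ** F \<beta> \<alpha>"
    using cprod_adjoint[of "[\<alpha>, \<beta>]"] by (simp add: F_def)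
  then show ?thesis
    by (simp add: skew_adjoint_def F_antisym[of \<alpha> \<beta>] matrix_mult_simps)
qed (simp add: skew_adjoint_def matrix_mult_simps transpose_simps)

lemma trace_F_F: "\<mu> \<noteq> \<nu> \<Longrightarrow> trace (F \<mu> \<nu> ** F \<alpha> \<beta>)
    = (if \<alpha> = \<mu> \<and> \<beta> = \<nu> then - 16 else if \<alpha> = \<nu> \<and> \<beta> = \<mu> then 16 else 0)"
proof -
  assume ne: "\<mu> \<noteq> \<nu>"
  consider "\<alpha> = \<mu>" "\<beta> = \<nu>" | "\<alpha> = \<nu>" "\<beta> = \<mu>" | "\<alpha> = \<beta>"
    | "\<alpha> \<noteq> \<beta>" "\<not> (\<alpha> = \<mu> \<and> \<beta> = \<nu>)" "\<not> (\<alpha> = \<nu> \<and> \<beta> = \<mu>)" by blast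
  then show ?thesis
  proof cases
    case 1
    then show ?thesis using ne by (simp add: F_square trace_simps trace_I card_n)
  next
    case 2
    then show ?thesis using ne F_antisym[of \<mu> \<nu>] by (simp add: F_square matrix_mult_simps trace_simps trace_I card_n)
  next
    case 3
    then show ?thesis using ne by (auto simp: matrix_mult_simps trace_simps)
  next
    case 4
    then obtain \<gamma> where "(\<gamma> = \<mu> \<or> \<gamma> = \<nu>) \<noteq> (\<gamma> = \<alpha> \<or> \<gamma> = \<beta>)" using ne by metis
    then have "E \<gamma> ** (F \<mu> \<nu> ** F \<alpha> \<beta>) ** E \<gamma> = - (F \<mu> \<nu> ** F \<alpha> \<beta>)"
      by (auto simp: conj_mult F_conj matrix_mult_simps)
    then have "trace (F \<mu> \<nu> ** F \<alpha> \<beta>) = 0" by (rule trace_conj_zero)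
    then show ?thesis using 4(2,3) by presburger
  qed
qed

text \<open>At least four of the six indices lie outside {\<alpha>, \<beta>}, and conjugation by any
  of them negates the product.\<close>

lemma trace_cprod_F:
  assumes "distinct xs" "length xs = 6"
  shows "trace (cprod xs ** F \<alpha> \<beta>) = 0"
proof -
  have "card (set xs - {\<alpha>, \<beta>}) \<ge> 6 - 2"
    using distinct_card[OF assms(1)] assms(2)
    by (intro order_trans[OF _ diff_card_le_card_Diff]) (auto simp: card_insert_if)
  then obtain \<gamma> where "\<gamma> \<in> set xs" "\<gamma> \<noteq> \<alpha>" "\<gamma> \<noteq> \<beta>"
    by (cases "set xs - {\<alpha>, \<beta>} = {}") auto
  then have "E \<gamma> ** (cprod xs ** F \<alpha> \<beta>) ** E \<gamma> = - (cprod xs ** F \<alpha> \<beta>)"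
    using assms by (simp add: conj_mult F_conj cprod_conj matrix_mult_simps)
  then show ?thesis by (rule trace_conj_zero)
qed

lemma sum_trace_F_F:
  assumes "\<mu> \<noteq> \<nu>"
  shows "(\<Sum>\<alpha>\<in>UNIV. \<Sum>\<beta>\<in>UNIV. trace (F \<mu> \<nu> ** F \<alpha> \<beta>) *\<^sub>R F \<alpha> \<beta>) = - 32 *\<^sub>R F \<mu> \<nu>"
proof -
  have "(\<Sum>\<beta>\<in>UNIV. trace (F \<mu> \<nu> ** F \<alpha> \<beta>) *\<^sub>R F \<alpha> \<beta>)
      = (if \<alpha> = \<mu> then - 16 *\<^sub>R F \<mu> \<nu> else 0) + (if \<alpha> = \<nu> then 16 *\<^sub>R F \<nu> \<mu> else 0)" for \<alpha>
  proof -
    have "(\<Sum>\<beta>\<in>UNIV. trace (F \<mu> \<nu> ** F \<alpha> \<beta>) *\<^sub>R F \<alpha> \<beta>)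
        = (\<Sum>\<beta>\<in>UNIV. (if \<beta> = \<nu> then if \<alpha> = \<mu> then - 16 *\<^sub>R F \<mu> \<nu> else 0 else 0)
          + (if \<beta> = \<mu> then if \<alpha> = \<nu> then 16 *\<^sub>R F \<nu> \<mu> else 0 else 0))"
      using assms by (intro sum.cong) (auto simp: trace_F_F)
    then show ?thesis by (simp add: sum.distrib)
  qed
  then show ?thesis by (simp add: sum.distrib F_antisym[of \<mu> \<nu>])
qed

text \<open>\<open>T\<close> is 5 on products of length 2 and -3 on products of length 6, so T + 3
  is 8 times the projection onto spin(9). The right-hand side is the same operator in terms of the
  trace form, since (- 1/4) (- 32) = 8.\<close>

theorem fierz:
  assumes "skew_adjoint G X"
  shows "T X + 3 *\<^sub>R X = - (1 / 4) *\<^sub>R (\<Sum>\<alpha>\<in>UNIV. \<Sum>\<beta>\<in>UNIV. trace (X ** F \<alpha> \<beta>) *\<^sub>R F \<alpha> \<beta>)"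
proof (rule linear_eq_on_skew_adjoint[OF _ _ _ assms])
  show "linear (\<lambda>X. T X + 3 *\<^sub>R X)"
    by (intro linearI) (simp_all add: linear_add[OF linear_T] linear_cmul[OF linear_T] algebra_simps)
  show "linear (\<lambda>X. - (1 / 4) *\<^sub>R (\<Sum>\<alpha>\<in>UNIV. \<Sum>\<beta>\<in>UNIV. trace (X ** F \<alpha> \<beta>) *\<^sub>R F \<alpha> \<beta>))"
    by (intro linearI) (simp_all add: matrix_mult_simps trace_simps scaleR_add_left sum.distrib scaleR_sum_right algebra_simps)
  fix xs :: "9 list" assume xs: "distinct xs" "length xs = 2 \<or> length xs = 6"
  show "T (cprod xs) + 3 *\<^sub>R cprod xs
      = - (1 / 4) *\<^sub>R (\<Sum>\<alpha>\<in>UNIV. \<Sum>\<beta>\<in>UNIV. trace (cprod xs ** F \<alpha> \<beta>) *\<^sub>R F \<alpha> \<beta>)"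
    using xs(2)
  proof
    assume 2: "length xs = 2"
    then obtain \<mu> \<nu> where eq: "xs = [\<mu>, \<nu>]" "\<mu> \<noteq> \<nu>"
      using xs(1) by (auto simp: length_Suc_conv numeral_2_eq_2)
    then have F: "cprod xs = F \<mu> \<nu>" by (simp add: F_def)
    have "T (cprod xs) + 3 *\<^sub>R cprod xs = 8 *\<^sub>R cprod xs"
      using T_cprod[OF xs(1)] 2 by (simp add: scaleR_add_left[symmetric])
    then show ?thesis unfolding F sum_trace_F_F[OF eq(2)] by simp
  next
    assume 6: "length xs = 6"
    then have "T (cprod xs) + 3 *\<^sub>R cprod xs = 0"
      using T_cprod[OF xs(1)] by (simp add: scaleR_add_left[symmetric])
    then show ?thesis by (simp add: trace_cprod_F[OF xs(1) 6])
  qed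
qed

text \<open>The equation x^2 = 2 x + 15 has as roots the two eigenvalues 5 and -3 of
  \<open>T\<close> on skew-adjoint endomorphisms.\<close>

theorem T_T_skew_adjoint:
  assumes "skew_adjoint G X"
  shows "T (T X) = 2 *\<^sub>R T X + 15 *\<^sub>R X"
proof (rule linear_eq_on_skew_adjoint[OF _ _ _ assms])
  show "linear (\<lambda>X. T (T X))"
    using linear_compose[OF linear_T linear_T] by (simp add: o_def)
  show "linear (\<lambda>X. 2 *\<^sub>R T X + 15 *\<^sub>R X)"
    by (intro linearI) (simp_all add: linear_add[OF linear_T] linear_cmul[OF linear_T] algebra_simps)
  fix xs :: "9 list" assume xs: "distinct xs" "length xs = 2 \<or> length xs = 6"
  then have "T (cprod xs) = (9 - 2 * real (length xs)) *\<^sub>R cprod xs" by (auto intro: T_cprod)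
  then show "T (T (cprod xs)) = 2 *\<^sub>R T (cprod xs) + 15 *\<^sub>R cprod xs"
    using xs(2) by (auto simp: linear_cmul[OF linear_T] linear_neg[OF linear_T] scaleR_add_left[symmetric] simp flip: scaleR_minus_left)
qed

text \<open>For distinct indices, conjugation by F is minus the composite of two conjugations by E,
  so the sum is 9 X - T (T X), where 9 X corrects the diagonal. The quadratic equation of
  \<open>T\<close> then brings back the operator T + 3.\<close>

lemma sum_F_conj:
  assumes "skew_adjoint G X"
  shows "(\<Sum>\<alpha>\<in>UNIV. \<Sum>\<beta>\<in>UNIV. F \<alpha> \<beta> ** X ** F \<alpha> \<beta>) = - 2 *\<^sub>R (T X + 3 *\<^sub>R X)"
proof -
  have "F \<alpha> \<beta> ** X ** F \<alpha> \<beta> = (if \<alpha> = \<beta> then X else 0) - E \<alpha> ** (E \<beta> ** X ** E \<beta>) ** E \<alpha>" for \<alpha> \<beta>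
  proof (cases "\<alpha> = \<beta>")
    case True
    then show ?thesis by (simp add: matrix_mult_simps matrix_mul_assoc E_square) (simp add: E_square_mult)
  next
    case False
    then have "F \<alpha> \<beta> ** X ** F \<alpha> \<beta> = - (F \<alpha> \<beta> ** X ** F \<beta> \<alpha>)"
      using F_antisym[of \<alpha> \<beta>] by (simp add: matrix_mult_simps)
    then show ?thesis using False by (simp add: F_def matrix_mul_assoc)
  qed
  then have "(\<Sum>\<alpha>\<in>UNIV. \<Sum>\<beta>\<in>UNIV. F \<alpha> \<beta> ** X ** F \<alpha> \<beta>) = 9 *\<^sub>R X - T (T X)"
    by (simp add: sum_subtractf T_def matrix_mult_sum_left matrix_mult_sum_right scaleR_conv_of_real sum_constant_scaleR)
  then show ?thesis
    unfolding T_T_skew_adjoint[OF assms] by (simp add: vec_eq_iff)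
qed

text \<open>Commuting with the generators of spin(9) means commuting with all even products, hence
  with all matrices, in particular with the matrix units.\<close>

lemma schur:
  assumes comm: "\<And>\<alpha> \<beta>. F \<alpha> \<beta> ** Z = Z ** F \<alpha> \<beta>"
  obtains z where "Z = z *\<^sub>R mat 1"
proof -
  have "cprod xs ** Z = Z ** cprod xs" if "even (length xs)" for xs
    using that
  proof (induction xs rule: induct_list012)
    case (3 \<alpha> \<beta> xs)
    have "E \<alpha> ** E \<beta> ** Z = Z ** (E \<alpha> ** E \<beta>)"
      using comm[of \<alpha> \<beta>] by (cases "\<alpha> = \<beta>") (simp_all add: F_def E_square)
    then have "cprod (\<alpha> # \<beta> # xs) ** Z = (E \<alpha> ** E \<beta>) ** (cprod xs ** Z)"
      "Z ** cprod (\<alpha> # \<beta> # xs) = (E \<alpha> ** E \<beta>) ** (Z ** cprod xs)"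
      by (simp_all add: matrix_mul_assoc)
    then show ?case using 3 by simp
  qed auto
  then have comm': "X ** Z = Z ** X" for X
    by (intro linear_eq_on_cprod[of "\<lambda>X. X ** Z" "\<lambda>X. Z ** X" X])
       (auto intro!: linearI simp: matrix_mult_simps)
  have entry: "Z $ i $ a = (if i = a then Z $ b $ b else 0)" for i a b
  proof -
    let ?X = "(\<chi> k l. if k = a \<and> l = b then 1 else 0) :: real^'n^'n"
    have "(Z ** ?X) $ i $ b = Z $ i $ a"
      by (simp add: matrix_matrix_mult_def if_distrib cong: if_cong)
    moreover have "(?X ** Z) $ i $ b = (if i = a then Z $ b $ b else 0)"
      by (auto simp: matrix_matrix_mult_def if_distrib if_distribR cong: if_cong)
    ultimately show ?thesis using comm'[of ?X] by simp
  qed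
  define z where "z = Z $ undefined $ undefined"
  have "Z $ i $ a = (z *\<^sub>R mat 1) $ i $ a" for i a
    using entry[of i a undefined] by (simp add: z_def mat_def)
  then show thesis by (intro that[of z]) (simp add: vec_eq_iff)
qed

end

text \<open>Constants off the diagonal solve the system, as the nine signs add up to 3 - 6 = -3 and
  the 9 missing diagonal terms balance (-3)^2. Comparing triples that differ in a single index shows
  that there are no other solutions.\<close>

lemma constant_off_diagonal:
  fixes K :: "9 \<Rightarrow> 9 \<Rightarrow> real"
  assumes sym: "\<And>\<alpha> \<beta>. K \<alpha> \<beta> = K \<beta> \<alpha>" and diag: "\<And>\<alpha>. K \<alpha> \<alpha> = 0"
    and zero: "\<And>\<rho> \<mu> \<nu>. \<rho> \<noteq> \<mu> \<Longrightarrow> \<rho> \<noteq> \<nu> \<Longrightarrow> \<mu> \<noteq> \<nu> \<Longrightarrow>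
      (\<Sum>\<alpha>\<in>UNIV. \<Sum>\<beta>\<in>UNIV. (if \<alpha> \<in> {\<rho>, \<mu>, \<nu>} then 1 else - 1) * (if \<beta> \<in> {\<rho>, \<mu>, \<nu>} then 1 else - 1) * K \<alpha> \<beta>) = 0"
    and ne: "\<alpha> \<noteq> \<beta>" "\<gamma> \<noteq> \<delta>"
  shows "K \<alpha> \<beta> = K \<gamma> \<delta>"
proof -
  define r where "r \<alpha> = (\<Sum>\<beta>\<in>UNIV. K \<alpha> \<beta>)" for \<alpha>
  define tot where "tot = (\<Sum>\<alpha>\<in>UNIV. r \<alpha>)"
  have ext: "\<exists>x. x \<notin> set [a, b, c, d]" for a b c d :: 9
    by (rule ex_not_in_9[OF le_less_trans[OF card_length]]) simp
  have eq: "8 * (K \<rho> \<mu> + K \<rho> \<nu> + K \<mu> \<nu>) - 4 * (r \<rho> + r \<mu> + r \<nu>) + tot = 0"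
    if "\<rho> \<noteq> \<mu>" "\<rho> \<noteq> \<nu>" "\<mu> \<noteq> \<nu>" for \<rho> \<mu> \<nu>
  proof -
    let ?C = "{\<rho>, \<mu>, \<nu>}"
    let ?i = "\<lambda>\<alpha>. if \<alpha> \<in> ?C then 1 else 0 :: real"
    have sC: "(\<Sum>\<alpha>\<in>UNIV. ?i \<alpha> * f \<alpha>) = f \<rho> + f \<mu> + f \<nu>" for f :: "9 \<Rightarrow> real"
    proof -
      have "(\<Sum>\<alpha>\<in>UNIV. ?i \<alpha> * f \<alpha>) = (\<Sum>\<alpha>\<in>?C. f \<alpha>)"
        by (rule sum.mono_neutral_cong_right) auto
      then show ?thesis using that by simp
    qed
    have "(\<Sum>\<alpha>\<in>UNIV. \<Sum>\<beta>\<in>UNIV. (if \<alpha> \<in> ?C then 1 else - 1) * (if \<beta> \<in> ?C then 1 else - 1) * K \<alpha> \<beta>)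
        = (\<Sum>\<alpha>\<in>UNIV. \<Sum>\<beta>\<in>UNIV. 4 * (?i \<alpha> * (?i \<beta> * K \<alpha> \<beta>)) - 2 * (?i \<alpha> * K \<alpha> \<beta>) - 2 * (?i \<beta> * K \<alpha> \<beta>) + K \<alpha> \<beta>)"
      by (intro sum.cong) auto
    also have "\<dots> = 4 * (\<Sum>\<alpha>\<in>UNIV. ?i \<alpha> * (\<Sum>\<beta>\<in>UNIV. ?i \<beta> * K \<alpha> \<beta>)) - 2 * (\<Sum>\<alpha>\<in>UNIV. ?i \<alpha> * r \<alpha>)
        - 2 * (\<Sum>\<beta>\<in>UNIV. ?i \<beta> * (\<Sum>\<alpha>\<in>UNIV. K \<alpha> \<beta>)) + tot"
      unfolding tot_def r_def sum_distrib_left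
      by (simp only: sum.distrib sum_subtractf) (subst (4) sum.swap, rule refl)
    also have "(\<Sum>\<beta>\<in>UNIV. ?i \<beta> * (\<Sum>\<alpha>\<in>UNIV. K \<alpha> \<beta>)) = (\<Sum>\<alpha>\<in>UNIV. ?i \<alpha> * r \<alpha>)"
      by (simp add: r_def sym)
    finally show ?thesis
      using zero[OF that] sym[of \<rho>] sym[of \<mu> \<nu>] unfolding sC by (simp add: diag)
  qed
  have indep: "K \<rho> \<nu> = K \<rho> \<nu>'" if l: "\<rho> \<noteq> \<nu>" "\<rho> \<noteq> \<nu>'" for \<rho> \<nu> \<nu>'
  proof (cases "\<nu> = \<nu>'")
    case False
    \<comment> \<open>Subtracting the equations of two triples that differ only in \<nu> and \<nu>'
      gives sums of two values of \<open>x\<close>, and three such sums force x = ?d away from \<nu>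
      and \<nu>'. Adding up the seven remaining values of \<open>x\<close> gives 4 ?d = 7
      ?d.\<close>
    let ?d = "(r \<nu> - r \<nu>') / 4"
    define x where "x \<rho> = K \<rho> \<nu> - K \<rho> \<nu>'" for \<rho>
    have pair: "x \<rho> + x \<mu> = 2 * ?d" if "\<rho> \<noteq> \<mu>" "\<rho> \<notin> {\<nu>, \<nu>'}" "\<mu> \<notin> {\<nu>, \<nu>'}" for \<rho> \<mu>
      using eq[of \<rho> \<mu> \<nu>] eq[of \<rho> \<mu> \<nu>'] that by (simp add: x_def field_simps)
    have x: "x \<rho> = ?d" if l: "\<rho> \<notin> {\<nu>, \<nu>'}" for \<rho>
    proof -
      obtain \<mu> where \<mu>: "\<mu> \<notin> {\<rho>, \<nu>, \<nu>'}" using ext[of \<rho> \<rho> \<nu> \<nu>'] by auto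
      obtain \<kappa> where \<kappa>: "\<kappa> \<notin> {\<mu>, \<rho>, \<nu>, \<nu>'}" using ext[of \<mu> \<rho> \<nu> \<nu>'] by auto
      show ?thesis
        using pair[of \<rho> \<mu>] pair[of \<rho> \<kappa>] pair[of \<mu> \<kappa>] l \<mu> \<kappa> by auto
    qed
    have "r \<nu> - r \<nu>' = (\<Sum>\<rho>\<in>UNIV. x \<rho>)"
      by (simp add: r_def x_def sum_subtractf sym)
    also have "\<dots> = (\<Sum>\<rho>\<in>UNIV - {\<nu>, \<nu>'}. x \<rho>) + (\<Sum>\<rho>\<in>{\<nu>, \<nu>'}. x \<rho>)"
      by (rule sum.subset_diff) auto
    also have "(\<Sum>\<rho>\<in>{\<nu>, \<nu>'}. x \<rho>) = 0"
      using False sym[of \<nu> \<nu>'] by (simp add: x_def diag)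
    also have "(\<Sum>\<rho>\<in>UNIV - {\<nu>, \<nu>'}. x \<rho>) = (\<Sum>\<rho>\<in>UNIV - {\<nu>, \<nu>'}. ?d)"
      by (rule sum.cong) (simp_all add: x)
    also have "\<dots> = 7 * ?d"
      using False by (simp add: card_Diff_subset)
    finally have "?d = 0" by simp
    then show ?thesis using x[of \<rho>] l by (simp add: x_def)
  qed simp
  show ?thesis
    using indep[of \<alpha> \<beta> \<delta>] indep[of \<delta> \<alpha> \<gamma>] indep[of \<beta> \<alpha> \<delta>] indep[of \<delta> \<beta> \<gamma>] indep[of \<alpha> \<beta> \<gamma>] ne sym
    by metis
qed

lemma sum_swap4:
  "(\<Sum>a\<in>A. \<Sum>b\<in>B. \<Sum>c\<in>C. \<Sum>d\<in>D. f a b c d) = (\<Sum>c\<in>C. \<Sum>d\<in>D. \<Sum>a\<in>A. \<Sum>b\<in>B. f a b c d)"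
proof -
  have "(\<Sum>a\<in>A. \<Sum>b\<in>B. \<Sum>c\<in>C. \<Sum>d\<in>D. f a b c d) = (\<Sum>a\<in>A. \<Sum>c\<in>C. \<Sum>b\<in>B. \<Sum>d\<in>D. f a b c d)"
    by (intro sum.cong refl sum.swap)
  also have "\<dots> = (\<Sum>c\<in>C. \<Sum>a\<in>A. \<Sum>b\<in>B. \<Sum>d\<in>D. f a b c d)" by (rule sum.swap)
  also have "\<dots> = (\<Sum>c\<in>C. \<Sum>a\<in>A. \<Sum>d\<in>D. \<Sum>b\<in>B. f a b c d)"
    by (intro sum.cong refl sum.swap)
  also have "\<dots> = (\<Sum>c\<in>C. \<Sum>d\<in>D. \<Sum>a\<in>A. \<Sum>b\<in>B. f a b c d)"
    by (intro sum.cong refl sum.swap)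
  finally show ?thesis .
qed

text \<open>The octahedron argument: four instances of the cyclic identity, one for each cyclic
  shift of i, j, k, l, are combined by means of the two antisymmetries.\<close>

lemma curvature_pair_symmetry:
  fixes r :: "'i \<Rightarrow> 'i \<Rightarrow> 'i \<Rightarrow> 'i \<Rightarrow> real"
  assumes "\<And>i j k l. r j i k l = - r i j k l" "\<And>i j k l. r i j l k = - r i j k l"
    "\<And>i j k l. r i j k l + r j l k i + r l i k j = 0"
  shows "r i j k l = r k l i j"
  using assms(3)[of i j k l] assms(3)[of j k l i] assms(3)[of k l i j] assms(3)[of l i j k]
    assms(1,2) by (smt (verit))

section \<open>Rigidity of curvature tensors with values in spin(9)\<close>

context spin9_module
begin

text \<open>The matrix entry, in the frame \<open>E\<close>, of the action of \<open>S\<close> on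
  \<open>V\<close> by commutators. In \<open>end_inner_commutator\<close> the factor arises as - 2 /
  16.\<close>

definition coframe_coeff :: "real^'n^'n \<Rightarrow> 9 \<Rightarrow> 9 \<Rightarrow> real" where
  "coframe_coeff S \<alpha> \<beta> = - (1 / 8) * trace (S ** F \<alpha> \<beta>)"

lemma trace_E_E: "trace (E \<alpha> ** E \<beta>) = (if \<alpha> = \<beta> then 16 else 0)"
proof (cases "\<alpha> = \<beta>")
  case True
  then show ?thesis by (simp add: E_square trace_I card_n)
next
  case False
  have "trace (E \<alpha> ** E \<beta>) = - trace (E \<beta> ** E \<alpha>)"
    using E_anticommute[OF False] by (simp add: trace_simps)
  also have "trace (E \<beta> ** E \<alpha>) = trace (E \<alpha> ** E \<beta>)" by (rule trace_mul_sym)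
  finally show ?thesis using False by simp
qed

lemma end_inner_commutator: "end_inner (E \<alpha>) (S ** E \<beta> - E \<beta> ** S) = coframe_coeff S \<alpha> \<beta>"
proof -
  have "trace (E \<alpha> ** (S ** E \<beta> - E \<beta> ** S)) = trace (E \<alpha> ** (S ** E \<beta>)) - trace ((E \<alpha> ** E \<beta>) ** S)"
    by (simp add: matrix_mult_simps trace_simps matrix_mul_assoc)
  also have "trace (E \<alpha> ** (S ** E \<beta>)) = trace (S ** (E \<beta> ** E \<alpha>))"
    by (subst trace_mul_sym) (simp add: matrix_mul_assoc)
  also have "trace ((E \<alpha> ** E \<beta>) ** S) = trace (S ** (E \<alpha> ** E \<beta>))" by (rule trace_mul_sym)
  also have "trace (S ** (E \<beta> ** E \<alpha>)) - trace (S ** (E \<alpha> ** E \<beta>)) = - 2 * trace (S ** F \<alpha> \<beta>)"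
    using E_anticommute[of \<beta> \<alpha>] by (cases "\<alpha> = \<beta>") (simp_all add: F_def matrix_mult_simps trace_simps)
  finally show ?thesis by (simp add: end_inner_def coframe_coeff_def card_n)
qed

lemma commutator_eq:
  assumes "S ** E \<beta> - E \<beta> ** S = (\<Sum>\<alpha>\<in>UNIV. p \<alpha> *\<^sub>R E \<alpha>)"
  shows "S ** E \<beta> - E \<beta> ** S = (\<Sum>\<alpha>\<in>UNIV. coframe_coeff S \<alpha> \<beta> *\<^sub>R E \<alpha>)"
proof -
  have "coframe_coeff S \<alpha> \<beta> = p \<alpha>" for \<alpha>
    unfolding end_inner_commutator[symmetric] assms end_inner_def
    by (simp add: matrix_mult_simps trace_simps trace_E_E card_n if_distrib cong: if_cong)
  then show ?thesis using assms by simp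
qed

text \<open>Let P be the double sum. Summing the conjugates of \<open>S\<close> over the frame gives
  T S = 9 S - P, the Fierz identity gives T S + 3 S = 2 P, and eliminating T S leaves 4 S =
  P.\<close>

lemma spin_element_eq:
  assumes S: "skew_adjoint G S" and comm: "\<And>\<beta>. \<exists>p. S ** E \<beta> - E \<beta> ** S = (\<Sum>\<alpha>\<in>UNIV. p \<alpha> *\<^sub>R E \<alpha>)"
  shows "S = (1 / 4) *\<^sub>R (\<Sum>\<alpha>\<in>UNIV. \<Sum>\<beta>\<in>UNIV. coframe_coeff S \<alpha> \<beta> *\<^sub>R F \<alpha> \<beta>)"
proof -
  let ?P = "\<Sum>\<alpha>\<in>UNIV. \<Sum>\<beta>\<in>UNIV. coframe_coeff S \<alpha> \<beta> *\<^sub>R F \<alpha> \<beta>"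
  have "E \<beta> ** S ** E \<beta> = S - (\<Sum>\<alpha>\<in>UNIV. coframe_coeff S \<alpha> \<beta> *\<^sub>R F \<alpha> \<beta>)" for \<beta>
  proof -
    obtain p where "S ** E \<beta> - E \<beta> ** S = (\<Sum>\<alpha>\<in>UNIV. p \<alpha> *\<^sub>R E \<alpha>)" using comm by blast
    from commutator_eq[OF this]
    have "S ** E \<beta> = E \<beta> ** S + (\<Sum>\<alpha>\<in>UNIV. coframe_coeff S \<alpha> \<beta> *\<^sub>R E \<alpha>)"
      by (simp add: algebra_simps)
    then have "E \<beta> ** (S ** E \<beta>) = S + (\<Sum>\<alpha>\<in>UNIV. coframe_coeff S \<alpha> \<beta> *\<^sub>R (E \<beta> ** E \<alpha>))"
      by (simp add: matrix_mult_simps E_square_mult)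
    also have "(\<Sum>\<alpha>\<in>UNIV. coframe_coeff S \<alpha> \<beta> *\<^sub>R (E \<beta> ** E \<alpha>)) = (\<Sum>\<alpha>\<in>UNIV. - (coframe_coeff S \<alpha> \<beta> *\<^sub>R F \<alpha> \<beta>))"
    proof (rule sum.cong)
      show "coframe_coeff S \<alpha> \<beta> *\<^sub>R (E \<beta> ** E \<alpha>) = - (coframe_coeff S \<alpha> \<beta> *\<^sub>R F \<alpha> \<beta>)" for \<alpha>
        using E_anticommute[of \<beta> \<alpha>]
        by (cases "\<alpha> = \<beta>") (auto simp: F_def coframe_coeff_def matrix_mult_simps trace_simps)
    qed simp
    finally show ?thesis by (simp add: sum_negf matrix_mul_assoc)
  qed
  then have "T S = 9 *\<^sub>R S - ?P"
    unfolding T_def by (subst sum.swap) (simp add: sum_subtractf sum_constant_scaleR del: sum_constant)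
  moreover have "T S + 3 *\<^sub>R S = 2 *\<^sub>R ?P"
    unfolding fierz[OF S] by (simp add: coframe_coeff_def scaleR_sum_right)
  ultimately have "4 *\<^sub>R S = ?P"
    by (simp add: vec_eq_iff)
  then show ?thesis by (simp flip: \<open>4 *\<^sub>R S = ?P\<close>)
qed

text \<open>The tensor is contracted with products M of three distinct E. The Bianchi identity makes
  the result symmetric, since M is trace-orthogonal to spin(9); pair symmetry makes it skew, since M
  is skew-adjoint. So it vanishes for every triple, which makes the product \<Psi> F independent of
  the pair of indices, and Schur's lemma turns this common value into a multiple of the
  metric.\<close>

theorem curvature_rigidity:
  fixes R :: "'n \<Rightarrow> 'n \<Rightarrow> real^'n^'n"
  assumes antisym: "\<And>i j. R j i = - R i j" and skew: "\<And>i j. skew_adjoint G (R i j)"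
    and bianchi: "\<And>i j k l. R i j $ k $ l + R j l $ k $ i + R l i $ k $ j = 0"
    and comm: "\<And>i j \<beta>. \<exists>p. R i j ** E \<beta> - E \<beta> ** R i j = (\<Sum>\<alpha>\<in>UNIV. p \<alpha> *\<^sub>R E \<alpha>)"
  obtains \<zeta> where "\<And>i j \<alpha> \<beta>. coframe_coeff (R i j) \<alpha> \<beta> = \<zeta> * (G ** F \<alpha> \<beta>) $ i $ j"
proof -
  define \<Psi> where "\<Psi> \<alpha> \<beta> = (\<chi> i j. coframe_coeff (R i j) \<alpha> \<beta>)" for \<alpha> \<beta>
  obtain H where H: "G ** H = mat 1" "H ** G = mat 1"
    using G(2) unfolding invertible_def by blast
  have Ht: "transpose H = H"
  proof -
    have "transpose H ** G = mat 1"
      using arg_cong[OF H(1), of transpose] by (simp add: matrix_transpose_mul G(1))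
    then have "transpose H ** (G ** H) = H" by (simp add: matrix_mul_assoc)
    then show ?thesis by (simp add: H)
  qed
  have R: "R i j $ k $ l = (1 / 4) * (\<Sum>\<alpha>\<in>UNIV. \<Sum>\<beta>\<in>UNIV. \<Psi> \<alpha> \<beta> $ i $ j * F \<alpha> \<beta> $ k $ l)" for i j k l
    using arg_cong[OF spin_element_eq[OF skew comm], of "\<lambda>M. M $ k $ l" i j]
    by (simp add: \<Psi>_def sum_component)
  have \<Psi>_antisym: "\<Psi> \<beta> \<alpha> = - \<Psi> \<alpha> \<beta>" for \<alpha> \<beta>
    by (simp add: \<Psi>_def vec_eq_iff coframe_coeff_def F_antisym[of \<alpha> \<beta>] matrix_mult_simps trace_simps)
  have \<Psi>_diag: "\<Psi> \<alpha> \<alpha> = 0" for \<alpha>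
    using \<Psi>_antisym[of \<alpha> \<alpha>] by (simp add: vec_eq_iff)
  have \<Psi>_skew: "transpose (\<Psi> \<alpha> \<beta>) = - \<Psi> \<alpha> \<beta>" for \<alpha> \<beta>
    unfolding \<Psi>_def transpose_def vec_eq_iff coframe_coeff_def
    by (subst antisym) (simp add: matrix_mult_simps trace_simps)
  define L where "L \<alpha> \<beta> = G ** F \<alpha> \<beta>" for \<alpha> \<beta>
  have F_L: "F \<alpha> \<beta> = H ** L \<alpha> \<beta>" for \<alpha> \<beta>
    by (simp add: L_def matrix_mul_assoc H)
  have L_skew: "transpose (L \<alpha> \<beta>) = - L \<alpha> \<beta>" for \<alpha> \<beta>
    using skew_adjoint_F[of \<alpha> \<beta>] by (simp add: L_def skew_adjoint_def matrix_transpose_mul G(1))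
  have pair: "(\<Sum>\<alpha>\<in>UNIV. \<Sum>\<beta>\<in>UNIV. \<Psi> \<alpha> \<beta> $ i $ j * L \<alpha> \<beta> $ k $ l) = (\<Sum>\<alpha>\<in>UNIV. \<Sum>\<beta>\<in>UNIV. \<Psi> \<alpha> \<beta> $ k $ l * L \<alpha> \<beta> $ i $ j)" for i j k l
  proof -
    let ?r = "\<lambda>i j k l. (G ** R i j) $ k $ l"
    have "?r i j k l = ?r k l i j"
    proof (rule curvature_pair_symmetry[of ?r])
      show "?r j i k l = - ?r i j k l" for i j k l
        by (subst antisym) (simp add: matrix_mult_simps)
      show "?r i j l k = - ?r i j k l" for i j k l
      proof -
        have "transpose (G ** R i j) = - (G ** R i j)"
          using skew[of i j] by (simp add: skew_adjoint_def matrix_transpose_mul G(1))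
        then have "transpose (G ** R i j) $ k $ l = - ?r i j k l" by simp
        then show ?thesis by (simp add: transpose_def)
      qed
      show "?r i j k l + ?r j l k i + ?r l i k j = 0" for i j k l
      proof -
        have "?r i j k l + ?r j l k i + ?r l i k j = (\<Sum>m\<in>UNIV. G $ k $ m * (R i j $ m $ l + R j l $ m $ i + R l i $ m $ j))"
          by (simp add: matrix_matrix_mult_def distrib_left sum.distrib)
        then show ?thesis by (simp add: bianchi)
      qed
    qed
    moreover have "?r i j k l = (1 / 4) * (\<Sum>\<alpha>\<in>UNIV. \<Sum>\<beta>\<in>UNIV. \<Psi> \<alpha> \<beta> $ i $ j * L \<alpha> \<beta> $ k $ l)" for i j k l
    proof -
      have "R i j = (1 / 4) *\<^sub>R (\<Sum>\<alpha>\<in>UNIV. \<Sum>\<beta>\<in>UNIV. \<Psi> \<alpha> \<beta> $ i $ j *\<^sub>R F \<alpha> \<beta>)"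
        by (simp add: vec_eq_iff R sum_component)
      then show ?thesis by (simp add: matrix_mult_simps L_def sum_component)
    qed
    ultimately show ?thesis by simp
  qed
  \<comment> \<open>\<open>Q M\<close> is four times the contraction of R with M over one form index
    and the row index of the endomorphism.\<close>
  define Q where "Q M = (\<Sum>\<alpha>\<in>UNIV. \<Sum>\<beta>\<in>UNIV. \<Psi> \<alpha> \<beta> ** M ** F \<alpha> \<beta>)" for M
  have Q_nth: "Q M $ i $ j = (\<Sum>\<alpha>\<in>UNIV. \<Sum>\<beta>\<in>UNIV. \<Sum>l\<in>UNIV. \<Sum>k\<in>UNIV. \<Psi> \<alpha> \<beta> $ i $ l * M $ l $ k * F \<alpha> \<beta> $ k $ j)" for M i j
  proof -
    have "(A ** M ** B) $ i $ j = (\<Sum>l\<in>UNIV. \<Sum>k\<in>UNIV. A $ i $ l * M $ l $ k * B $ k $ j)" for A B :: "real^'n^'n"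
      by (simp add: matrix_matrix_mult_def sum_distrib_right) (rule sum.swap)
    then show ?thesis by (simp add: Q_def sum_component)
  qed
  \<comment> \<open>The first term of the contracted Bianchi identity is a combination of traces of
    F M and vanishes; the other two are a quarter of an entry of \<open>Q M\<close> and of its
    transpose.\<close>
  have contracted: "Q M $ i $ j = Q M $ j $ i" if M: "\<And>\<alpha> \<beta>. trace (F \<alpha> \<beta> ** M) = 0" for M i j
  proof -
    have swap4: "(\<Sum>k\<in>UNIV. \<Sum>l\<in>UNIV. \<Sum>\<alpha>\<in>(UNIV :: 9 set). \<Sum>\<beta>\<in>(UNIV :: 9 set). f k l \<alpha> \<beta>)
        = (\<Sum>\<alpha>\<in>UNIV. \<Sum>\<beta>\<in>UNIV. \<Sum>l\<in>UNIV. \<Sum>k\<in>UNIV. f k l \<alpha> \<beta>)" for f :: "'n \<Rightarrow> 'n \<Rightarrow> 9 \<Rightarrow> 9 \<Rightarrow> real"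
      by (subst sum.swap) (rule sum_swap4)
    have 1: "(\<Sum>k\<in>UNIV. \<Sum>l\<in>UNIV. M $ l $ k * R i j $ k $ l) = 0"
    proof -
      have "(\<Sum>k\<in>UNIV. \<Sum>l\<in>UNIV. M $ l $ k * R i j $ k $ l)
          = (1 / 4) * (\<Sum>\<alpha>\<in>UNIV. \<Sum>\<beta>\<in>UNIV. \<Sum>l\<in>UNIV. \<Sum>k\<in>UNIV. \<Psi> \<alpha> \<beta> $ i $ j * (F \<alpha> \<beta> $ k $ l * M $ l $ k))"
        by (simp add: R sum_distrib_left swap4 mult_ac)
      also have "\<dots> = (1 / 4) * (\<Sum>\<alpha>\<in>UNIV. \<Sum>\<beta>\<in>UNIV. \<Psi> \<alpha> \<beta> $ i $ j * trace (F \<alpha> \<beta> ** M))"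
        unfolding trace_def matrix_matrix_mult_def vec_lambda_beta sum_distrib_left
        by (intro arg_cong[where f = "(*) _"] sum.cong refl sum.swap)
      finally show ?thesis by (simp add: M)
    qed
    have 2: "(\<Sum>k\<in>UNIV. \<Sum>l\<in>UNIV. M $ l $ k * R a l $ k $ b) = (1 / 4) * Q M $ a $ b" for a b
      by (simp add: R Q_nth sum_distrib_left swap4 mult_ac)
    have "0 = (\<Sum>k\<in>UNIV. \<Sum>l\<in>UNIV. M $ l $ k * (R i j $ k $ l + R j l $ k $ i - R i l $ k $ j))"
    proof -
      have "R l i $ k $ j = - R i l $ k $ j" for k l by (subst antisym) simp
      then have "R i j $ k $ l + R j l $ k $ i - R i l $ k $ j = 0" for k l
        using bianchi[of i j k l] by simp
      then show ?thesis by simp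
    qed
    also have "\<dots> = (1 / 4) * Q M $ j $ i - (1 / 4) * Q M $ i $ j"
      by (simp add: distrib_left right_diff_distrib sum.distrib sum_subtractf 1 2)
    finally show ?thesis by simp
  qed
  have pairN: "(\<Sum>\<alpha>\<in>UNIV. \<Sum>\<beta>\<in>UNIV. L \<alpha> \<beta> ** N ** \<Psi> \<alpha> \<beta>) = (\<Sum>\<alpha>\<in>UNIV. \<Sum>\<beta>\<in>UNIV. \<Psi> \<alpha> \<beta> ** N ** L \<alpha> \<beta>)" for N
  proof -
    have entry: "(\<Sum>\<alpha>\<in>UNIV. \<Sum>\<beta>\<in>UNIV. A \<alpha> \<beta> ** N ** B \<alpha> \<beta>) $ i $ j
        = (\<Sum>l\<in>UNIV. \<Sum>k\<in>UNIV. N $ l $ k * (\<Sum>\<alpha>\<in>UNIV. \<Sum>\<beta>\<in>UNIV. A \<alpha> \<beta> $ i $ l * B \<alpha> \<beta> $ k $ j))"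
      for A B :: "9 \<Rightarrow> 9 \<Rightarrow> real^'n^'n" and i j
    proof -
      have "(A \<alpha> \<beta> ** N ** B \<alpha> \<beta>) $ i $ j = (\<Sum>l\<in>UNIV. \<Sum>k\<in>UNIV. N $ l $ k * (A \<alpha> \<beta> $ i $ l * B \<alpha> \<beta> $ k $ j))" for \<alpha> \<beta>
        by (simp add: matrix_matrix_mult_def sum_distrib_right sum_distrib_left mult_ac) (rule sum.swap)
      then show ?thesis
        unfolding sum_distrib_left by (simp add: sum_component) (rule sum_swap4)
    qed
    show ?thesis
      unfolding vec_eq_iff
    proof (intro allI)
      fix i j
      have eq: "(\<Sum>\<alpha>\<in>UNIV. \<Sum>\<beta>\<in>UNIV. L \<alpha> \<beta> $ i $ l * \<Psi> \<alpha> \<beta> $ k $ j) = (\<Sum>\<alpha>\<in>UNIV. \<Sum>\<beta>\<in>UNIV. \<Psi> \<alpha> \<beta> $ i $ l * L \<alpha> \<beta> $ k $ j)" for l k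
        using pair[of k j i l] by (simp add: mult.commute)
      show "(\<Sum>\<alpha>\<in>UNIV. \<Sum>\<beta>\<in>UNIV. L \<alpha> \<beta> ** N ** \<Psi> \<alpha> \<beta>) $ i $ j = (\<Sum>\<alpha>\<in>UNIV. \<Sum>\<beta>\<in>UNIV. \<Psi> \<alpha> \<beta> ** N ** L \<alpha> \<beta>) $ i $ j"
        unfolding entry eq ..
    qed
  qed
  \<comment> \<open>Passing to N = M H gives a matrix that is skew in the ordinary sense.
    Transposing a summand then exchanges \<Psi> and L, and \<open>pairN\<close> exchanges them
    back.\<close>
  have Q_skew: "transpose (Q M) = - Q M" if M: "skew_adjoint G M" for M
  proof -
    define N where "N = M ** H"
    have "H ** (transpose M ** G) ** H = - (H ** (G ** M) ** H)"
      using M by (simp add: skew_adjoint_def matrix_mult_simps)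
    then have "H ** transpose M = - N"
      by (simp add: matrix_mul_assoc[symmetric] H N_def) (simp add: matrix_mul_assoc H)
    then have N: "transpose N = - N" by (simp add: N_def matrix_transpose_mul Ht)
    have QN: "Q M = (\<Sum>\<alpha>\<in>UNIV. \<Sum>\<beta>\<in>UNIV. \<Psi> \<alpha> \<beta> ** N ** L \<alpha> \<beta>)"
      by (simp add: Q_def F_L N_def matrix_mul_assoc)
    have "transpose (\<Psi> \<alpha> \<beta> ** N ** L \<alpha> \<beta>) = - (L \<alpha> \<beta> ** N ** \<Psi> \<alpha> \<beta>)" for \<alpha> \<beta>
      by (simp add: matrix_transpose_mul N \<Psi>_skew L_skew matrix_mult_simps matrix_mul_assoc)
    moreover have "transpose (sum f S) = (\<Sum>s\<in>S. transpose (f s))" for f :: "9 \<Rightarrow> real^'n^'n" and S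
      by (induction S rule: infinite_finite_induct) (simp_all add: transpose_simps)
    ultimately have "transpose (Q M) = - (\<Sum>\<alpha>\<in>UNIV. \<Sum>\<beta>\<in>UNIV. L \<alpha> \<beta> ** N ** \<Psi> \<alpha> \<beta>)"
      unfolding QN by (simp add: sum_negf)
    then show ?thesis by (simp add: pairN QN)
  qed
  have vanish: "(\<Sum>\<alpha>\<in>UNIV. \<Sum>\<beta>\<in>UNIV. ((if \<alpha> \<in> {\<kappa>, \<mu>, \<nu>} then 1 else - 1) * (if \<beta> \<in> {\<kappa>, \<mu>, \<nu>} then 1 else - 1)) *\<^sub>R (\<Psi> \<alpha> \<beta> ** F \<alpha> \<beta>)) = 0"
    if ne: "\<kappa> \<noteq> \<mu>" "\<kappa> \<noteq> \<nu>" "\<mu> \<noteq> \<nu>" for \<kappa> \<mu> \<nu>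
  proof -
    let ?xs = "[\<kappa>, \<mu>, \<nu>]"
    \<comment> \<open>The sign picked up when E passes the three factors of \<open>M\<close>: +1 for
      one of their own indices and -1 for any other.\<close>
    define s :: "9 \<Rightarrow> real" where "s \<alpha> = (if \<alpha> \<in> {\<kappa>, \<mu>, \<nu>} then 1 else - 1)" for \<alpha>
    define M where "M = cprod ?xs"
    have EM: "E \<beta> ** M = s \<beta> *\<^sub>R (M ** E \<beta>)" for \<beta>
      using cprod_commute[of \<beta> ?xs] ne unfolding M_def s_def by (auto simp del: cprod.simps)
    have MF: "M ** F \<alpha> \<beta> = (s \<alpha> * s \<beta>) *\<^sub>R (F \<alpha> \<beta> ** M)" for \<alpha> \<beta>
    proof (cases "\<alpha> = \<beta>")
      case False
      have "E \<alpha> ** (E \<beta> ** M) = (s \<alpha> * s \<beta>) *\<^sub>R (M ** (E \<alpha> ** E \<beta>))"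
        by (simp only: EM matrix_mult_scaleR_right matrix_mul_assoc matrix_mult_scaleR_left scaleR_scaleR mult.commute)
      moreover have "(s \<alpha> * s \<beta>) * (s \<alpha> * s \<beta>) = 1" by (simp add: s_def)
      ultimately have "(s \<alpha> * s \<beta>) *\<^sub>R (E \<alpha> ** (E \<beta> ** M)) = M ** (E \<alpha> ** E \<beta>)"
        by (simp only: scaleR_scaleR scaleR_one)
      then show ?thesis using False by (simp only: F_def if_False matrix_mul_assoc)
    qed (simp add: matrix_mult_simps)
    have "skew_adjoint G M"
      using cprod_adjoint[of ?xs] cprod_rev_sign[of ?xs] ne
      unfolding skew_adjoint_def M_def by (simp add: matrix_mult_simps del: cprod.simps)
    then have 1: "transpose (Q M) = - Q M" by (rule Q_skew)
    have "trace (F \<alpha> \<beta> ** M) = 0" for \<alpha> \<beta>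
    proof -
      obtain \<epsilon> where \<epsilon>: "\<epsilon> \<notin> set [\<alpha>, \<beta>, \<kappa>, \<mu>, \<nu>]"
        using ex_not_in_9[OF le_less_trans[OF card_length[of "[\<alpha>, \<beta>, \<kappa>, \<mu>, \<nu>]"]]] by auto
      then have "E \<epsilon> ** M ** E \<epsilon> = - M"
        by (simp add: EM s_def matrix_mult_simps E_square_mult)
      then have "E \<epsilon> ** (F \<alpha> \<beta> ** M) ** E \<epsilon> = - (F \<alpha> \<beta> ** M)"
        using \<epsilon> by (simp add: conj_mult F_conj matrix_mult_simps)
      then show ?thesis by (rule trace_conj_zero)
    qed
    then have "Q M $ i $ j = Q M $ j $ i" for i j by (rule contracted)
    moreover have "Q M $ j $ i = - Q M $ i $ j" for i j
      using arg_cong[OF 1, of "\<lambda>X. X $ i $ j"] by (simp add: transpose_def)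
    ultimately have "Q M $ i $ j = 0" for i j by (metis equal_neg_zero)
    then have "Q M = 0" by (simp add: vec_eq_iff)
    moreover have "Q M = (\<Sum>\<alpha>\<in>UNIV. \<Sum>\<beta>\<in>UNIV. (s \<alpha> * s \<beta>) *\<^sub>R (\<Psi> \<alpha> \<beta> ** F \<alpha> \<beta>)) ** M"
      unfolding Q_def matrix_mult_sum_left
    proof (intro sum.cong refl)
      fix \<alpha> \<beta>
      have "\<Psi> \<alpha> \<beta> ** M ** F \<alpha> \<beta> = \<Psi> \<alpha> \<beta> ** (M ** F \<alpha> \<beta>)" by (simp only: matrix_mul_assoc)
      also have "\<dots> = (s \<alpha> * s \<beta>) *\<^sub>R (\<Psi> \<alpha> \<beta> ** F \<alpha> \<beta>) ** M"
        unfolding MF by (simp only: matrix_mult_scaleR_right matrix_mult_scaleR_left matrix_mul_assoc)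
      finally show "\<Psi> \<alpha> \<beta> ** M ** F \<alpha> \<beta> = (s \<alpha> * s \<beta>) *\<^sub>R (\<Psi> \<alpha> \<beta> ** F \<alpha> \<beta>) ** M" .
    qed
    moreover have "X = 0" if "X ** M = 0" for X
    proof -
      have "X ** (M ** cprod (rev ?xs)) = 0"
        using that by (simp only: matrix_mul_assoc matrix_mult_zero_left)
      then show ?thesis using cprod_rev[of "rev ?xs"] by (simp add: M_def del: cprod.simps)
    qed
    ultimately show ?thesis unfolding s_def by simp
  qed
  define Y where "Y = \<Psi> 0 1 ** F 0 1"
  have Y: "\<Psi> \<alpha> \<beta> ** F \<alpha> \<beta> = Y" if "\<alpha> \<noteq> \<beta>" for \<alpha> \<beta>
    unfolding vec_eq_iff
  proof (intro allI)
    fix a b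
    show "(\<Psi> \<alpha> \<beta> ** F \<alpha> \<beta>) $ a $ b = Y $ a $ b"
      unfolding Y_def
    proof (rule constant_off_diagonal[of "\<lambda>\<alpha> \<beta>. (\<Psi> \<alpha> \<beta> ** F \<alpha> \<beta>) $ a $ b"])
      show "(\<Psi> \<alpha> \<beta> ** F \<alpha> \<beta>) $ a $ b = (\<Psi> \<beta> \<alpha> ** F \<beta> \<alpha>) $ a $ b" for \<alpha> \<beta>
        using \<Psi>_antisym[of \<alpha> \<beta>] F_antisym[of \<alpha> \<beta>] by (simp add: matrix_mult_simps)
      show "(\<Sum>\<alpha>\<in>UNIV. \<Sum>\<beta>\<in>UNIV. (if \<alpha> \<in> {\<kappa>, \<mu>, \<nu>} then 1 else - 1) * (if \<beta> \<in> {\<kappa>, \<mu>, \<nu>} then 1 else - 1) * (\<Psi> \<alpha> \<beta> ** F \<alpha> \<beta>) $ a $ b) = 0"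
        if "\<kappa> \<noteq> \<mu>" "\<kappa> \<noteq> \<nu>" "\<mu> \<noteq> \<nu>" for \<kappa> \<mu> \<nu>
        using arg_cong[OF vanish[OF that], of "\<lambda>X. X $ a $ b"] by (simp add: sum_component)
    qed (use that in \<open>simp_all add: matrix_mult_simps\<close>)
  qed
  have \<Psi>: "\<Psi> \<alpha> \<beta> = - (Y ** F \<alpha> \<beta>)" for \<alpha> \<beta>
  proof (cases "\<alpha> = \<beta>")
    case False
    then have "Y ** F \<alpha> \<beta> = \<Psi> \<alpha> \<beta> ** (F \<alpha> \<beta> ** F \<alpha> \<beta>)"
      using Y by (simp add: matrix_mul_assoc)
    then show ?thesis using False by (simp add: F_square matrix_mult_simps)
  qed (simp add: \<Psi>_diag matrix_mult_simps)
  have Y_sym: "transpose Y = Y"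
  proof -
    have "trace (F \<alpha> \<beta> ** mat 1) = 0" for \<alpha> \<beta>
      using trace_conj_zero[of \<alpha> "F \<alpha> \<beta>"] by (simp add: F_conj)
    then have "Q (mat 1) $ i $ j = Q (mat 1) $ j $ i" for i j by (rule contracted)
    \<comment> \<open>The factor 72 = 9 * 8 counts the ordered pairs of distinct indices.\<close>
    moreover have "Q (mat 1) $ i $ j = 72 * Y $ i $ j" for i j
    proof -
      have "(\<Psi> \<alpha> \<beta> ** F \<alpha> \<beta>) $ i $ j = Y $ i $ j - (if \<beta> = \<alpha> then Y $ i $ j else 0)" for \<alpha> \<beta>
        using Y[of \<alpha> \<beta>] by (cases "\<alpha> = \<beta>") (auto simp: matrix_mult_simps)
      then have "Q (mat 1) $ i $ j = (\<Sum>\<alpha>\<in>(UNIV :: 9 set). \<Sum>\<beta>\<in>(UNIV :: 9 set). Y $ i $ j - (if \<beta> = \<alpha> then Y $ i $ j else 0))"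
        by (simp only: Q_def sum_component matrix_mul_rid)
      then show ?thesis by (simp add: sum_subtractf)
    qed
    ultimately show ?thesis by (simp add: vec_eq_iff transpose_def)
  qed
  \<comment> \<open>\<open>Z\<close> is the endomorphism belonging to the bilinear form
    \<open>Y\<close>; skewness of \<Psi> = - Y F says precisely that it commutes with F.\<close>
  define Z where "Z = H ** Y"
  have GZ: "G ** Z = Y" by (simp add: Z_def matrix_mul_assoc H)
  have "F \<alpha> \<beta> ** Z = Z ** F \<alpha> \<beta>" for \<alpha> \<beta>
  proof -
    have "transpose (F \<alpha> \<beta>) ** (G ** H) = - (G ** F \<alpha> \<beta>) ** H"
      using skew_adjoint_F[of \<alpha> \<beta>] by (simp add: skew_adjoint_def matrix_mul_assoc)
    then have Ft: "transpose (F \<alpha> \<beta>) = - (G ** F \<alpha> \<beta> ** H)" by (simp add: H matrix_mult_simps)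
    have "- (transpose (F \<alpha> \<beta>) ** Y) = Y ** F \<alpha> \<beta>"
      using \<Psi>_skew[of \<alpha> \<beta>] unfolding \<Psi> by (simp add: transpose_simps matrix_transpose_mul Y_sym)
    then have "G ** F \<alpha> \<beta> ** H ** Y = Y ** F \<alpha> \<beta>"
      by (simp add: Ft matrix_mult_simps)
    then have "H ** (G ** F \<alpha> \<beta> ** H ** Y) = H ** (Y ** F \<alpha> \<beta>)" by simp
    then have "(H ** G) ** F \<alpha> \<beta> ** Z = Z ** F \<alpha> \<beta>"
      by (simp only: Z_def matrix_mul_assoc)
    then show ?thesis by (simp add: H)
  qed
  then obtain z where z: "Z = z *\<^sub>R mat 1" using schur by blast
  have eq: "\<Psi> \<alpha> \<beta> = (- z) *\<^sub>R (G ** F \<alpha> \<beta>)" for \<alpha> \<beta>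
    unfolding \<Psi> GZ[symmetric] z by (simp add: matrix_mult_simps)
  have "coframe_coeff (R i j) \<alpha> \<beta> = \<Psi> \<alpha> \<beta> $ i $ j" for i j \<alpha> \<beta>
    by (simp add: \<Psi>_def)
  then have "coframe_coeff (R i j) \<alpha> \<beta> = - z * (G ** F \<alpha> \<beta>) $ i $ j" for i j \<alpha> \<beta>
    by (simp add: eq)
  then show thesis by (rule that)
qed

end

section \<open>Trace identities from the representations of F4\<close>

lemma sum_option: "(\<Sum>p\<in>UNIV. f p) = f None + (\<Sum>\<alpha>\<in>UNIV. f (Some \<alpha>))"
  for f :: "'b::finite option \<Rightarrow> 'a::comm_monoid_add"
  by (simp add: UNIV_option_conv sum.reindex)

lemma sum_pair: "(\<Sum>p\<in>UNIV. f p) = (\<Sum>\<alpha>\<in>UNIV. \<Sum>\<beta>\<in>UNIV. f (\<alpha>, \<beta>))"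
  for f :: "'b::finite \<times> 'c::finite \<Rightarrow> 'a::comm_monoid_add"
  by (simp add: sum.cartesian_product)

text \<open>This replaces the cyclic invariance of the trace: an odd matrix squares to a matrix whose
  powers are commutators.\<close>

lemma trace_mpow_odd:
  fixes A :: "('n::{finite,linorder}) ext^'b^'a" and B :: "'n ext^'a^'b"
  assumes A: "mhomog 1 A" and B: "mhomog 1 B"
  shows "trace (mpow (A ** B) (Suc k)) = - trace (mpow (B ** A) (Suc k))"
proof -
  have "mpow (A ** B) (Suc k) = A ** (mpow (B ** A) k ** B)"
    by (induction k) (simp_all add: matrix_mul_assoc)
  moreover have "mhomog (k * 2 + 1) (mpow (B ** A) k ** B)"
    using mhomog_mult[OF mhomog_mpow[OF mhomog_mult[OF B A], of k] B] by (simp add: numeral_2_eq_2)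
  ultimately have "trace (mpow (A ** B) (Suc k)) = - trace (mpow (B ** A) k ** B ** A)"
    using trace_homog_commute[OF A] by (simp add: power_add)
  then show ?thesis by (simp add: mpow_Suc_right matrix_mul_assoc del: mpow.simps)
qed

text \<open>The step of the binomial theorem for a sum of two commuting operators, of which one
  raises the first index of \<open>f\<close> and the other the second.\<close>

lemma binomial_pascal_sum:
  fixes f :: "nat \<Rightarrow> nat \<Rightarrow> 'a::comm_ring_1"
  shows "(\<Sum>j\<le>k. of_nat (k choose j) * (f (Suc j) (k - j) + f j (Suc (k - j))))
    = (\<Sum>j\<le>Suc k. of_nat (Suc k choose j) * f j (Suc k - j))"
proof -
  let ?g = "\<lambda>j. of_nat (k choose j) * f j (Suc k - j)"
  have "(\<Sum>j\<le>Suc k. of_nat (Suc k choose j) * f j (Suc k - j))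
      = f 0 (Suc k) + (\<Sum>j\<le>k. of_nat (Suc k choose Suc j) * f (Suc j) (k - j))"
    by (subst sum.atMost_Suc_shift) simp
  also have "(\<Sum>j\<le>k. of_nat (Suc k choose Suc j) * f (Suc j) (k - j))
      = (\<Sum>j\<le>k. of_nat (k choose j) * f (Suc j) (k - j)) + (\<Sum>j\<le>k. ?g (Suc j))"
    by (simp add: sum.distrib distrib_right)
  also have "f 0 (Suc k) + ((\<Sum>j\<le>k. of_nat (k choose j) * f (Suc j) (k - j)) + (\<Sum>j\<le>k. ?g (Suc j)))
      = (\<Sum>j\<le>k. of_nat (k choose j) * f (Suc j) (k - j)) + (\<Sum>j\<le>Suc k. ?g j)"
    by (subst sum.atMost_Suc_shift[of ?g]) (simp add: add_ac binomial_eq_0)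
  also have "(\<Sum>j\<le>Suc k. ?g j) = (\<Sum>j\<le>k. of_nat (k choose j) * f j (Suc (k - j)))"
    by (simp add: Suc_diff_le binomial_eq_0)
  finally show ?thesis by (simp add: sum.distrib distrib_left)
qed

text \<open>\<open>adjoint_matrix \<phi>\<close> is, up to a factor, the action of \<open>\<phi> \<in> so(r)\<close> on the tensors of degree 2,
  composed with antisymmetrisation.\<close>

definition adjoint_matrix :: "'a::comm_ring_1^'r^'r \<Rightarrow> 'a^('r \<times> 'r)^('r \<times> 'r)" where
  "adjoint_matrix \<phi> = (\<chi> p q. (if snd p = fst q then \<phi> $ fst p $ snd q else 0) - (if fst p = fst q then \<phi> $ snd p $ snd q else 0)
     + (if snd p = snd q then \<phi> $ fst q $ fst p else 0) - (if fst p = snd q then \<phi> $ fst q $ snd p else 0))"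

text \<open>\<open>X k\<close> holds the entries of the k-th power of L, the action of \<phi> on
  both tensor factors, and \<open>adjoint_matrix\<close> is - L composed with 1 - swap. These two
  commute, and (1 - swap)^2 = 2 (1 - swap); hence the factor (-1)^(k+1) 2^k.\<close>

lemma mpow_adjoint_matrix:
  fixes \<phi> :: "'a::comm_ring_1^'r^'r"
  assumes skew: "\<And>\<alpha> \<beta>. \<phi> $ \<beta> $ \<alpha> = - \<phi> $ \<alpha> $ \<beta>"
  defines "X \<equiv> \<lambda>k \<alpha> \<beta> \<mu> \<nu>. \<Sum>j\<le>k. of_nat (k choose j) * (mpow \<phi> j $ \<alpha> $ \<mu> * mpow \<phi> (k - j) $ \<beta> $ \<nu>)"
  shows "mpow (adjoint_matrix \<phi>) (Suc k) $ (\<alpha>, \<beta>) $ (\<mu>, \<nu>) = (- 1) ^ Suc k * 2 ^ k * (X (Suc k) \<alpha> \<beta> \<mu> \<nu> - X (Suc k) \<alpha> \<beta> \<nu> \<mu>)"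
proof -
  have X_swap: "X k \<beta> \<alpha> \<mu> \<nu> = X k \<alpha> \<beta> \<nu> \<mu>" for k \<alpha> \<beta> \<mu> \<nu>
    unfolding X_def by (rule sum.reindex_bij_witness[where i = "\<lambda>j. k - j" and j = "\<lambda>j. k - j"])
      (auto simp: binomial_symmetric[symmetric] mult.commute)
  have X_Suc: "(\<Sum>\<gamma>\<in>UNIV. \<phi> $ \<alpha> $ \<gamma> * X k \<gamma> \<beta> \<mu> \<nu>) + (\<Sum>\<gamma>\<in>UNIV. \<phi> $ \<beta> $ \<gamma> * X k \<alpha> \<gamma> \<mu> \<nu>) = X (Suc k) \<alpha> \<beta> \<mu> \<nu>"
    for k \<alpha> \<beta> \<mu> \<nu>
  proof -
    have "(\<Sum>\<gamma>\<in>UNIV. \<phi> $ \<alpha> $ \<gamma> * X k \<gamma> \<beta> \<mu> \<nu>) = (\<Sum>j\<le>k. of_nat (k choose j) * (mpow \<phi> (Suc j) $ \<alpha> $ \<mu> * mpow \<phi> (k - j) $ \<beta> $ \<nu>))"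
      unfolding X_def sum_distrib_left
      by (subst sum.swap) (simp add: matrix_matrix_mult_def sum_distrib_left sum_distrib_right mult_ac)
    moreover have "(\<Sum>\<gamma>\<in>UNIV. \<phi> $ \<beta> $ \<gamma> * X k \<alpha> \<gamma> \<mu> \<nu>) = (\<Sum>j\<le>k. of_nat (k choose j) * (mpow \<phi> j $ \<alpha> $ \<mu> * mpow \<phi> (Suc (k - j)) $ \<beta> $ \<nu>))"
      unfolding X_def sum_distrib_left
      by (subst sum.swap) (simp add: matrix_matrix_mult_def sum_distrib_left sum_distrib_right mult_ac)
    ultimately show ?thesis
      using binomial_pascal_sum[of k "\<lambda>i j. mpow \<phi> i $ \<alpha> $ \<mu> * mpow \<phi> j $ \<beta> $ \<nu>"]
      by (simp add: X_def sum.distrib distrib_left del: mpow.simps)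
  qed
  have row: "(\<Sum>q\<in>UNIV. adjoint_matrix \<phi> $ (\<alpha>, \<beta>) $ q * Y (fst q) (snd q))
      = (\<Sum>\<gamma>\<in>UNIV. \<phi> $ \<alpha> $ \<gamma> * (Y \<beta> \<gamma> - Y \<gamma> \<beta>)) + (\<Sum>\<gamma>\<in>UNIV. \<phi> $ \<beta> $ \<gamma> * (Y \<gamma> \<alpha> - Y \<alpha> \<gamma>))" for Y \<alpha> \<beta>
  proof -
    have "(\<Sum>q\<in>UNIV. adjoint_matrix \<phi> $ (\<alpha>, \<beta>) $ q * Y (fst q) (snd q))
      = (\<Sum>\<gamma>\<in>UNIV. \<Sum>\<delta>\<in>UNIV. (if \<beta> = \<gamma> then \<phi> $ \<alpha> $ \<delta> * Y \<gamma> \<delta> else 0) - (if \<alpha> = \<gamma> then \<phi> $ \<beta> $ \<delta> * Y \<gamma> \<delta> else 0)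
        + (if \<beta> = \<delta> then \<phi> $ \<gamma> $ \<alpha> * Y \<gamma> \<delta> else 0) - (if \<alpha> = \<delta> then \<phi> $ \<gamma> $ \<beta> * Y \<gamma> \<delta> else 0))"
      unfolding sum_pair adjoint_matrix_def by (intro sum.cong refl) (auto simp: algebra_simps)
    also have "\<dots> = (\<Sum>\<delta>\<in>UNIV. \<phi> $ \<alpha> $ \<delta> * Y \<beta> \<delta>) - (\<Sum>\<delta>\<in>UNIV. \<phi> $ \<beta> $ \<delta> * Y \<alpha> \<delta>)
        + (\<Sum>\<gamma>\<in>UNIV. \<phi> $ \<gamma> $ \<alpha> * Y \<gamma> \<beta>) - (\<Sum>\<gamma>\<in>UNIV. \<phi> $ \<gamma> $ \<beta> * Y \<gamma> \<alpha>)"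
    proof -
      have "(\<Sum>\<gamma>\<in>UNIV. \<Sum>\<delta>\<in>UNIV. if \<beta> = \<gamma> then f \<gamma> \<delta> else 0) = (\<Sum>\<delta>\<in>UNIV. f \<beta> \<delta>)" for f :: "'r \<Rightarrow> 'r \<Rightarrow> 'a" and \<beta>
        by (subst sum.swap) simp
      then show ?thesis by (simp add: sum.distrib sum_subtractf)
    qed
    also have "\<dots> = (\<Sum>\<gamma>\<in>UNIV. \<phi> $ \<alpha> $ \<gamma> * (Y \<beta> \<gamma> - Y \<gamma> \<beta>)) + (\<Sum>\<gamma>\<in>UNIV. \<phi> $ \<beta> $ \<gamma> * (Y \<gamma> \<alpha> - Y \<alpha> \<gamma>))"
      by (simp add: skew[of _ \<alpha>] skew[of _ \<beta>] right_diff_distrib sum_subtractf sum_negf)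
    finally show ?thesis .
  qed
  show ?thesis
  proof (induction k arbitrary: \<alpha> \<beta> \<mu> \<nu>)
    case 0
    have "adjoint_matrix \<phi> $ (\<alpha>, \<beta>) $ (\<mu>, \<nu>) = - (X (Suc 0) \<alpha> \<beta> \<mu> \<nu> - X (Suc 0) \<alpha> \<beta> \<nu> \<mu>)"
    proof -
      have "X (Suc 0) \<alpha> \<beta> \<mu> \<nu> = mat 1 $ \<alpha> $ \<mu> * \<phi> $ \<beta> $ \<nu> + \<phi> $ \<alpha> $ \<mu> * mat 1 $ \<beta> $ \<nu>" for \<mu> \<nu>
        by (simp add: X_def)
      then show ?thesis
        using skew[of \<mu> \<alpha>] skew[of \<mu> \<beta>] by (auto simp: adjoint_matrix_def mat_def)
    qed
    then show ?case by simp
  next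
    case (Suc k)
    let ?c = "(- 1) ^ Suc k * 2 ^ k :: 'a"
    define Y where "Y \<gamma> \<delta> = X (Suc k) \<gamma> \<delta> \<mu> \<nu> - X (Suc k) \<gamma> \<delta> \<nu> \<mu>" for \<gamma> \<delta>
    have Y: "Y \<delta> \<gamma> = - Y \<gamma> \<delta>" for \<gamma> \<delta>
      using X_swap[of "Suc k"] by (simp add: Y_def)
    have "mpow (adjoint_matrix \<phi>) (Suc (Suc k)) $ (\<alpha>, \<beta>) $ (\<mu>, \<nu>)
        = (\<Sum>q\<in>UNIV. adjoint_matrix \<phi> $ (\<alpha>, \<beta>) $ q * mpow (adjoint_matrix \<phi>) (Suc k) $ (fst q, snd q) $ (\<mu>, \<nu>))"
      by (simp add: matrix_matrix_mult_def)
    also have "\<dots> = ?c * (\<Sum>q\<in>UNIV. adjoint_matrix \<phi> $ (\<alpha>, \<beta>) $ q * Y (fst q) (snd q))"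
      unfolding Suc sum_distrib_left by (simp add: Y_def mult_ac)
    also have "(\<Sum>q\<in>UNIV. adjoint_matrix \<phi> $ (\<alpha>, \<beta>) $ q * Y (fst q) (snd q))
        = - 2 * ((\<Sum>\<gamma>\<in>UNIV. \<phi> $ \<alpha> $ \<gamma> * Y \<gamma> \<beta>) + (\<Sum>\<gamma>\<in>UNIV. \<phi> $ \<beta> $ \<gamma> * Y \<alpha> \<gamma>))"
    proof -
      have 1: "Y \<beta> \<gamma> - Y \<gamma> \<beta> = - 2 * Y \<gamma> \<beta>" and 2: "Y \<gamma> \<alpha> - Y \<alpha> \<gamma> = - 2 * Y \<alpha> \<gamma>" for \<gamma>
        using Y[of \<gamma> \<beta>] Y[of \<alpha> \<gamma>] by simp_all
      show ?thesis unfolding row 1 2 by (simp add: sum_distrib_left sum_negf mult.left_commute)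
    qed
    also have "(\<Sum>\<gamma>\<in>UNIV. \<phi> $ \<alpha> $ \<gamma> * Y \<gamma> \<beta>) + (\<Sum>\<gamma>\<in>UNIV. \<phi> $ \<beta> $ \<gamma> * Y \<alpha> \<gamma>)
        = X (Suc (Suc k)) \<alpha> \<beta> \<mu> \<nu> - X (Suc (Suc k)) \<alpha> \<beta> \<nu> \<mu>"
      unfolding Y_def X_Suc[symmetric] by (simp add: right_diff_distrib sum_subtractf)
    also have "?c * (- 2 * Z) = (- 1) ^ Suc (Suc k) * 2 ^ Suc k * Z" for Z
      by (simp add: mult_ac)
    finally show ?case .
  qed
qed

text \<open>Without the swap the trace factors into power sums; with it, the two powers of \<phi>
  are multiplied to one fixed power, and the binomial coefficients add up to 2^(k+1).\<close>

lemma trace_mpow_adjoint_matrix: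
  fixes \<phi> :: "'a::comm_ring_1^'r^'r"
  assumes "\<And>\<alpha> \<beta>. \<phi> $ \<beta> $ \<alpha> = - \<phi> $ \<alpha> $ \<beta>"
  shows "trace (mpow (adjoint_matrix \<phi>) (Suc k)) = (- 1) ^ Suc k * 2 ^ k *
    ((\<Sum>j\<le>Suc k. of_nat (Suc k choose j) * (trace (mpow \<phi> j) * trace (mpow \<phi> (Suc k - j)))) - 2 ^ Suc k * trace (mpow \<phi> (Suc k)))"
proof -
  let ?c = "(- 1) ^ Suc k * 2 ^ k :: 'a"
  have 1: "(\<Sum>\<alpha>\<in>UNIV. \<Sum>\<beta>\<in>UNIV. \<Sum>j\<le>Suc k. of_nat (Suc k choose j) * (mpow \<phi> j $ \<alpha> $ \<alpha> * mpow \<phi> (Suc k - j) $ \<beta> $ \<beta>))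
      = (\<Sum>j\<le>Suc k. of_nat (Suc k choose j) * (trace (mpow \<phi> j) * trace (mpow \<phi> (Suc k - j))))"
  proof -
    have swap: "(\<Sum>\<alpha>\<in>UNIV. \<Sum>\<beta>\<in>UNIV. \<Sum>j\<le>Suc k. f j \<alpha> \<beta>) = (\<Sum>j\<le>Suc k. \<Sum>\<alpha>\<in>UNIV. \<Sum>\<beta>\<in>UNIV. f j \<alpha> \<beta>)" for f :: "nat \<Rightarrow> 'r \<Rightarrow> 'r \<Rightarrow> 'a"
    proof -
      have "(\<Sum>\<alpha>\<in>UNIV. \<Sum>\<beta>\<in>UNIV. \<Sum>j\<le>Suc k. f j \<alpha> \<beta>) = (\<Sum>\<alpha>\<in>UNIV. \<Sum>j\<le>Suc k. \<Sum>\<beta>\<in>UNIV. f j \<alpha> \<beta>)"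
        by (intro sum.cong refl sum.swap)
      then show ?thesis by (subst sum.swap)
    qed
    have "trace M * trace N = (\<Sum>\<alpha>\<in>UNIV. \<Sum>\<beta>\<in>UNIV. M $ \<alpha> $ \<alpha> * N $ \<beta> $ \<beta>)" for M N :: "'a^'r^'r"
      by (simp add: trace_def sum_product)
    then show ?thesis by (simp only: swap sum_distrib_left)
  qed
  have 2: "(\<Sum>\<alpha>\<in>UNIV. \<Sum>\<beta>\<in>UNIV. \<Sum>j\<le>Suc k. of_nat (Suc k choose j) * (mpow \<phi> j $ \<alpha> $ \<beta> * mpow \<phi> (Suc k - j) $ \<beta> $ \<alpha>))
      = 2 ^ Suc k * trace (mpow \<phi> (Suc k))"
  proof -
    have "(\<Sum>\<alpha>\<in>UNIV. \<Sum>\<beta>\<in>UNIV. \<Sum>j\<le>Suc k. of_nat (Suc k choose j) * (mpow \<phi> j $ \<alpha> $ \<beta> * mpow \<phi> (Suc k - j) $ \<beta> $ \<alpha>))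
        = (\<Sum>\<alpha>\<in>UNIV. \<Sum>j\<le>Suc k. of_nat (Suc k choose j) * (mpow \<phi> j ** mpow \<phi> (Suc k - j)) $ \<alpha> $ \<alpha>)"
      by (subst sum.swap) (simp add: matrix_matrix_mult_def sum_distrib_left del: mpow.simps sum.atMost_Suc)
    also have "\<dots> = (\<Sum>\<alpha>\<in>UNIV. \<Sum>j\<le>Suc k. of_nat (Suc k choose j) * mpow \<phi> (Suc k) $ \<alpha> $ \<alpha>)"
      by (intro sum.cong refl) (simp add: mpow_add[symmetric] del: mpow.simps)
    also have "\<dots> = of_nat (\<Sum>j\<le>Suc k. Suc k choose j) * trace (mpow \<phi> (Suc k))"
      by (simp add: trace_def sum_distrib_left sum_distrib_right[symmetric] of_nat_sum del: mpow.simps sum.atMost_Suc)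
    finally show ?thesis by (simp only: choose_row_sum of_nat_power of_nat_numeral)
  qed
  have "trace (mpow (adjoint_matrix \<phi>) (Suc k)) = (\<Sum>\<alpha>\<in>UNIV. \<Sum>\<beta>\<in>UNIV. mpow (adjoint_matrix \<phi>) (Suc k) $ (\<alpha>, \<beta>) $ (\<alpha>, \<beta>))"
    by (simp only: trace_def sum_pair)
  then show ?thesis
    unfolding mpow_adjoint_matrix[OF assms]
    by (simp only: sum_distrib_left[symmetric] sum_subtractf 1 2)
qed

section \<open>One-forms and two-forms attached to real matrices\<close>

definition lin :: "real^('n::{finite,linorder})^'a \<Rightarrow> 'a \<Rightarrow> 'n ext" where
  "lin P i = (\<Sum>j\<in>UNIV. P $ i $ j *\<^sub>R dx j)"

definition quad :: "real^('n::{finite,linorder})^('n::{finite,linorder}) \<Rightarrow> 'n ext" where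
  "quad M = (\<Sum>j\<in>UNIV. \<Sum>k\<in>UNIV. M $ j $ k *\<^sub>R (dx j * dx k))"

definition matrix_unit :: "'n \<Rightarrow> 'n \<Rightarrow> real^'n^'n" where
  "matrix_unit j k = (\<chi> a b. if a = j \<and> b = k then 1 else 0)"

lemma matrix_mult_nth: "(A ** B) $ i $ j = (\<Sum>k\<in>UNIV. A $ i $ k * B $ k $ j)"
  by (simp add: matrix_matrix_mult_def)

lemma homog_lin: "homog (Suc 0) (lin P i)"
  unfolding lin_def by (intro homog_sum homog_simps)

lemma quad_linear: "quad (A + B) = quad A + quad B" "quad (A - B) = quad A - quad B" "quad (r *\<^sub>R A) = r *\<^sub>R quad A"
  "quad (- A) = - quad A" "quad 0 = 0"
  by (simp_all add: quad_def scaleR_add_left scaleR_diff_left sum.distrib sum_subtractf scaleR_sum_right sum_negf)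

lemma quad_transpose: "quad (transpose M) = - quad M"
proof -
  have "quad (transpose M) = (\<Sum>j\<in>UNIV. \<Sum>k\<in>UNIV. - (M $ k $ j *\<^sub>R (dx k * dx j)))"
    unfolding quad_def
  proof (intro sum.cong refl)
    fix j k :: 'a
    show "transpose M $ j $ k *\<^sub>R (dx j * dx k) = - (M $ k $ j *\<^sub>R (dx k * dx j))"
      using dx_anticommute[of j k] by (simp add: transpose_def)
  qed
  also have "\<dots> = - quad M" by (subst sum.swap) (simp add: quad_def sum_negf)
  finally show ?thesis .
qed

lemma quad_symmetric: "transpose M = M \<Longrightarrow> quad M = 0"
  using quad_transpose[of M] by (simp add: eq_neg_iff_add_eq_0 scaleR_2[symmetric])

lemma form_of_two_form_skew:
  assumes "transpose M = - M"
  shows "form_of (two_form (\<lambda>i j. r * M $ i $ j)) = (r / 2) *\<^sub>R quad M"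
proof -
  have skew: "r * M $ j $ i = - (r * M $ i $ j)" for i j
    using arg_cong[OF assms, of "\<lambda>X. X $ i $ j"] by (simp add: transpose_def)
  have "form_of (two_form (\<lambda>i j. r * M $ i $ j)) = (1 / 2) *\<^sub>R (\<Sum>i\<in>UNIV. \<Sum>j\<in>UNIV. (r * M $ i $ j) *\<^sub>R (dx i * dx j))"
    using form_of_two_form[of "\<lambda>i j. r * M $ i $ j"] skew by blast
  then show ?thesis by (simp add: quad_def scaleR_sum_right)
qed

lemma sum_lin_mult: "(\<Sum>i\<in>UNIV. lin (transpose P) i * lin Q i) = quad (P ** Q)"
proof -
  have "(\<Sum>i\<in>UNIV. lin (transpose P) i * lin Q i)
      = (\<Sum>i\<in>UNIV. \<Sum>j\<in>UNIV. \<Sum>k\<in>UNIV. (P $ j $ i * Q $ i $ k) *\<^sub>R (dx j * dx k))"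
    by (simp add: lin_def sum_product transpose_def mult.commute)
  also have "\<dots> = (\<Sum>j\<in>UNIV. \<Sum>i\<in>UNIV. \<Sum>k\<in>UNIV. (P $ j $ i * Q $ i $ k) *\<^sub>R (dx j * dx k))"
    by (rule sum.swap)
  also have "\<dots> = (\<Sum>j\<in>UNIV. \<Sum>k\<in>UNIV. \<Sum>i\<in>UNIV. (P $ j $ i * Q $ i $ k) *\<^sub>R (dx j * dx k))"
    by (intro sum.cong refl sum.swap)
  finally show ?thesis by (simp add: quad_def matrix_matrix_mult_def scaleR_sum_left)
qed

text \<open>The order of factors opposite to \<open>sum_lin_mult\<close> gives an
  endomorphism-valued 2-form built from rank one matrices; in this way B A becomes a sum of terms P
  (\<open>matrix_unit\<close> j k) G P.\<close>

lemma lin_mult_lin: "lin P i * lin (transpose Q) l = tens (\<lambda>j k. P ** matrix_unit j k ** Q) $ i $ l"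
proof -
  have "(P ** matrix_unit j k ** Q) $ i $ l = P $ i $ j * Q $ k $ l" for j k
  proof -
    have "(P ** matrix_unit j k) $ i $ b = (if b = k then P $ i $ j else 0)" for b
    proof -
      have "(P ** matrix_unit j k) $ i $ b = (\<Sum>a\<in>UNIV. if a = j then (if b = k then P $ i $ j else 0) else 0)"
        unfolding matrix_matrix_mult_def matrix_unit_def vec_lambda_beta by (intro sum.cong) auto
      then show ?thesis by simp
    qed
    then have "(P ** matrix_unit j k ** Q) $ i $ l = (\<Sum>b\<in>UNIV. if b = k then P $ i $ j * Q $ k $ l else 0)"
      unfolding matrix_matrix_mult_def[of "P ** matrix_unit j k"] vec_lambda_beta by (intro sum.cong) auto
    then show ?thesis by simp
  qed
  then show ?thesis
    by (simp add: lin_def tens_def sum_product transpose_def sum_component mat_mult_nth emb_def of_real_def mult.commute)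
qed

lemma tens_antisymmetrise: "tens B = tens (\<lambda>j k. (1 / 2) *\<^sub>R (B j k - B k j))"
proof -
  have "tens (\<lambda>j k. (1 / 2) *\<^sub>R (B j k - B k j)) = (1 / 2) *\<^sub>R tens (\<lambda>j k. B j k - B k j)"
    by (simp add: tens_def emb_simps matrix_mult_simps scaleR_sum_right)
  also have "\<dots> = tens B"
    by (simp add: tens_diff tens_swap[of B] scaleR_2[symmetric])
  finally show ?thesis by simp
qed

lemma tens_scaleR: "tens (\<lambda>j k. r *\<^sub>R B j k) = r *\<^sub>R tens B"
  by (simp add: tens_def emb_simps matrix_mult_simps scaleR_sum_right)

context
  fixes G :: "real^('n::{finite,linorder})^('n::{finite,linorder})" and E :: "9 \<Rightarrow> real^('n::{finite,linorder})^('n::{finite,linorder})"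
  assumes spin9: "spin9_module G E"
begin

interpretation spin9_module G E by (rule spin9)

text \<open>The curvature matrices of \<open>V\<close> and \<open>\<Delta>\<close> for the symmetric space F4/Spin(9).\<close>

definition phi :: "(('n even_ext, 9) vec, 9) vec" where
  "phi = (\<chi> \<alpha> \<beta>. two_form (\<lambda>i j. 2 * (G ** F \<alpha> \<beta>) $ i $ j))"

text \<open>Normalised jointly with \<open>phi\<close>: a curvature tensor with scalar \<zeta> in
  \<open>curvature_rigidity\<close> yields \<zeta> / 2 times \<open>Xi\<close> and \<zeta> / 2 times
  \<open>phi\<close>.\<close>

definition Xi :: "(('n ext, 'n) vec, 'n) vec" where
  "Xi = tens (\<lambda>j k. (1 / 4) *\<^sub>R (\<Sum>\<alpha>\<in>UNIV. \<Sum>\<beta>\<in>UNIV. (G ** F \<alpha> \<beta>) $ j $ k *\<^sub>R F \<alpha> \<beta>))"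

lemma GF_skew: "transpose (G ** F \<alpha> \<beta>) = - (G ** F \<alpha> \<beta>)"
  using skew_adjoint_F[of \<alpha> \<beta>] by (simp add: skew_adjoint_def matrix_transpose_mul G(1))

lemma form_of_phi: "form_of (phi $ \<alpha> $ \<beta>) = quad (G ** F \<alpha> \<beta>)"
  by (simp add: phi_def form_of_two_form_skew[OF GF_skew])

lemma phi_skew: "phi $ \<beta> $ \<alpha> = - phi $ \<alpha> $ \<beta>"
  by (rule form_of_inject[THEN iffD1]) (simp add: form_of_phi F_antisym[of \<alpha> \<beta>] matrix_mult_simps quad_linear)

text \<open>The skew-adjoint endomorphism given by the wedge of two coordinate vectors, with one
  index lowered by \<open>G\<close>.\<close>

definition antisym_unit :: "'n \<Rightarrow> 'n \<Rightarrow> ((real, 'n) vec, 'n) vec" where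
  "antisym_unit j k = (1 / 2) *\<^sub>R ((matrix_unit j k - matrix_unit k j) ** G)"

lemma skew_adjoint_antisym_unit: "skew_adjoint G (antisym_unit j k)"
proof -
  have "transpose (matrix_unit j k) = matrix_unit k j" for j k :: 'n
    by (auto simp: transpose_def matrix_unit_def vec_eq_iff)
  then show ?thesis
    by (simp add: skew_adjoint_def antisym_unit_def transpose_simps matrix_transpose_mul G(1) matrix_mult_simps
        matrix_mul_assoc algebra_simps)
qed

lemma trace_antisym_unit: "trace (antisym_unit j k ** F \<alpha> \<beta>) = - (G ** F \<alpha> \<beta>) $ j $ k"
proof -
  have tr: "trace (matrix_unit j k ** M) = M $ k $ j" for M :: "((real, 'n) vec, 'n) vec" and j k
  proof -
    have "(matrix_unit j k ** M) $ a $ a = (if a = j then M $ k $ j else 0)" for a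
    proof -
      have "(matrix_unit j k ** M) $ a $ a = (\<Sum>b\<in>UNIV. if b = k then (if a = j then M $ k $ j else 0) else 0)"
        unfolding matrix_matrix_mult_def matrix_unit_def vec_lambda_beta by (intro sum.cong) auto
      then show ?thesis by simp
    qed
    then show ?thesis by (simp add: trace_def)
  qed
  have "(G ** F \<alpha> \<beta>) $ k $ j = - (G ** F \<alpha> \<beta>) $ j $ k"
    using arg_cong[OF GF_skew[of \<alpha> \<beta>], of "\<lambda>X. X $ j $ k"] by (simp add: transpose_def)
  then show ?thesis
    by (simp add: antisym_unit_def matrix_mult_simps trace_simps tr matrix_mul_assoc[symmetric])
qed

text \<open>The Fierz identity rewrites the spin(9)-valued curvature as conjugates of the
  antisymmetric unit by the nine E and three copies of it, which is the shape of B A in the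
  representation of dimension 26.\<close>

lemma Xi_eq: "Xi = tens (\<lambda>j k. T (antisym_unit j k) + 3 *\<^sub>R antisym_unit j k)"
  by (simp add: Xi_def fierz[OF skew_adjoint_antisym_unit] trace_antisym_unit sum_negf)

text \<open>The 26-dimensional representation of F4 is \<open>\<real> \<oplus> V \<oplus> \<Delta>\<close>.\<close>

lemma trace_phi_26: "form_of (trace (mpow phi (Suc k))) = - trace (mpow Xi (Suc k))"
proof -
  let ?P = "\<lambda>p. case p of None \<Rightarrow> mat 1 | Some \<alpha> \<Rightarrow> E \<alpha>"
  \<comment> \<open>The weight 3 on the trivial summand is the 3 in T + 3. It is put entirely into
    \<open>B\<close>, instead of a square root in each of \<open>A\<close> and
    \<open>B\<close>.\<close>
  let ?r = "\<lambda>p. case p of None \<Rightarrow> 3 | Some _ \<Rightarrow> (1 :: real)"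
  define A :: "(('n ext, 'n) vec, 9 option) vec" where "A = (\<chi> p i. lin (transpose (G ** ?P p)) i)"
  define B :: "(('n ext, 9 option) vec, 'n) vec" where "B = (\<chi> i p. lin (?r p *\<^sub>R ?P p) i)"
  have A: "mhomog 1 A" and B: "mhomog 1 B"
    by (simp_all add: mhomog_def A_def B_def homog_lin)
  have AB: "(A ** B) $ p $ q = ?r q *\<^sub>R quad (G ** ?P p ** ?P q)" for p q
  proof -
    have "(A ** B) $ p $ q = quad (G ** ?P p ** (?r q *\<^sub>R ?P q))"
      unfolding sum_lin_mult[symmetric] by (subst matrix_mult_nth) (simp add: A_def B_def)
    then show ?thesis by (simp add: matrix_mult_simps quad_linear)
  qed
  have GE: "transpose (G ** E \<alpha>) = G ** E \<alpha>" for \<alpha>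
    using E_adjoint[of \<alpha>] by (simp add: matrix_transpose_mul G(1))
  \<comment> \<open>The matrices G and G E are symmetric, so the 2-forms joining the trivial summand
    to itself and to V vanish; A B is block diagonal with blocks 0 and \<open>phi\<close>.\<close>
  have zero: "(A ** B) $ None $ q = 0" "(A ** B) $ p $ None = 0" for p q
    by (cases q; cases p; simp add: AB GE G(1) quad_symmetric)+
  have some: "(A ** B) $ Some \<alpha> $ Some \<beta> = form_of (phi $ \<alpha> $ \<beta>)" for \<alpha> \<beta>
  proof (cases "\<alpha> = \<beta>")
    case True
    then show ?thesis
      by (simp add: AB form_of_phi matrix_mul_assoc[symmetric] E_square G(1) quad_symmetric quad_linear matrix_mult_simps)
  qed (simp add: AB form_of_phi F_def matrix_mul_assoc)
  have pow: "mpow (A ** B) (Suc k) $ None $ q = 0 \<and> mpow (A ** B) (Suc k) $ Some \<alpha> $ None = 0 \<and>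
      mpow (A ** B) (Suc k) $ Some \<alpha> $ Some \<beta> = mpow (\<chi> \<alpha> \<beta>. form_of (phi $ \<alpha> $ \<beta>)) (Suc k) $ \<alpha> $ \<beta>" for \<alpha> \<beta> q
  proof (induction k arbitrary: \<alpha> \<beta> q)
    case 0
    then show ?case by (simp add: zero some)
  next
    case (Suc k)
    have "mpow (A ** B) (Suc (Suc k)) $ a $ b = (\<Sum>c\<in>UNIV. (A ** B) $ a $ c * mpow (A ** B) (Suc k) $ c $ b)" for a b
      by (simp add: matrix_matrix_mult_def[of "A ** B"])
    then show ?case
      using Suc by (simp add: sum_option zero some matrix_matrix_mult_def[of "\<chi> \<alpha> \<beta>. form_of (phi $ \<alpha> $ \<beta>)"])
  qed
  have "trace (mpow (A ** B) (Suc k)) = form_of (trace (mpow phi (Suc k)))"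
    unfolding form_of_trace_mpow unfolding trace_def sum_option by (simp add: pow del: mpow.simps)
  moreover have "B ** A = Xi"
  proof -
    have BA: "(B ** A) $ i $ l = (\<Sum>p\<in>UNIV. tens (\<lambda>j k. (?r p *\<^sub>R ?P p) ** matrix_unit j k ** (G ** ?P p)) $ i $ l)" for i l
      unfolding lin_mult_lin[symmetric] by (subst matrix_mult_nth) (simp add: A_def B_def)
    have tens_sum: "(\<Sum>p\<in>(UNIV :: 9 set). tens (f p)) = tens (\<lambda>j k. \<Sum>p\<in>UNIV. f p j k)" for f :: "9 \<Rightarrow> 'n \<Rightarrow> 'n \<Rightarrow> ((real, 'n) vec, 'n) vec"
    proof -
      have "(\<Sum>p\<in>S. tens (f p)) = tens (\<lambda>j k. \<Sum>p\<in>S. f p j k)" if "finite S" for S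
        using that by induction (simp_all add: tens_add, simp add: tens_def emb_simps matrix_mult_simps)
      then show ?thesis by simp
    qed
    have "B ** A = tens (\<lambda>j k. 3 *\<^sub>R (matrix_unit j k ** G)) + (\<Sum>\<alpha>\<in>UNIV. tens (\<lambda>j k. E \<alpha> ** matrix_unit j k ** (G ** E \<alpha>)))"
      by (simp add: vec_eq_iff BA sum_option sum_component matrix_mult_simps)
    also have "\<dots> = tens (\<lambda>j k. T (matrix_unit j k ** G) + 3 *\<^sub>R (matrix_unit j k ** G))"
      by (simp add: tens_sum T_def matrix_mul_assoc tens_add[symmetric] add.commute)
    also have "\<dots> = tens (\<lambda>j k. T (antisym_unit j k) + 3 *\<^sub>R antisym_unit j k)"
      by (subst tens_antisymmetrise, rule arg_cong[where f = tens])
         (simp add: fun_eq_iff antisym_unit_def linear_cmul[OF linear_T] linear_diff[OF linear_T] matrix_mult_simps algebra_simps)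
    finally show ?thesis by (simp add: Xi_eq)
  qed
  ultimately show ?thesis using trace_mpow_odd[OF A B] by simp
qed

text \<open>The relations of so(9). Each F differs from the product of two E by a central term, so
  the commutator can be computed from the anticommutators of the E.\<close>

lemma commutator_F_F:
  "F \<alpha> \<beta> ** F \<gamma> \<delta> - F \<gamma> \<delta> ** F \<alpha> \<beta> = 2 *\<^sub>R ((if \<beta> = \<gamma> then F \<alpha> \<delta> else 0) - (if \<alpha> = \<gamma> then F \<beta> \<delta> else 0)
    + (if \<beta> = \<delta> then F \<gamma> \<alpha> else 0) - (if \<alpha> = \<delta> then F \<gamma> \<beta> else 0))"
proof -
  let ?\<delta> = "\<lambda>\<alpha> \<beta>. if \<alpha> = \<beta> then mat 1 else 0 :: ((real, 'n) vec, 'n) vec"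
  have FE: "F \<alpha> \<beta> = E \<alpha> ** E \<beta> - ?\<delta> \<alpha> \<beta>" for \<alpha> \<beta>
    by (simp add: F_def E_square)
  have anti: "E \<alpha> ** E \<beta> + E \<beta> ** E \<alpha> = 2 *\<^sub>R ?\<delta> \<alpha> \<beta>" for \<alpha> \<beta>
    using E_anticommute[of \<alpha> \<beta>] by (auto simp: E_square scaleR_2)
  have comm: "E \<alpha> ** E \<beta> ** E \<gamma> - E \<gamma> ** (E \<alpha> ** E \<beta>) = 2 *\<^sub>R (if \<beta> = \<gamma> then E \<alpha> else 0) - 2 *\<^sub>R (if \<alpha> = \<gamma> then E \<beta> else 0)"
    for \<alpha> \<beta> \<gamma>
  proof -
    have "E \<alpha> ** E \<beta> ** E \<gamma> - E \<gamma> ** (E \<alpha> ** E \<beta>)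
        = E \<alpha> ** (E \<beta> ** E \<gamma> + E \<gamma> ** E \<beta>) - (E \<alpha> ** E \<gamma> + E \<gamma> ** E \<alpha>) ** E \<beta>"
      by (simp add: matrix_mult_simps matrix_mul_assoc)
    also have "\<dots> = 2 *\<^sub>R (if \<beta> = \<gamma> then E \<alpha> else 0) - 2 *\<^sub>R (if \<alpha> = \<gamma> then E \<beta> else 0)"
      unfolding anti by (simp add: matrix_mult_simps)
    finally show ?thesis .
  qed
  have "F \<alpha> \<beta> ** F \<gamma> \<delta> - F \<gamma> \<delta> ** F \<alpha> \<beta> = (E \<alpha> ** E \<beta>) ** (E \<gamma> ** E \<delta>) - (E \<gamma> ** E \<delta>) ** (E \<alpha> ** E \<beta>)"
    by (simp add: FE matrix_mult_simps)
  also have "\<dots> = (E \<alpha> ** E \<beta> ** E \<gamma> - E \<gamma> ** (E \<alpha> ** E \<beta>)) ** E \<delta> + E \<gamma> ** (E \<alpha> ** E \<beta> ** E \<delta> - E \<delta> ** (E \<alpha> ** E \<beta>))"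
    by (simp add: matrix_mult_simps matrix_mul_assoc)
  also have "\<dots> = 2 *\<^sub>R ((if \<beta> = \<gamma> then E \<alpha> ** E \<delta> else 0) - (if \<alpha> = \<gamma> then E \<beta> ** E \<delta> else 0)
      + (if \<beta> = \<delta> then E \<gamma> ** E \<alpha> else 0) - (if \<alpha> = \<delta> then E \<gamma> ** E \<beta> else 0))"
    unfolding comm by (simp add: matrix_mult_simps scaleR_diff_right scaleR_add_right)
  also have "\<dots> = 2 *\<^sub>R ((if \<beta> = \<gamma> then F \<alpha> \<delta> else 0) - (if \<alpha> = \<gamma> then F \<beta> \<delta> else 0)
      + (if \<beta> = \<delta> then F \<gamma> \<alpha> else 0) - (if \<alpha> = \<delta> then F \<gamma> \<beta> else 0))"
    by (simp add: FE E_square)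
  finally show ?thesis .
qed

text \<open>The 52-dimensional adjoint representation of F4 is \<open>\<Lambda>\<^sup>2V \<oplus> \<Delta>\<close>.\<close>

lemma trace_phi_52: "form_of (trace (mpow (adjoint_matrix phi) (Suc k))) = - ((- 2) ^ Suc k *\<^sub>R trace (mpow Xi (Suc k)))"
proof -
  define A :: "(('n ext, 'n) vec, 9 \<times> 9) vec" where "A = (\<chi> p i. lin (transpose (G ** F (fst p) (snd p))) i)"
  define B :: "(('n ext, 9 \<times> 9) vec, 'n) vec" where "B = (\<chi> i p. lin (F (fst p) (snd p)) i)"
  have A: "mhomog 1 A" and B: "mhomog 1 B"
    by (simp_all add: mhomog_def A_def B_def homog_lin)
  have "(A ** B) $ (\<alpha>, \<beta>) $ (\<gamma>, \<delta>) = form_of (adjoint_matrix phi $ (\<alpha>, \<beta>) $ (\<gamma>, \<delta>))" for \<alpha> \<beta> \<gamma> \<delta>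
  proof -
    have "(A ** B) $ (\<alpha>, \<beta>) $ (\<gamma>, \<delta>) = quad (G ** F \<alpha> \<beta> ** F \<gamma> \<delta>)"
      unfolding sum_lin_mult[symmetric] by (subst matrix_mult_nth) (simp add: A_def B_def)
    \<comment> \<open>Transposition exchanges the two orders of the factors F, and
      \<open>quad\<close> sees only the antisymmetric part, so half a commutator appears.\<close>
    also have "\<dots> = (1 / 2) *\<^sub>R quad (G ** F \<alpha> \<beta> ** F \<gamma> \<delta> - G ** F \<gamma> \<delta> ** F \<alpha> \<beta>)"
    proof -
      have "transpose (G ** F \<alpha> \<beta> ** F \<gamma> \<delta>) = transpose (F \<gamma> \<delta>) ** (transpose (F \<alpha> \<beta>) ** G)"
        by (simp add: matrix_transpose_mul G(1))
      also have "\<dots> = G ** F \<gamma> \<delta> ** F \<alpha> \<beta>"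
        using skew_adjoint_F[of \<alpha> \<beta>] skew_adjoint_F[of \<gamma> \<delta>]
        by (simp add: skew_adjoint_def matrix_mult_simps matrix_mul_assoc)
      finally show ?thesis
        using quad_transpose[of "G ** F \<alpha> \<beta> ** F \<gamma> \<delta>"] by (simp add: quad_linear scaleR_2[symmetric])
    qed
    also have "G ** F \<alpha> \<beta> ** F \<gamma> \<delta> - G ** F \<gamma> \<delta> ** F \<alpha> \<beta> = G ** (F \<alpha> \<beta> ** F \<gamma> \<delta> - F \<gamma> \<delta> ** F \<alpha> \<beta>)"
      by (simp add: matrix_mult_simps matrix_mul_assoc)
    also have "(1 / 2) *\<^sub>R quad \<dots> = form_of (adjoint_matrix phi $ (\<alpha>, \<beta>) $ (\<gamma>, \<delta>))"
      unfolding commutator_F_F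
      by (simp add: matrix_mult_simps quad_linear adjoint_matrix_def form_of_phi)
    finally show ?thesis .
  qed
  then have "A ** B = (\<chi> p q. form_of (adjoint_matrix phi $ p $ q))"
    by (simp add: vec_eq_iff)
  then have "trace (mpow (A ** B) (Suc k)) = form_of (trace (mpow (adjoint_matrix phi) (Suc k)))"
    by (simp add: form_of_trace_mpow del: mpow.simps)
  moreover have "B ** A = - 2 *\<^sub>R Xi"
  proof -
    have BA: "(B ** A) $ i $ l = (\<Sum>p\<in>UNIV. tens (\<lambda>j k. F (fst p) (snd p) ** matrix_unit j k ** (G ** F (fst p) (snd p))) $ i $ l)" for i l
      unfolding lin_mult_lin[symmetric] by (subst matrix_mult_nth) (simp add: A_def B_def)
    have tens_sum: "(\<Sum>p\<in>(UNIV :: 9 set). tens (f p)) = tens (\<lambda>j k. \<Sum>p\<in>UNIV. f p j k)" for f :: "9 \<Rightarrow> 'n \<Rightarrow> 'n \<Rightarrow> ((real, 'n) vec, 'n) vec"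
    proof -
      have "(\<Sum>p\<in>S. tens (f p)) = tens (\<lambda>j k. \<Sum>p\<in>S. f p j k)" if "finite S" for S
        using that by induction (simp_all add: tens_add, simp add: tens_def emb_simps matrix_mult_simps)
      then show ?thesis by simp
    qed
    have "B ** A = (\<Sum>\<alpha>\<in>UNIV. \<Sum>\<beta>\<in>UNIV. tens (\<lambda>j k. F \<alpha> \<beta> ** matrix_unit j k ** (G ** F \<alpha> \<beta>)))"
      by (simp add: vec_eq_iff BA sum_pair sum_component)
    also have "\<dots> = tens (\<lambda>j k. \<Sum>\<alpha>\<in>UNIV. \<Sum>\<beta>\<in>UNIV. F \<alpha> \<beta> ** (matrix_unit j k ** G) ** F \<alpha> \<beta>)"
      by (simp add: tens_sum matrix_mul_assoc)
    also have "\<dots> = tens (\<lambda>j k. \<Sum>\<alpha>\<in>UNIV. \<Sum>\<beta>\<in>UNIV. F \<alpha> \<beta> ** antisym_unit j k ** F \<alpha> \<beta>)"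
      by (subst tens_antisymmetrise, rule arg_cong[where f = tens])
         (simp add: fun_eq_iff antisym_unit_def matrix_mult_simps scaleR_sum_right sum_subtractf scaleR_diff_right)
    \<comment> \<open>\<open>sum_F_conj\<close> produces T + 3 once more, and therefore the same
      \<open>Xi\<close> as in dimension 26.\<close>
    also have "\<dots> = - 2 *\<^sub>R Xi"
      unfolding sum_F_conj[OF skew_adjoint_antisym_unit] tens_scaleR Xi_eq ..
    finally show ?thesis .
  qed
  ultimately show ?thesis
    using trace_mpow_odd[OF A B, of k] by (simp only: mpow_scaleR trace_scaleR)
qed

end

text \<open>The Newton polynomials are the coefficients of exp (- sum of p_k x^k / k). With only p_4
  and p_8 left, this is 1 - p_4 x^4 / 4 - p_8 x^8 / 8 + p_4^2 x^8 / 32 up to degree 8.\<close>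

lemma newton_sparse:
  fixes p :: "nat \<Rightarrow> 'a::real_algebra_1"
  assumes "p 1 = 0" "p 2 = 0" "p 3 = 0" "p 5 = 0" "p 6 = 0" "p 7 = 0"
  shows "newton p 2 = 0" "newton p 4 = - (1 / 4) *\<^sub>R p 4" "newton p 6 = 0"
    "newton p 8 = - (1 / 8) *\<^sub>R (p 8 - (1 / 4) *\<^sub>R (p 4 * p 4))"
proof -
  let ?S = "\<lambda>k. newton p k"
  have p: "p (Suc 0) = 0" "p (Suc (Suc 0)) = 0" "p (Suc (Suc (Suc 0))) = 0" "p (Suc (Suc (Suc (Suc (Suc 0))))) = 0"
    "p (Suc (Suc (Suc (Suc (Suc (Suc 0)))))) = 0" "p (Suc (Suc (Suc (Suc (Suc (Suc (Suc 0))))))) = 0"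
    using assms by (simp_all add: numeral_eq_Suc)
  have n1: "?S (Suc 0) = 0" by (simp add: p)
  have n2: "?S (Suc (Suc 0)) = 0" by (simp add: p n1 del: newton.simps(2) add: newton.simps(2)[of p "Suc 0"])
  have n3: "?S (Suc (Suc (Suc 0))) = 0"
    by (subst newton.simps(2)) (simp add: p n1 n2 del: newton.simps(2))
  have n4: "?S (Suc (Suc (Suc (Suc 0)))) = - (1 / 4) *\<^sub>R p (Suc (Suc (Suc (Suc 0))))"
    by (subst newton.simps(2)) (simp add: p n1 n2 n3 del: newton.simps(2))
  have n5: "?S (Suc (Suc (Suc (Suc (Suc 0))))) = 0"
    by (subst newton.simps(2)) (simp add: p n1 n2 n3 n4 del: newton.simps(2))
  have n6: "?S (Suc (Suc (Suc (Suc (Suc (Suc 0)))))) = 0"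
    by (subst newton.simps(2)) (simp add: p n1 n2 n3 n4 n5 del: newton.simps(2))
  have n7: "?S (Suc (Suc (Suc (Suc (Suc (Suc (Suc 0))))))) = 0"
    by (subst newton.simps(2)) (simp add: p n1 n2 n3 n4 n5 n6 del: newton.simps(2))
  have n8: "?S (Suc (Suc (Suc (Suc (Suc (Suc (Suc (Suc 0)))))))) = - (1 / 8) *\<^sub>R
      (p (Suc (Suc (Suc (Suc (Suc (Suc (Suc (Suc 0)))))))) - (1 / 4) *\<^sub>R (p (Suc (Suc (Suc (Suc 0)))) * p (Suc (Suc (Suc (Suc 0))))))"
    by (subst newton.simps(2)) (simp add: p n1 n2 n3 n4 n5 n6 n7 del: newton.simps(2))
  have "2 = Suc (Suc 0)" "4 = Suc (Suc (Suc (Suc 0)))" "6 = Suc (Suc (Suc (Suc (Suc (Suc 0)))))"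
    "8 = Suc (Suc (Suc (Suc (Suc (Suc (Suc (Suc 0)))))))" by simp_all
  then show "newton p 2 = 0" "newton p 4 = - (1 / 4) *\<^sub>R p 4" "newton p 6 = 0"
    "newton p 8 = - (1 / 8) *\<^sub>R (p 8 - (1 / 4) *\<^sub>R (p 4 * p 4))"
    by (simp_all only: n2 n4 n6 n8)
qed

text \<open>Over a commutative ring transposition commutes with powers; it negates the odd powers of
  a skew matrix and preserves traces.\<close>

lemma trace_mpow_skew_odd:
  fixes N :: "'a::{comm_ring_1, real_algebra_1}^'r^'r"
  assumes "\<And>\<alpha> \<beta>. N $ \<beta> $ \<alpha> = - N $ \<alpha> $ \<beta>" "odd k"
  shows "trace (mpow N k) = 0"
proof -
  have t: "transpose (mpow N k) = mpow (transpose N) k" for k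
  proof (induction k)
    case (Suc k)
    have "transpose (mpow N (Suc k)) = mpow (transpose N) k ** transpose N"
      by (simp add: matrix_transpose_mul Suc)
    then show ?case by (simp only: mpow_Suc_right)
  qed simp
  have "transpose N $ i $ j = - N $ i $ j" for i j
    using assms(1)[of i j] by (simp add: transpose_def)
  then have tN: "transpose N = (- 1) *\<^sub>R N" by (simp add: vec_eq_iff)
  have "trace (transpose (mpow N k)) = - trace (mpow N k)"
    unfolding t tN mpow_scaleR trace_scaleR using assms(2) by simp
  then have "trace (mpow N k) = - trace (mpow N k)" by (simp add: trace_def transpose_def)
  then show ?thesis by (simp add: eq_neg_iff_add_eq_0 scaleR_2[symmetric])
qed

section \<open>Power sums of the model curvatures and the resulting coefficients\<close>

context
  fixes G :: "real^('n::{finite,linorder})^('n::{finite,linorder})" and E :: "9 \<Rightarrow> real^('n::{finite,linorder})^('n::{finite,linorder})"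
  assumes spin9: "spin9_module G E"
begin

text \<open>Both representations express tr Xi^k, and eliminating it leaves a relation for V alone.
  The summand 2^k comes from the swap in \<open>trace_mpow_adjoint_matrix\<close>, the summand 2
  from dividing (-2)^k by (-1)^k 2^(k-1).\<close>

lemma phi_power_sum_relation:
  defines "t \<equiv> \<lambda>k. trace (mpow (phi G E) k)"
  assumes "0 < k"
  shows "(\<Sum>j\<le>k. of_nat (k choose j) * (t j * t (k - j))) = (2 ^ k + 2) *\<^sub>R t k"
proof -
  obtain m where k: "k = Suc m" using assms(2) by (cases k) auto
  let ?Z = "(\<Sum>j\<le>k. of_nat (k choose j) * (t j * t (k - j))) - 2 ^ k * t k"
  have "form_of (trace (mpow (adjoint_matrix (phi G E)) k)) = form_of ((- 2) ^ k *\<^sub>R t k)"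
    unfolding k trace_phi_52[OF spin9] using trace_phi_26[OF spin9, of m] by (simp add: t_def)
  then have "trace (mpow (adjoint_matrix (phi G E)) k) = (- 2) ^ k *\<^sub>R t k"
    by (simp only: form_of_inject)
  moreover have "trace (mpow (adjoint_matrix (phi G E)) k) = (- 1) ^ k * 2 ^ m * ?Z"
    unfolding k t_def by (rule trace_mpow_adjoint_matrix) (rule phi_skew[OF spin9])
  moreover have "(- 1) ^ k * 2 ^ m * ?Z = ((- 1) ^ k * 2 ^ m) *\<^sub>R ?Z"
    by (simp add: scaleR_conv_of_real)
  moreover have "(- 2) ^ k *\<^sub>R t k = ((- 1) ^ k * 2 ^ m) *\<^sub>R (2 *\<^sub>R t k)"
    by (simp add: k power_minus[of 2])
  ultimately have "((- 1) ^ k * 2 ^ m) *\<^sub>R ?Z = ((- 1) ^ k * 2 ^ m) *\<^sub>R (2 *\<^sub>R t k)" by simp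
  then have "?Z = 2 *\<^sub>R t k"
    unfolding scaleR_cancel_left by simp
  then show ?thesis
    by (simp add: scaleR_add_left scaleR_conv_of_real algebra_simps)
qed

text \<open>As t 0 = 9, the two extreme terms give 18 t_k against (2^k + 2) t_k. For k = 2 and k = 6
  the other terms vanish and the factors 6 and 66 differ from 18. For k = 4 the factor is again 18,
  so t_4 stays free; for k = 8 the middle term 70 t_4^2 equals (258 - 18) t_8.\<close>

lemma phi_power_sums:
  defines "t \<equiv> \<lambda>k. trace (mpow (phi G E) k)"
  shows "odd k \<Longrightarrow> t k = 0" "t 2 = 0" "t 6 = 0" "t 8 = (7 / 24) *\<^sub>R (t 4 * t 4)"
proof -
  show odd: "t k = 0" if "odd k" for k
    unfolding t_def by (rule trace_mpow_skew_odd[OF phi_skew[OF spin9] that])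
  have t0: "t 0 = 9 *\<^sub>R 1"
    by (simp add: t_def trace_I scaleR_conv_of_real)
  have rel: "(\<Sum>j\<le>k. of_nat (k choose j) * (t j * t (k - j))) = (2 ^ k + 2) *\<^sub>R t k" if "0 < k" for k
    unfolding t_def by (rule phi_power_sum_relation[OF that])
  have "(\<Sum>j\<le>2. of_nat (2 choose j) * (t j * t (2 - j))) = 18 *\<^sub>R t 2"
  proof -
    have "{..2} = {0, 1, 2 :: nat}" by auto
    then show ?thesis using t0 odd[of 1] by (simp add: scaleR_add_left[symmetric])
  qed
  then have "18 *\<^sub>R t 2 = 6 *\<^sub>R t 2" using rel[of 2] by simp
  then show t2: "t 2 = 0" by simp
  have "(\<Sum>j\<le>6. of_nat (6 choose j) * (t j * t (6 - j))) = 18 *\<^sub>R t 6"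
  proof -
    have "{..6} = {0, 1, 2, 3, 4, 5, 6 :: nat}" by auto
    then show ?thesis using t0 odd[of 1] odd[of 3] odd[of 5] t2 by (simp add: scaleR_add_left[symmetric])
  qed
  then have "18 *\<^sub>R t 6 = 66 *\<^sub>R t 6" using rel[of 6] by simp
  then show t6: "t 6 = 0" by simp
  have "(\<Sum>j\<le>8. of_nat (8 choose j) * (t j * t (8 - j))) = 18 *\<^sub>R t 8 + 70 *\<^sub>R (t 4 * t 4)"
  proof -
    have "{..8} = {0, 1, 2, 3, 4, 5, 6, 7, 8 :: nat}" by auto
    moreover have "8 choose 4 = (70 :: nat)" by code_simp
    ultimately show ?thesis
      using t0 odd[of 1] odd[of 3] odd[of 5] odd[of 7] t2 t6
      by (simp add: scaleR_add_left[symmetric]) (simp add: scaleR_conv_of_real)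
  qed
  then have "18 *\<^sub>R t 8 + 70 *\<^sub>R (t 4 * t 4) = 258 *\<^sub>R t 8" using rel[of 8] by simp
  then have "70 *\<^sub>R (t 4 * t 4) = 258 *\<^sub>R t 8 - 18 *\<^sub>R t 8" by (simp add: eq_diff_eq add.commute)
  also have "\<dots> = 240 *\<^sub>R t 8" by (simp add: scaleR_left_diff_distrib[symmetric])
  finally have "(1 / 240) *\<^sub>R (70 *\<^sub>R (t 4 * t 4)) = (1 / 240) *\<^sub>R (240 *\<^sub>R t 8)" by simp
  then show "t 8 = (7 / 24) *\<^sub>R (t 4 * t 4)" by simp
qed

text \<open>With t_8 = 7/24 t_4^2 the coefficient of degree 8 is - (7 - 6) t_4^2 / 192 for
  \<open>phi\<close> and, as all power sums change sign, (7 + 6) t_4^2 / 192 for \<open>Xi\<close>;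
  hence the ratio -13. In degree 4 only the sign changes.\<close>

theorem char_coeff_relations:
  fixes C :: "(('n ext, 'n) vec, 'n) vec" and P :: "(('n even_ext, 9) vec, 9) vec"
  assumes C: "C = r *\<^sub>R Xi G E" and P: "P = r *\<^sub>R phi G E"
  defines "e \<equiv> newton (\<lambda>i. trace (mpow C i))" and "\<tau> \<equiv> newton (\<lambda>i. trace (mpow P i))"
  shows "e 2 = 0" "e 4 = - form_of (\<tau> 4)" "e 6 = 0" "e 8 = - 13 *\<^sub>R form_of (\<tau> 8)"
proof -
  let ?t = "\<lambda>i. trace (mpow (phi G E) i)" and ?T = "\<lambda>i. trace (mpow (Xi G E) i)"
  note t = phi_power_sums
  have T: "?T i = - form_of (?t i)" if "0 < i" for i
    using trace_phi_26[OF spin9, of "i - 1"] that by simp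
  have e: "e k = r ^ k *\<^sub>R newton ?T k" and \<tau>: "\<tau> k = r ^ k *\<^sub>R newton ?t k" for k
    by (simp_all only: e_def \<tau>_def C P mpow_scaleR trace_scaleR newton_scaleR)
  have z: "?t 1 = 0" "?t 2 = 0" "?t 3 = 0" "?t 5 = 0" "?t 6 = 0" "?t 7 = 0"
    using t(2,3) t(1)[of 1] t(1)[of 3] t(1)[of 5] t(1)[of 7] by simp_all
  have "?T 1 = 0" "?T 2 = 0" "?T 3 = 0" "?T 5 = 0" "?T 6 = 0" "?T 7 = 0"
    using z T[of 1] T[of 2] T[of 3] T[of 5] T[of 6] T[of 7] by simp_all
  note nt = newton_sparse[of ?t, OF z] and nT = newton_sparse[of ?T, OF this]
  show "e 2 = 0" "e 6 = 0" by (simp_all add: e nT)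
  show "e 4 = - form_of (\<tau> 4)"
    by (simp add: e \<tau> nT nt T)
  have "newton ?T 8 = - 13 *\<^sub>R form_of (newton ?t 8)"
    unfolding nT nt by (simp add: T t(4) scaleR_left_diff_distrib[symmetric] flip: scaleR_minus_left scaleR_add_left)
  then show "e 8 = - 13 *\<^sub>R form_of (\<tau> 8)"
    by (simp add: e \<tau>)
qed

end

section \<open>Curvature of a Levi-Civita connection preserving a Spin(9)-structure\<close>

lemma bounded_linear_entry: "bounded_linear (\<lambda>M :: real^'n^'m. M $ k $ i)"
  by (auto simp: linear_conv_bounded_linear[symmetric] intro!: linearI)

lemma span_range_explicit:
  fixes f :: "'a::finite \<Rightarrow> 'b::real_vector"
  assumes "v \<in> span (range f)"
  shows "\<exists>p. v = (\<Sum>\<alpha>\<in>UNIV. p \<alpha> *\<^sub>R f \<alpha>)"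
  using assms
proof (induction rule: span_induct_alt)
  case base
  show ?case by (rule exI[of _ "\<lambda>_. 0"]) simp
next
  case (step r b v)
  from step obtain \<beta> p where "b = f \<beta>" "v = (\<Sum>\<alpha>\<in>UNIV. p \<alpha> *\<^sub>R f \<alpha>)" by auto
  then show ?case
    by (intro exI[of _ "\<lambda>\<alpha>. (if \<alpha> = \<beta> then r else 0) + p \<alpha>"])
      (simp add: scaleR_add_left sum.distrib if_distrib[of "\<lambda>r. r *\<^sub>R _"] cong: if_cong)
qed

lemma bounded_linear_transpose: "bounded_linear (transpose :: real^'n^'m \<Rightarrow> real^'m^'n)"
  by (auto simp: linear_conv_bounded_linear[symmetric] transpose_simps intro!: linearI)

context
  fixes A :: "('a::t2_space, 'n::{finite,linorder}) chart set" and g D c x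
  assumes A: "smooth_atlas A" and g: "riemannian_metric A g" and LC: "levi_civita A g D"
    and c: "c \<in> A" and x: "x \<in> snd c ` fst c"
begin

lemma open_S: "open (snd c ` fst c)"
  by (rule open_chart_image[OF A c])

lemma smooth_D: "smooth_on (snd c ` fst c) (\<lambda>y. D c y i)"
  using LC c by (auto simp: levi_civita_def is_connection_def)

lemma smooth_g: "smooth_on (snd c ` fst c) (g c)"
  using g c by (auto simp: riemannian_metric_def)

text \<open>Vanishing torsion makes derivative terms and product terms symmetric in j and l, so they
  cancel in pairs in the cyclic sum.\<close>

lemma curv_first_bianchi: "curv (D c) x i j $ k $ l + curv (D c) x j l $ k $ i + curv (D c) x l i $ k $ j = 0"
proof -
  have sym: "D c y i $ k $ j = D c y j $ k $ i" if "y \<in> snd c ` fst c" for y i j k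
    using LC c that unfolding levi_civita_def by blast
  have entry: "pd i (\<lambda>y. D c y j) x $ k $ l = pd i (\<lambda>y. D c y j $ k $ l) x" for i j k l
    by (rule pd_bounded_linear[OF bounded_linear_entry smooth_on_differentiable[OF smooth_D x], symmetric])
  have "pd i (\<lambda>y. D c y j) x $ k $ l = pd i (\<lambda>y. D c y l) x $ k $ j" for i j k l
    unfolding entry by (rule pd_cong_open[OF open_S x]) (rule sym)
  note 1 = this[of i j k l] this[of j l k i] this[of l i k j]
  have "(D c x i ** D c x j) $ k $ l = (D c x i ** D c x l) $ k $ j" for i j k l
    by (simp add: matrix_matrix_mult_def sym[OF x, of j _ l])
  note 2 = this[of i j k l] this[of j l k i] this[of l i k j]
  show ?thesis
    using 1 2 unfolding curv_def vector_add_component vector_minus_component by linarith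
qed

text \<open>The compatibility of connection and metric is differentiated again; since second
  derivatives of the metric commute, antisymmetrising leaves the curvature.\<close>

lemma skew_adjoint_curv: "skew_adjoint (g c x) (curv (D c) x i j)"
proof -
  let ?S = "snd c ` fst c"
  have metric: "pd i (g c) y = transpose (D c y i) ** g c y + g c y ** D c y i" if "y \<in> ?S" for y i
    using LC c that unfolding levi_civita_def by blast
  have dD: "(\<lambda>y. D c y i) differentiable (at x)" for i by (rule smooth_on_differentiable[OF smooth_D x])
  have dg: "g c differentiable (at x)" by (rule smooth_on_differentiable[OF smooth_g x])
  have dDt: "(\<lambda>y. transpose (D c y i)) differentiable (at x)" for i
    by (rule differentiable_bounded_linear[OF bounded_linear_transpose dD])
  define dG where "dG i = pd i (g c) x" for i
  define dC where "dC i j = pd i (\<lambda>y. D c y j) x" for i j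
  have d2: "pd j (pd i (g c)) x = transpose (dC j i) ** g c x + transpose (D c x i) ** dG j + (dG j ** D c x i + g c x ** dC j i)" for i j
  proof -
    have "pd j (pd i (g c)) x = pd j (\<lambda>y. transpose (D c y i) ** g c y + g c y ** D c y i) x"
      by (rule pd_cong_open[OF open_S x metric])
    then show ?thesis
      by (simp add: pd_add pd_bilinear[OF bounded_bilinear_matrix_mult] differentiable_bilinear[OF bounded_bilinear_matrix_mult]
          dD dg dDt pd_bounded_linear[OF bounded_linear_transpose] dG_def dC_def)
  qed
  have comm: "pd j (pd i (g c)) x = pd i (pd j (g c)) x"
    by (rule pd_commute[OF smooth_g open_S x])
  have dG: "dG i = transpose (D c x i) ** g c x + g c x ** D c x i" for i
    unfolding dG_def by (rule metric[OF x])
  have "transpose (dC i j) ** g c x - transpose (dC j i) ** g c x + g c x ** dC i j - g c x ** dC j i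
      = transpose (D c x i) ** dG j + dG j ** D c x i - transpose (D c x j) ** dG i - dG i ** D c x j"
    using comm unfolding d2 by (simp add: algebra_simps)
  also have "\<dots> = transpose (D c x i) ** transpose (D c x j) ** g c x - transpose (D c x j) ** transpose (D c x i) ** g c x
      + g c x ** D c x j ** D c x i - g c x ** D c x i ** D c x j"
    unfolding dG by (simp add: matrix_mult_simps matrix_mul_assoc)
  finally have "transpose (dC i j) ** g c x - transpose (dC j i) ** g c x
        + transpose (D c x j) ** transpose (D c x i) ** g c x - transpose (D c x i) ** transpose (D c x j) ** g c x
      = - (g c x ** dC i j - g c x ** dC j i + g c x ** D c x i ** D c x j - g c x ** D c x j ** D c x i)"
    by (simp add: algebra_simps)
  then show ?thesis
    by (simp add: skew_adjoint_def curv_def transpose_simps matrix_transpose_mul matrix_mult_simps matrix_mul_assoc flip: dC_def)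
qed

text \<open>The induced connection acts on endomorphisms by commutators, and so does its
  curvature.\<close>

lemma end_deriv_commutator:
  assumes W: "open W" "x \<in> W" "W \<subseteq> snd c ` fst c" and S: "smooth_on W S"
  shows "end_deriv D c i (end_deriv D c j S) x - end_deriv D c j (end_deriv D c i S) x
    = curv (D c) x i j ** S x - S x ** curv (D c) x i j"
proof -
  have dD: "(\<lambda>y. D c y i) differentiable (at x)" for i by (rule smooth_on_differentiable[OF smooth_D x])
  have dS: "S differentiable (at x)" "pd i S differentiable (at x)" for i
    using smooth_on_differentiable[OF S W(2)] smooth_on_differentiable[OF smooth_on_pd[OF S] W(2)] by auto
  have bil: "(\<lambda>y. D c y j ** S y) differentiable (at x)" "(\<lambda>y. S y ** D c y j) differentiable (at x)" for j
    by (intro differentiable_bilinear[OF bounded_bilinear_matrix_mult] dD dS)+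
  have "pd i (end_deriv D c j S) x = pd i (pd j S) x + (pd i (\<lambda>y. D c y j) x ** S x + D c x j ** pd i S x)
      - (pd i S x ** D c x j + S x ** pd i (\<lambda>y. D c y j) x)" for i j
    unfolding end_deriv_def[abs_def]
    by (simp add: pd_add pd_diff bil dS dD differentiable_add pd_bilinear[OF bounded_bilinear_matrix_mult])
  then have e: "end_deriv D c i (end_deriv D c j S) x = pd i (pd j S) x + (pd i (\<lambda>y. D c y j) x ** S x + D c x j ** pd i S x)
      - (pd i S x ** D c x j + S x ** pd i (\<lambda>y. D c y j) x)
      + D c x i ** (pd j S x + D c x j ** S x - S x ** D c x j) - (pd j S x + D c x j ** S x - S x ** D c x j) ** D c x i" for i j
    by (simp add: end_deriv_def)
  have comm: "pd i (pd j S) x = pd j (pd i S) x"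
    by (rule pd_commute[OF S W(1,2)])
  show ?thesis
    unfolding e comm by (simp add: curv_def matrix_mult_simps matrix_mul_assoc)
qed

lemma smooth_end_deriv:
  assumes W: "open W" "W \<subseteq> snd c ` fst c" and S: "smooth_on W S"
  shows "smooth_on W (end_deriv D c i S)"
  unfolding end_deriv_def[abs_def]
  by (intro smooth_on_add smooth_on_diff smooth_on_matrix_mult smooth_on_pd W S smooth_on_subset[OF smooth_D])

lemma invertible_metric: "invertible (g c x)" and symmetric_metric: "transpose (g c x) = g c x"
proof -
  have "v \<bullet> (g c x *v v) > 0" if "v \<noteq> 0" for v
    using g c x that unfolding riemannian_metric_def by blast
  then have "\<forall>v. g c x *v v = 0 \<longrightarrow> v = 0" by force
  then show "invertible (g c x)"
    by (simp add: invertible_left_inverse matrix_left_invertible_ker)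
  show "transpose (g c x) = g c x"
    using g c x unfolding riemannian_metric_def by blast
qed

end

lemma Spin9_curvature:
  fixes A :: "('a::t2_space, 16) chart set"
  assumes A: "smooth_atlas A" and g: "riemannian_metric A g" and LC: "levi_civita A g D"
    and V: "preserved_by A D V" and c: "c \<in> A" and x: "x \<in> W" and E: "local_frame g V c W E"
  obtains r where "spin9_module (g c x) (\<lambda>\<alpha>. E \<alpha> x)"
    "curv_form (D c) x = r *\<^sub>R Xi (g c x) (\<lambda>\<alpha>. E \<alpha> x)" "psi D c E x = r *\<^sub>R phi (g c x) (\<lambda>\<alpha>. E \<alpha> x)"
proof -
  have W: "open W" "W \<subseteq> snd c ` fst c" and smooth_E: "\<And>\<alpha>. smooth_on W (E \<alpha>)"
    and cliff: "\<And>y. y \<in> W \<Longrightarrow> clifford_system (g c y) (\<lambda>\<alpha>. E \<alpha> y)"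
    and span: "\<And>y. y \<in> W \<Longrightarrow> V c y = span (range (\<lambda>\<alpha>. E \<alpha> y))"
    using E by (auto simp: local_frame_def)
  have xc: "x \<in> snd c ` fst c" using x W(2) by blast
  have spin9: "spin9_module (g c x) (\<lambda>\<alpha>. E \<alpha> x)"
    by (unfold_locales) (simp_all add: cliff[OF x] invertible_metric[OF A g LC c xc] symmetric_metric[OF A g LC c xc])
  interpret spin9_module "g c x" "\<lambda>\<alpha>. E \<alpha> x" by (rule spin9)
  let ?R = "curv (D c) x"
  let ?comm = "\<lambda>i j \<beta>. end_deriv D c i (end_deriv D c j (E \<beta>)) x - end_deriv D c j (end_deriv D c i (E \<beta>)) x"
  have comm: "?comm i j \<beta> = ?R i j ** E \<beta> x - E \<beta> x ** ?R i j" for i j \<beta>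
    by (rule end_deriv_commutator[OF A g LC c xc W(1) x W(2) smooth_E])
  have in_V: "end_deriv D c i S y \<in> V c y" if "smooth_on W S" "\<And>y. y \<in> W \<Longrightarrow> S y \<in> V c y" "y \<in> W" for i S y
    using V c W that unfolding preserved_by_def by blast
  have E_V: "E \<beta> y \<in> V c y" if "y \<in> W" for \<beta> y
    unfolding span[OF that] by (rule span_base) simp
  \<comment> \<open>Since V is preserved, second covariant derivatives of the frame stay in V, so
    commutators with the curvature map V to itself: the hypothesis that places the curvature in
    spin(9).\<close>
  have comm_V: "\<exists>p. ?R i j ** E \<beta> x - E \<beta> x ** ?R i j = (\<Sum>\<alpha>\<in>UNIV. p \<alpha> *\<^sub>R E \<alpha> x)" for i j \<beta>
  proof -
    have "end_deriv D c i (end_deriv D c j (E \<beta>)) x \<in> V c x" for i j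
      by (intro in_V smooth_end_deriv[OF A g LC c xc W smooth_E] smooth_E E_V x)
    then have "?comm i j \<beta> \<in> span (range (\<lambda>\<alpha>. E \<alpha> x))"
      unfolding span[OF x] by (intro span_diff)
    then show ?thesis
      unfolding comm by (rule span_range_explicit)
  qed
  then obtain \<zeta> where \<zeta>: "\<And>i j \<alpha> \<beta>. coframe_coeff (?R i j) \<alpha> \<beta> = \<zeta> * (g c x ** F \<alpha> \<beta>) $ i $ j"
    using comm_V skew_adjoint_curv[OF A g LC c xc] curv_first_bianchi[OF A g LC c xc]
    by (rule_tac curvature_rigidity[of ?R]) (auto simp: curv_def)
  show thesis
  proof (rule that[OF spin9, of "\<zeta> / 2"])
    have "?R i j = \<zeta> *\<^sub>R ((1 / 4) *\<^sub>R (\<Sum>\<alpha>\<in>UNIV. \<Sum>\<beta>\<in>UNIV. (g c x ** F \<alpha> \<beta>) $ i $ j *\<^sub>R F \<alpha> \<beta>))" for i j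
      using spin_element_eq[OF skew_adjoint_curv[OF A g LC c xc] comm_V, of i j]
      by (simp add: \<zeta> scaleR_sum_right)
    then have "?R = (\<lambda>i j. \<zeta> *\<^sub>R ((1 / 4) *\<^sub>R (\<Sum>\<alpha>\<in>UNIV. \<Sum>\<beta>\<in>UNIV. (g c x ** F \<alpha> \<beta>) $ i $ j *\<^sub>R F \<alpha> \<beta>)))"
      by (intro ext)
    then have "curv_form (D c) x = (1 / 2) *\<^sub>R tens (\<lambda>i j. \<zeta> *\<^sub>R ((1 / 4) *\<^sub>R (\<Sum>\<alpha>\<in>UNIV. \<Sum>\<beta>\<in>UNIV. (g c x ** F \<alpha> \<beta>) $ i $ j *\<^sub>R F \<alpha> \<beta>)))"
      by (simp only: curv_form_def)
    then show "curv_form (D c) x = (\<zeta> / 2) *\<^sub>R Xi (g c x) (\<lambda>\<alpha>. E \<alpha> x)"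
      by (simp only: tens_scaleR Xi_def[OF spin9] scaleR_scaleR) simp
    show "psi D c E x = (\<zeta> / 2) *\<^sub>R phi (g c x) (\<lambda>\<alpha>. E \<alpha> x)"
      unfolding vec_eq_iff
    proof (intro allI form_of_inject[THEN iffD1])
      fix \<alpha> \<beta>
      have "psi D c E x $ \<alpha> $ \<beta> = two_form (\<lambda>i j. \<zeta> * (g c x ** F \<alpha> \<beta>) $ i $ j)"
        by (simp add: psi_def comm end_inner_commutator \<zeta>)
      then show "form_of (psi D c E x $ \<alpha> $ \<beta>) = form_of (((\<zeta> / 2) *\<^sub>R phi (g c x) (\<lambda>\<alpha>. E \<alpha> x)) $ \<alpha> $ \<beta>)"
        by (simp add: form_of_two_form_skew[OF GF_skew[OF spin9]] form_of_phi[OF spin9])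
    qed
  qed
qed

lemma Spin9_char_coeff:
  fixes A :: "('a::t2_space, 16) chart set"
  assumes A: "smooth_atlas A" and g: "riemannian_metric A g" and LC: "levi_civita A g D"
    and V: "Spin9_structure A g V" "preserved_by A D V" and c: "c \<in> A" and x: "x \<in> snd c ` fst c"
  shows "char_coeff (D c) 2 x = 0" "char_coeff (D c) 4 x = - tau g D V 4 c x"
    "char_coeff (D c) 6 x = 0" "char_coeff (D c) 8 x = - 13 *\<^sub>R tau g D V 8 c x"
proof -
  \<comment> \<open>The very frame that \<open>tau\<close> selects at this point, so that no two
    frames have to be compared.\<close>
  define E where "E = (SOME E. \<exists>W. x \<in> W \<and> local_frame g V c W E)"
  have "\<exists>W E. x \<in> W \<and> local_frame g V c W E"
    using V(1) c x unfolding Spin9_structure_def by (elim conjE) (drule (1) bspec)+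
  then obtain W E' where "x \<in> W \<and> local_frame g V c W E'" by (elim exE)
  then have "\<exists>W. x \<in> W \<and> local_frame g V c W E'" by (rule exI)
  then have "\<exists>W. x \<in> W \<and> local_frame g V c W E"
    unfolding E_def by (rule someI[where P = "\<lambda>E. \<exists>W. x \<in> W \<and> local_frame g V c W E"])
  then obtain W where W: "x \<in> W" "local_frame g V c W E" by blast
  obtain r where r: "spin9_module (g c x) (\<lambda>\<alpha>. E \<alpha> x)"
    "curv_form (D c) x = r *\<^sub>R Xi (g c x) (\<lambda>\<alpha>. E \<alpha> x)" "psi D c E x = r *\<^sub>R phi (g c x) (\<lambda>\<alpha>. E \<alpha> x)"
    by (rule Spin9_curvature[OF A g LC V(2) c W])
  have tau: "tau g D V k c x = form_of (newton (\<lambda>i. trace (mpow (psi D c E x) i)) k)" if "k \<le> 9" for k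
    using char_form_coeff[of k "psi D c E x"] that unfolding tau_def E_def[symmetric] by simp
  show "char_coeff (D c) 2 x = 0" "char_coeff (D c) 4 x = - tau g D V 4 c x"
    "char_coeff (D c) 6 x = 0" "char_coeff (D c) 8 x = - 13 *\<^sub>R tau g D V 8 c x"
    unfolding char_coeff_def tau[of 4, simplified] tau[of 8, simplified] by (rule char_coeff_relations[OF r])+
qed

theorem corollary7p3:
  fixes A :: "('a::t2_space, 16) chart set"
    and g :: "('a, 16) metric"
    and D :: "('a, 16) connection"
    and V :: "('a, 16) end_subbundle"
  assumes "compact (UNIV :: 'a set)" and "connected (UNIV :: 'a set)"
    and "smooth_atlas A"
    and "riemannian_metric A g"
    and "levi_civita A g D"
    and "has_holonomy_Spin9 A g D"
    and "Spin9_structure A g V"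
    and "preserved_by A D V"
  shows "pontrjagin_class A 1 = de_rham_class A 4 (\<lambda>c x. 0) \<and>
    pontrjagin_class A 2 = de_rham_class A 8 (\<lambda>c x. (- 45 / (2 * pi ^ 4)) *\<^sub>R Phi_Spin9 g D V c x) \<and>
    pontrjagin_class A 3 = de_rham_class A 12 (\<lambda>c x. 0) \<and>
    pontrjagin_class A 4 = de_rham_class A 16 (\<lambda>c x. (- 13 / (256 * pi ^ 8)) *\<^sub>R tau g D V 8 c x)"
proof -
  have D: "is_connection A D" using assms(5) by (simp add: levi_civita_def)
  have p: "pontrjagin_class A k = de_rham_class A (4 * k) \<omega>"
    if "0 < k" "k \<le> 8" "\<And>c x. c \<in> A \<Longrightarrow> x \<in> snd c ` fst c \<Longrightarrow> (1 / (2 * pi)) ^ (2 * k) *\<^sub>R char_coeff (D c) (2 * k) x = \<omega> c x" for k \<omega>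
    unfolding pontrjagin_class_eq[OF assms(3) D that(1)] using that
    by (subst pontrjagin_class_eq[OF assms(3) D]) (auto intro!: de_rham_class_cong)
  \<comment> \<open>The constants come from the normalisation by (2 pi)^(-2k): 360 / (2 pi)^4 = 45 /
    (2 pi^4), where 360 is the factor in the definition of the canonical 8-form, and 13 / (2 pi)^8 =
    13 / (256 pi^8).\<close>
  note coeffs = Spin9_char_coeff[OF assms(3,4,5,7,8)]
  show ?thesis
    using p[of 1 "\<lambda>c x. 0"] p[of 2 "\<lambda>c x. (- 45 / (2 * pi ^ 4)) *\<^sub>R Phi_Spin9 g D V c x"]
      p[of 3 "\<lambda>c x. 0"] p[of 4 "\<lambda>c x. (- 13 / (256 * pi ^ 8)) *\<^sub>R tau g D V 8 c x"]
    by (simp add: coeffs Phi_Spin9_def power_divide power_mult_distrib)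
qed

end
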